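(* Let $R$ be a countable Boolean ring with Stone space $X$, and let $J_{1},\ldots,J_{n}$ be ideals of $R$ corresponding to the closed subsets $C_{1},\ldots,C_{n}$ of $X$ (i.e. $J_{i}=I(C_{i})=\{A\in R\mid A\cap C_{i}=\emptyset\}$). Write $\boldsymbol{C}^{\{n\}}=\{C_{1},\ldots,C_{n}\}$. Then the following are equivalent: (1) the system $(R,J_{1},\ldots,J_{n})$ is $\omega$-categorical; (2) the closure subalgebra $\langle\boldsymbol{C}^{\{n\}},^{-}\rangle$ of $2^{X}$ is finite, and each of its atoms has only finitely many isolated points; (3) the sub-TBA $\langle\boldsymbol{C}^{\{n\}},^{\prime}\rangle$ of $2^{X}$ is finite, and its atoms form a finite-crowded partition of $X$; (4) the atoms of $\langle\boldsymbol{C}^{\{n\}},^{\prime}\rangle$ form a finite-crowded complete $P$-partition of $X$ for some finite PO system $P$; (5) $\boldsymbol{C}^{\{n\}}$ can be refined to a finite-crowded complete $P$-partition of $X$ for some finite PO system $P$.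
   Context: Boolean rings need not have an identity. The Stone space $X$ of a Boolean ring $R$ is the locally compact, totally disconnected Hausdorff space whose compact open subsets form a ring isomorphic to $R$; we identify $R$ with the ring of compact open subsets of $X$. Closed subsets $C$ of $X$ correspond to ideals $I(C)=\{A\in R\mid A\cap C=\emptyset\}$. A system $(R,J_{1},\ldots,J_{n})$ is regarded as a structure in the language of Boolean rings with $n$ additional unary predicates; a countable structure is $\omega$-categorical if its first-order theory has, up to isomorphism, exactly one countable model. For a topological space $X$ and $S\subseteq X$, $S^{\prime}$ denotes the derived set (set of limit points) of $S$ and $\overline{S}$ the closure. $S$ is crowded if it has no isolated points (i.e. $S\subseteq S^{\prime}$). The power set $2^{X}$ is a closure algebra (Boolean algebra with closure operator $^{-}$) and a topological Boolean algebra (TBA: Boolean algebra with unary operator $^{\prime}$). For $\mathcal{A}\subseteq2^{X}$, $\langle\mathcal{A},^{-}\rangle$ denotes the smallest Boolean subalgebra of $2^{X}$ containing $\mathcal{A}$ (and $X$) and closed under closure, and $\langle\mathcal{A},^{\prime}\rangle$ the smallest Boolean subalgebra of $2^{X}$ containing $\mathcal{A}$ (and $X$) and closed under taking derived sets. An isolated point of a subset $A$ is a point of $A$ isolated in the subspace $A$. A PO system is a set $P$ with an antisymmetric transitive relation $<$ (so possibly $p<p$ for some $p$). A partition $\mathscr{X}$ of $X$ is a complete $P$-partition if it can be labelled $\mathscr{X}=\{X_{p}\mid p\in P\}$ with $X_{p}^{\prime}=\bigcup_{q<p}X_{q}$ for all $p\in P$. A partition is finite-crowded if it is finite and each of its elements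 is either finite or crowded. A partition $\{X_{p}\mid p\in P\}$ refines a family $\{A_{i}\}$ of subsets if each $A_{i}$ is a union of some of the $X_{p}$. *)

theory Defs
  imports "HOL-Analysis.Analysis" "HOL-Library.Disjoint_Sets"
begin

text \<open>The type class \<open>ring\<close> does not require a multiplicative identity. A Boolean ring is a type
  of this class in which \<open>x * x = x\<close> for all \<open>x\<close>.\<close>

definition ring_ideal :: "'r::ring set \<Rightarrow> bool" where
  "ring_ideal J \<longleftrightarrow>
     0 \<in> J \<and> (\<forall>a\<in>J. \<forall>b\<in>J. a - b \<in> J) \<and> (\<forall>a\<in>J. \<forall>r. r * a \<in> J \<and> a * r \<in> J)"

definition totally_disconnected_space :: "'x topology \<Rightarrow> bool" where
  "totally_disconnected_space X \<longleftrightarrow> (\<forall>S. connectedin X S \<longrightarrow> (\<exists>a. S \<subseteq> {a}))"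

definition compact_opens :: "'x topology \<Rightarrow> 'x set set" where
  "compact_opens X = {A. openin X A \<and> compactin X A}"

text \<open>\<open>stone_space X \<phi>\<close>: the space \<open>X\<close> is the Stone space of the Boolean ring \<open>'r\<close>, and \<open>\<phi>\<close> is the
  isomorphism identifying \<open>'r\<close> with the ring of compact open subsets of \<open>X\<close>, whose addition is
  symmetric difference and whose multiplication is intersection.\<close>

definition stone_space :: "'x topology \<Rightarrow> ('r::ring \<Rightarrow> 'x set) \<Rightarrow> bool" where
  "stone_space X \<phi> \<longleftrightarrow>
     locally_compact_space X \<and> totally_disconnected_space X \<and> Hausdorff_space X \<and>
     bij_betw \<phi> UNIV (compact_opens X) \<and>
     (\<forall>a b. \<phi> (a + b) = (\<phi> a - \<phi> b) \<union> (\<phi> b - \<phi> a)) \<and>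
     (\<forall>a b. \<phi> (a * b) = \<phi> a \<inter> \<phi> b)"

definition ideal_of_closed :: "('r \<Rightarrow> 'x set) \<Rightarrow> 'x set \<Rightarrow> 'r set" where
  "ideal_of_closed \<phi> C = {a. \<phi> a \<inter> C = {}}"

datatype bterm = TVar nat | TZero | TAdd bterm bterm | TMult bterm bterm

datatype fm =
    Eq bterm bterm
  | Pred nat bterm
  | Neg fm
  | Conj fm fm
  | Exists nat fm

fun term_vars :: "bterm \<Rightarrow> nat set" where
  "term_vars (TVar k) = {k}"
| "term_vars TZero = {}"
| "term_vars (TAdd s t) = term_vars s \<union> term_vars t"
| "term_vars (TMult s t) = term_vars s \<union> term_vars t"

fun free_vars :: "fm \<Rightarrow> nat set" where
  "free_vars (Eq s t) = term_vars s \<union> term_vars t"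
| "free_vars (Pred i t) = term_vars t"
| "free_vars (Neg p) = free_vars p"
| "free_vars (Conj p q) = free_vars p \<union> free_vars q"
| "free_vars (Exists k p) = free_vars p - {k}"

fun pred_symbols :: "fm \<Rightarrow> nat set" where
  "pred_symbols (Eq s t) = {}"
| "pred_symbols (Pred i t) = {i}"
| "pred_symbols (Neg p) = pred_symbols p"
| "pred_symbols (Conj p q) = pred_symbols p \<union> pred_symbols q"
| "pred_symbols (Exists k p) = pred_symbols p"

text \<open>The language with \<open>n\<close> unary predicates uses the predicate symbols \<open>1, \<dots>, n\<close>.\<close>

definition sentences :: "nat \<Rightarrow> fm set" where
  "sentences n = {p. free_vars p = {} \<and> pred_symbols p \<subseteq> {1..n}}"

record 'a ring_system =
  univ :: "'a set"
  zero_of :: 'a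
  add_of :: "'a \<Rightarrow> 'a \<Rightarrow> 'a"
  mult_of :: "'a \<Rightarrow> 'a \<Rightarrow> 'a"
  pred_of :: "nat \<Rightarrow> 'a set"

definition wf_system :: "nat \<Rightarrow> 'a ring_system \<Rightarrow> bool" where
  "wf_system n M \<longleftrightarrow>
     zero_of M \<in> univ M \<and>
     (\<forall>a\<in>univ M. \<forall>b\<in>univ M. add_of M a b \<in> univ M \<and> mult_of M a b \<in> univ M) \<and>
     (\<forall>i\<in>{1..n}. pred_of M i \<subseteq> univ M)"

fun term_val :: "'a ring_system \<Rightarrow> (nat \<Rightarrow> 'a) \<Rightarrow> bterm \<Rightarrow> 'a" where
  "term_val M e (TVar k) = e k"
| "term_val M e TZero = zero_of M"
| "term_val M e (TAdd s t) = add_of M (term_val M e s) (term_val M e t)"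
| "term_val M e (TMult s t) = mult_of M (term_val M e s) (term_val M e t)"

fun sat :: "'a ring_system \<Rightarrow> (nat \<Rightarrow> 'a) \<Rightarrow> fm \<Rightarrow> bool" where
  "sat M e (Eq s t) \<longleftrightarrow> term_val M e s = term_val M e t"
| "sat M e (Pred i t) \<longleftrightarrow> term_val M e t \<in> pred_of M i"
| "sat M e (Neg p) \<longleftrightarrow> \<not> sat M e p"
| "sat M e (Conj p q) \<longleftrightarrow> sat M e p \<and> sat M e q"
| "sat M e (Exists k p) \<longleftrightarrow> (\<exists>a\<in>univ M. sat M (e(k := a)) p)"

definition holds_in :: "'a ring_system \<Rightarrow> fm \<Rightarrow> bool" where
  "holds_in M p \<longleftrightarrow> (\<forall>e. range e \<subseteq> univ M \<longrightarrow> sat M e p)"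

definition theory_of :: "nat \<Rightarrow> 'a ring_system \<Rightarrow> fm set" where
  "theory_of n M = {p \<in> sentences n. holds_in M p}"

definition model_of :: "nat \<Rightarrow> fm set \<Rightarrow> 'a ring_system \<Rightarrow> bool" where
  "model_of n T M \<longleftrightarrow> wf_system n M \<and> (\<forall>p\<in>T. holds_in M p)"

definition isomorphic_systems :: "nat \<Rightarrow> 'a ring_system \<Rightarrow> 'b ring_system \<Rightarrow> bool" where
  "isomorphic_systems n M N \<longleftrightarrow>
     (\<exists>h. bij_betw h (univ M) (univ N) \<and>
          h (zero_of M) = zero_of N \<and>
          (\<forall>a\<in>univ M. \<forall>b\<in>univ M.
             h (add_of M a b) = add_of N (h a) (h b) \<and>
             h (mult_of M a b) = mult_of N (h a) (h b)) \<and>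
          (\<forall>i\<in>{1..n}. \<forall>a\<in>univ M. a \<in> pred_of M i \<longleftrightarrow> h a \<in> pred_of N i))"

text \<open>Countable means finite or countably infinite. Every countable structure is isomorphic to one
  whose universe is a set of natural numbers, so it suffices to quantify over such structures.\<close>

definition omega_categorical :: "nat \<Rightarrow> 'a ring_system \<Rightarrow> bool" where
  "omega_categorical n M \<longleftrightarrow>
     (\<exists>N :: nat ring_system. model_of n (theory_of n M) N \<and>
        (\<forall>N' :: nat ring_system. model_of n (theory_of n M) N' \<longrightarrow> isomorphic_systems n N' N))"

definition system_of :: "(nat \<Rightarrow> 'r::ring set) \<Rightarrow> 'r ring_system" where
  "system_of J = \<lparr>univ = UNIV, zero_of = 0, add_of = (+), mult_of = (*), pred_of = J\<rparr>"

text \<open>The library predicate \<open>algebra U \<B>\<close> says that \<open>\<B>\<close> is a Boolean subalgebra of \<open>Pow U\<close>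
  (containing \<open>U\<close>).\<close>

definition closure_subalgebra :: "'x topology \<Rightarrow> 'x set set \<Rightarrow> 'x set set" where
  "closure_subalgebra X \<A> =
     (\<lambda>\<B>. algebra (topspace X) \<B> \<and> (\<forall>S\<in>\<B>. X closure_of S \<in> \<B>)) hull \<A>"

definition derived_subalgebra :: "'x topology \<Rightarrow> 'x set set \<Rightarrow> 'x set set" where
  "derived_subalgebra X \<A> =
     (\<lambda>\<B>. algebra (topspace X) \<B> \<and> (\<forall>S\<in>\<B>. X derived_set_of S \<in> \<B>)) hull \<A>"

definition atoms :: "'x set set \<Rightarrow> 'x set set" where
  "atoms \<B> = {A \<in> \<B>. A \<noteq> {} \<and> (\<forall>B\<in>\<B>. B \<subseteq> A \<longrightarrow> B = {} \<or> B = A)}"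

definition isolated_points :: "'x topology \<Rightarrow> 'x set \<Rightarrow> 'x set" where
  "isolated_points X A = {x \<in> A. openin (subtopology X A) {x}}"

definition crowded :: "'x topology \<Rightarrow> 'x set \<Rightarrow> bool" where
  "crowded X A \<longleftrightarrow> isolated_points X A = {}"

lemma isolated_points_eq:
  assumes "A \<subseteq> topspace X"
  shows "isolated_points X A = A - X derived_set_of A"
proof -
  have "openin (subtopology X A) {x} \<longleftrightarrow> x \<notin> X derived_set_of A" if "x \<in> A" for x
  proof -
    have "openin (subtopology X A) {x} \<longleftrightarrow> (\<exists>T. openin X T \<and> T \<inter> A = {x})"
      by (auto simp: openin_subtopology)
    also have "\<dots> \<longleftrightarrow> x \<notin> X derived_set_of A"
      using that assms by (auto simp: in_derived_set_of)
    finally show ?thesis .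
  qed
  then show ?thesis
    by (auto simp: isolated_points_def)
qed

lemma crowded_iff_subset_derived_set_of:
  "A \<subseteq> topspace X \<Longrightarrow> crowded X A \<longleftrightarrow> A \<subseteq> X derived_set_of A"
  by (auto simp: crowded_def isolated_points_eq)

definition finite_crowded_partition :: "'x topology \<Rightarrow> 'x set set \<Rightarrow> bool" where
  "finite_crowded_partition X \<X> \<longleftrightarrow>
     partition_on (topspace X) \<X> \<and> finite \<X> \<and> (\<forall>A\<in>\<X>. finite A \<or> crowded X A)"

definition PO_system :: "'p set \<Rightarrow> 'p rel \<Rightarrow> bool" where
  "PO_system P r \<longleftrightarrow> r \<subseteq> P \<times> P \<and> antisym r \<and> trans r"

text \<open>Here \<open>(q, p) \<in> r\<close> stands for \<open>q < p\<close>; the labelling \<open>L\<close> maps \<open>p\<close> to \<open>X\<^sub>p\<close>.\<close>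

definition complete_partition :: "'x topology \<Rightarrow> 'p set \<Rightarrow> 'p rel \<Rightarrow> 'x set set \<Rightarrow> bool" where
  "complete_partition X P r \<X> \<longleftrightarrow>
     partition_on (topspace X) \<X> \<and>
     (\<exists>L. bij_betw L P \<X> \<and> (\<forall>p\<in>P. X derived_set_of (L p) = \<Union> {L q |q. (q, p) \<in> r}))"

definition refines_family :: "'x set set \<Rightarrow> 'x set set \<Rightarrow> bool" where
  "refines_family \<X> \<A> \<longleftrightarrow> (\<forall>A\<in>\<A>. \<exists>\<S>\<subseteq>\<X>. A = \<Union>\<S>)"

text \<open>A finite PO system may be taken to have natural numbers as its elements.\<close>

definition finite_crowded_complete_partition :: "'x topology \<Rightarrow> 'x set set \<Rightarrow> bool" where
  "finite_crowded_complete_partition X \<X> \<longleftrightarrow>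
     finite_crowded_partition X \<X> \<and>
     (\<exists>(P :: nat set) r. finite P \<and> PO_system P r \<and> complete_partition X P r \<X>)"

end

theory Submission
  imports Defs "HOL-Library.Countable"
begin

text \<open>The four topological conditions are linked by partitions whose blocks \<open>B\<close> satisfy
  \<open>B \<inter> A' \<noteq> {} \<longrightarrow> B \<subseteq> A'\<close>, so that unions of blocks form a sub-TBA. Antisymmetry of the order on the
  atoms holds because the generators are closed: two atoms contained in each other's derived set
  lie in the same closed sets.

  If the system is \<open>\<omega>\<close>-categorical, then only finitely many subsets of \<open>R\<close> are definable: otherwise
  a non-principal 1-type is realised in one countable model and omitted in another, both being Henkin
  term models whose elements are variables. For every \<open>S\<close> in the closure algebra the ideal
  \<open>{A. A \<inter> S = {}}\<close> is definable, as is the number of points of \<open>A \<inter> S\<close> up to any bound; hence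
  the closure algebra is finite and its members have finitely many isolated points.

  Conversely, given a finite-crowded partition as above, attach to a clopen set \<open>S\<close>, for every block
  \<open>A\<close>, the number of points of \<open>S \<inter> A\<close> if \<open>A\<close> is finite, whether \<open>S \<inter> A\<close> is empty, and whether \<open>S\<close>
  meets the closure of \<open>A\<close> in a compact set. A compact open part of \<open>S\<close> can be matched in every
  clopen \<open>T\<close> with the same invariants, so the invariants of the cells of a tuple from \<open>R\<close> determine
  its type. Thus there are finitely many \<open>k\<close>-types for every \<open>k\<close>, all of them isolated, and
  back-and-forth gives categoricity.\<close>

section \<open>Definable relations in ring systems\<close>

text \<open>Since \<open>R\<close> need not have an identity, the complement of the union of a tuple
  is a clopen set that may fail to be compact; hence the compactness entry of the invariants. A
  compact open part \<open>U\<close> of \<open>S\<close> swallows \<open>S \<inter> A\<close> for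
  some blocks \<open>A\<close>, and the matching part of \<open>T\<close> must swallow
  \<open>T \<inter> A\<close>; this is possible only if \<open>T\<close> meets the closure of
  \<open>A\<close> in a compact set. The obstacle in the other direction is that the ring sees a set
  \<open>S\<close> only through the compact open sets that miss it, so it does not distinguish
  \<open>S\<close> from its closure. Finiteness of the set of definable ideals therefore bounds only
  the closed members of the closure algebra, and the whole algebra has to be recovered from these.
  Definability and types are handled as predicates on assignments. A type with witnesses is a filter
  of such predicates, so a single generic construction yields both the model that realises a given
  type and the one that omits it.\<close>

instance bterm :: countable
  by countable_datatype

instance fm :: countable
  by countable_datatype

definition assignments :: "'a ring_system \<Rightarrow> (nat \<Rightarrow> 'a) set" where
  "assignments M = {e. range e \<subseteq> univ M}"

lemma assignments_apply: "e \<in> assignments M \<Longrightarrow> e i \<in> univ M"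
  by (auto simp: assignments_def)

lemma assignments_upd: "e \<in> assignments M \<Longrightarrow> a \<in> univ M \<Longrightarrow> e(k := a) \<in> assignments M"
  by (auto simp: assignments_def)

lemma assignments_comp: "e \<in> assignments M \<Longrightarrow> e \<circ> s \<in> assignments M"
  by (auto simp: assignments_def)

lemma assignments_const: "a \<in> univ M \<Longrightarrow> (\<lambda>_. a) \<in> assignments M"
  by (auto simp: assignments_def)

lemma wf_system_univ_nonempty: "wf_system n M \<Longrightarrow> univ M \<noteq> {}"
  by (auto simp: wf_system_def)

lemma term_val_cong:
  "(\<And>i. i \<in> term_vars t \<Longrightarrow> e i = e' i) \<Longrightarrow> term_val M e t = term_val M e' t"
proof (induction t)
  case (TAdd s t)
  then have "term_val M e s = term_val M e' s" "term_val M e t = term_val M e' t" by auto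
  then show ?case by simp
next
  case (TMult s t)
  then have "term_val M e s = term_val M e' s" "term_val M e t = term_val M e' t" by auto
  then show ?case by simp
qed auto

lemma sat_cong:
  "(\<And>i. i \<in> free_vars p \<Longrightarrow> e i = e' i) \<Longrightarrow> sat M e p = sat M e' p"
proof (induction p arbitrary: e e')
  case (Eq s t)
  have "term_val M e s = term_val M e' s" "term_val M e t = term_val M e' t"
    using Eq by (intro term_val_cong; simp)+
  then show ?case by simp
next
  case (Pred i t)
  have "term_val M e t = term_val M e' t"
    using Pred by (intro term_val_cong) simp
  then show ?case by simp
next
  case (Neg p)
  have "sat M e p = sat M e' p" by (rule Neg.IH) (use Neg.prems in simp)
  then show ?case by simp
next
  case (Conj p q)
  have "sat M e p = sat M e' p" by (rule Conj.IH) (use Conj.prems in simp)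
  moreover have "sat M e q = sat M e' q" by (rule Conj.IH) (use Conj.prems in simp)
  ultimately show ?case by simp
next
  case (Exists k p)
  have "sat M (e(k := a)) p = sat M (e'(k := a)) p" for a
    using Exists.prems by (intro Exists.IH) auto
  then show ?case by simp
qed

lemma finite_term_vars: "finite (term_vars t)"
  by (induction t) auto

lemma finite_free_vars: "finite (free_vars p)"
  by (induction p) (auto simp: finite_term_vars)

lemma term_val_in_univ:
  "wf_system n M \<Longrightarrow> e \<in> assignments M \<Longrightarrow> term_val M e t \<in> univ M"
  by (induction t) (auto simp: wf_system_def assignments_apply)

lemma sat_iso:
  assumes wf: "wf_system n M"
    and inj: "inj_on h (univ M)" and sur: "h ` univ M = univ N"
    and zero: "h (zero_of M) = zero_of N"
    and ops: "\<And>a b. a \<in> univ M \<Longrightarrow> b \<in> univ M \<Longrightarrow>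
      h (add_of M a b) = add_of N (h a) (h b) \<and> h (mult_of M a b) = mult_of N (h a) (h b)"
    and preds: "\<And>i a. i \<in> {1..n} \<Longrightarrow> a \<in> univ M \<Longrightarrow> a \<in> pred_of M i \<longleftrightarrow> h a \<in> pred_of N i"
    and "pred_symbols p \<subseteq> {1..n}" "e \<in> assignments M"
  shows "sat N (h \<circ> e) p = sat M e p"
proof -
  have t: "term_val N (h \<circ> e) t = h (term_val M e t)" if "e \<in> assignments M" for e t
  proof (induction t)
    case (TAdd s t)
    then show ?case using ops[OF term_val_in_univ[OF wf that] term_val_in_univ[OF wf that]] by simp
  next
    case (TMult s t)
    then show ?case using ops[OF term_val_in_univ[OF wf that] term_val_in_univ[OF wf that]] by simp
  qed (use zero in auto)
  show ?thesis
    using \<open>pred_symbols p \<subseteq> {1..n}\<close> \<open>e \<in> assignments M\<close>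
  proof (induction p arbitrary: e)
    case (Eq s u)
    have "term_val M e s \<in> univ M" "term_val M e u \<in> univ M"
      using term_val_in_univ[OF wf Eq(2)] by auto
    then show ?case using t[OF Eq(2)] inj unfolding sat.simps by (metis inj_onD)
  next
    case (Pred i u)
    then have "i \<in> {1..n}" by simp
    then show ?case using t[OF Pred(2)] preds term_val_in_univ[OF wf Pred(2)] unfolding sat.simps by metis
  next
    case (Exists k p)
    have "sat N ((h \<circ> e)(k := h a)) p = sat M (e(k := a)) p" if "a \<in> univ M" for a
    proof -
      have "(h \<circ> e)(k := h a) = h \<circ> e(k := a)" by auto
      moreover have "sat N (h \<circ> e(k := a)) p = sat M (e(k := a)) p"
        using Exists.prems that by (intro Exists.IH assignments_upd) simp_all
      ultimately show ?thesis by simp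
    qed
    then show ?case unfolding sat.simps sur[symmetric] by blast
  qed auto
qed

text \<open>Definability without parameters, as a property of predicates on assignments: rules for
  the connectives then replace explicit formulas.\<close>

definition definable :: "nat \<Rightarrow> 'a ring_system \<Rightarrow> ((nat \<Rightarrow> 'a) \<Rightarrow> bool) \<Rightarrow> bool" where
  "definable n M Q \<longleftrightarrow>
     (\<exists>p. pred_symbols p \<subseteq> {1..n} \<and> (\<forall>e\<in>assignments M. sat M e p \<longleftrightarrow> Q e))"

lemma definable_sat: "pred_symbols p \<subseteq> {1..n} \<Longrightarrow> definable n M (\<lambda>e. sat M e p)"
  by (auto simp: definable_def)

lemma definable_cong:
  "definable n M Q \<Longrightarrow> (\<And>e. e \<in> assignments M \<Longrightarrow> Q e = Q' e) \<Longrightarrow> definable n M Q'"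
  unfolding definable_def by (metis (full_types))

lemma definable_not: "definable n M Q \<Longrightarrow> definable n M (\<lambda>e. \<not> Q e)"
  unfolding definable_def by (metis pred_symbols.simps(3) sat.simps(3))

lemma definable_conj:
  assumes "definable n M Q" "definable n M Q'"
  shows "definable n M (\<lambda>e. Q e \<and> Q' e)"
proof -
  from assms(1) obtain p where "pred_symbols p \<subseteq> {1..n}" "\<forall>e\<in>assignments M. sat M e p \<longleftrightarrow> Q e"
    unfolding definable_def by blast
  moreover from assms(2) obtain p' where
    "pred_symbols p' \<subseteq> {1..n}" "\<forall>e\<in>assignments M. sat M e p' \<longleftrightarrow> Q' e"
    unfolding definable_def by blast
  ultimately have "pred_symbols (Conj p p') \<subseteq> {1..n} \<and>
      (\<forall>e\<in>assignments M. sat M e (Conj p p') \<longleftrightarrow> Q e \<and> Q' e)"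
    by simp
  then show ?thesis unfolding definable_def by blast
qed

lemma definable_disj:
  "definable n M Q \<Longrightarrow> definable n M Q' \<Longrightarrow> definable n M (\<lambda>e. Q e \<or> Q' e)"
  by (rule definable_cong[of n M "\<lambda>e. \<not> (\<not> Q e \<and> \<not> Q' e)"])
    (intro definable_not definable_conj, blast+)

lemma definable_imp:
  "definable n M Q \<Longrightarrow> definable n M Q' \<Longrightarrow> definable n M (\<lambda>e. Q e \<longrightarrow> Q' e)"
  by (rule definable_cong[of n M "\<lambda>e. \<not> Q e \<or> Q' e"]) (intro definable_not definable_disj, blast+)

lemma definable_ex:
  assumes "definable n M Q"
  shows "definable n M (\<lambda>e. \<exists>a\<in>univ M. Q (e(k := a)))"
proof -
  obtain p where "pred_symbols p \<subseteq> {1..n}" "\<forall>e\<in>assignments M. sat M e p \<longleftrightarrow> Q e"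
    using assms unfolding definable_def by metis
  then show ?thesis
    unfolding definable_def by (intro exI[of _ "Exists k p"]) (auto simp: assignments_upd)
qed

lemma definable_term_eq: "definable n M (\<lambda>e. term_val M e s = term_val M e t)"
  using definable_sat[of "Eq s t"] by simp

lemma definable_pred: "i \<in> {1..n} \<Longrightarrow> definable n M (\<lambda>e. term_val M e t \<in> pred_of M i)"
  using definable_sat[of "Pred i t" n] by simp

lemma definable_support:
  assumes "definable n M Q"
  obtains V where "finite V"
    "\<And>e e'. e \<in> assignments M \<Longrightarrow> e' \<in> assignments M \<Longrightarrow> (\<And>i. i \<in> V \<Longrightarrow> e i = e' i) \<Longrightarrow> Q e = Q e'"
proof -
  obtain p where p: "\<forall>e\<in>assignments M. sat M e p \<longleftrightarrow> Q e"
    using assms unfolding definable_def by metis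
  show thesis
  proof (rule that[of "free_vars p"])
    fix e e' assume e: "e \<in> assignments M" "e' \<in> assignments M" "\<And>i. i \<in> free_vars p \<Longrightarrow> e i = e' i"
    have "sat M e p = sat M e' p" by (rule sat_cong) (rule e(3))
    then show "Q e = Q e'" using p e(1,2) by blast
  qed (rule finite_free_vars)
qed

section \<open>Renaming variables and eliminating irrelevant ones\<close>

fun rename_term :: "(nat \<Rightarrow> nat) \<Rightarrow> bterm \<Rightarrow> bterm" where
  "rename_term s (TVar k) = TVar (s k)"
| "rename_term s TZero = TZero"
| "rename_term s (TAdd t u) = TAdd (rename_term s t) (rename_term s u)"
| "rename_term s (TMult t u) = TMult (rename_term s t) (rename_term s u)"

lemma term_val_rename: "term_val M e (rename_term s t) = term_val M (e \<circ> s) t"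
  by (induction t) auto

lemma definable_rename:
  "pred_symbols p \<subseteq> {1..n} \<Longrightarrow> definable n M (\<lambda>e. sat M (e \<circ> s) p)"
proof (induction p arbitrary: s)
  case (Eq t u)
  then show ?case
    using definable_term_eq[of n M "rename_term s t" "rename_term s u"]
    unfolding term_val_rename sat.simps by blast
next
  case (Pred i t)
  then have "i \<in> {1..n}" by simp
  then show ?case
    using definable_pred[of i n M "rename_term s t"] unfolding term_val_rename
    unfolding sat.simps pred_symbols.simps by blast
next
  case (Neg p)
  then show ?case by (auto intro: definable_not)
next
  case (Conj p q)
  then show ?case by (auto intro: definable_conj)
next
  case (Exists k p)
  \<comment> \<open>Renaming under the quantifier must not capture: the bound variable
    \<open>k\<close> becomes an index \<open>j\<close> that no renamed free variable uses.\<close>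
  obtain j where j: "j \<notin> s ` free_vars p"
    using finite_free_vars ex_new_if_finite infinite_UNIV_nat by blast
  have *: "definable n M (\<lambda>e. sat M (e \<circ> s(k := j)) p)"
    by (rule Exists.IH) (use Exists.prems in simp)
  have "sat M (e(j := a) \<circ> s(k := j)) p = sat M ((e \<circ> s)(k := a)) p" for e a
    using j by (intro sat_cong) auto
  then show ?case
    using definable_ex[OF *, of j] unfolding sat.simps by simp
qed

lemma free_vars_foldr_Exists: "free_vars (foldr Exists ks p) = free_vars p - set ks"
  by (induction ks) auto

lemma pred_symbols_foldr_Exists: "pred_symbols (foldr Exists ks p) = pred_symbols p"
  by (induction ks) auto

lemma sat_foldr_Exists:
  "e \<in> assignments M \<Longrightarrow> sat M e (foldr Exists ks p) \<longleftrightarrow>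
     (\<exists>e'\<in>assignments M. (\<forall>i. i \<notin> set ks \<longrightarrow> e' i = e i) \<and> sat M e' p)"
proof (induction ks arbitrary: e)
  case Nil
  have "(\<forall>i. e' i = e i) \<longleftrightarrow> e' = e" for e' by auto
  then show ?case using Nil by auto
next
  case (Cons k ks)
  show ?case
  proof
    assume "sat M e (foldr Exists (k # ks) p)"
    then obtain a where a: "a \<in> univ M" "sat M (e(k := a)) (foldr Exists ks p)" by auto
    then obtain e' where "e' \<in> assignments M" "\<forall>i. i \<notin> set ks \<longrightarrow> e' i = (e(k := a)) i" "sat M e' p"
      using Cons.IH[OF assignments_upd[OF Cons.prems a(1)]] by blast
    then show "\<exists>e'\<in>assignments M. (\<forall>i. i \<notin> set (k # ks) \<longrightarrow> e' i = e i) \<and> sat M e' p"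
      by (intro bexI[of _ e']) auto
  next
    assume "\<exists>e'\<in>assignments M. (\<forall>i. i \<notin> set (k # ks) \<longrightarrow> e' i = e i) \<and> sat M e' p"
    then obtain e' where e': "e' \<in> assignments M" "\<forall>i. i \<notin> set (k # ks) \<longrightarrow> e' i = e i" "sat M e' p"
      by auto
    have "e' k \<in> univ M" using assignments_apply[OF e'(1)] .
    moreover have "\<forall>i. i \<notin> set ks \<longrightarrow> e' i = (e(k := e' k)) i" using e'(2) by auto
    ultimately have "sat M (e(k := e' k)) (foldr Exists ks p)"
      using Cons.IH[OF assignments_upd[OF Cons.prems \<open>e' k \<in> univ M\<close>]] e' by blast
    then show "sat M e (foldr Exists (k # ks) p)" using \<open>e' k \<in> univ M\<close> by auto
  qed
qed

text \<open>The variables of \<open>p\<close> outside \<open>V\<close> are quantified away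
  existentially. This does not change the truth value, because \<open>Q\<close> ignores what an
  assignment does outside \<open>V\<close>.\<close>

lemma definable_formula:
  assumes "definable n M Q" "univ M \<noteq> {}"
    and dep: "\<And>e e'. e \<in> assignments M \<Longrightarrow> e' \<in> assignments M \<Longrightarrow> (\<And>i. i \<in> V \<Longrightarrow> e i = e' i) \<Longrightarrow> Q e = Q e'"
  obtains p where "pred_symbols p \<subseteq> {1..n}" "free_vars p \<subseteq> V" "\<And>e. e \<in> assignments M \<Longrightarrow> sat M e p \<longleftrightarrow> Q e"
proof -
  obtain p where p: "pred_symbols p \<subseteq> {1..n}" "\<forall>e\<in>assignments M. sat M e p \<longleftrightarrow> Q e"
    using assms(1) unfolding definable_def by metis
  define q where "q = foldr Exists (sorted_list_of_set (free_vars p - V)) p"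
  have fin: "finite (free_vars p - V)" using finite_free_vars by auto
  have q: "pred_symbols q \<subseteq> {1..n}" "free_vars q = free_vars p - (free_vars p - V)"
    "\<And>e. e \<in> assignments M \<Longrightarrow> sat M e q \<longleftrightarrow>
      (\<exists>e'\<in>assignments M. (\<forall>i. i \<notin> free_vars p - V \<longrightarrow> e' i = e i) \<and> sat M e' p)"
    using p(1) fin unfolding q_def
    by (simp_all only: pred_symbols_foldr_Exists free_vars_foldr_Exists sat_foldr_Exists set_sorted_list_of_set)
  have "sat M e q \<longleftrightarrow> Q e" if e: "e \<in> assignments M" for e
  proof -
    have "sat M e' p = Q e" if "e' \<in> assignments M" "\<forall>i. i \<notin> free_vars p - V \<longrightarrow> e' i = e i" for e'
      using p(2) dep[of e' e] that e by auto
    then show ?thesis using q(3)[OF e] e by auto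
  qed
  with q show thesis using that[of q] by auto
qed

text \<open>The existential closure \<open>q\<close> of \<open>p\<close> is a sentence, and either
  \<open>q\<close> or \<open>Neg q\<close> belongs to the theory of \<open>M\<close>. The
  back-and-forth argument moves facts between \<open>M\<close> and its models through this.\<close>

lemma satisfiable_transfer:
  assumes "wf_system n M" "model_of n (theory_of n M) N" "pred_symbols p \<subseteq> {1..n}"
  shows "(\<exists>e\<in>assignments M. sat M e p) \<longleftrightarrow> (\<exists>e\<in>assignments N. sat N e p)"
proof -
  define q where "q = foldr Exists (sorted_list_of_set (free_vars p)) p"
  have q: "pred_symbols q \<subseteq> {1..n}" "free_vars q = {}"
    "\<And>e. e \<in> assignments M \<Longrightarrow> sat M e q \<longleftrightarrow>
      (\<exists>e'\<in>assignments M. (\<forall>i. i \<notin> free_vars p \<longrightarrow> e' i = e i) \<and> sat M e' p)"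
    "\<And>e. e \<in> assignments N \<Longrightarrow> sat N e q \<longleftrightarrow>
      (\<exists>e'\<in>assignments N. (\<forall>i. i \<notin> free_vars p \<longrightarrow> e' i = e i) \<and> sat N e' p)"
    using assms(3) finite_free_vars[of p] unfolding q_def
    by (simp_all only: pred_symbols_foldr_Exists free_vars_foldr_Exists sat_foldr_Exists
        set_sorted_list_of_set Diff_cancel)
  have wfN: "wf_system n N" using assms by (auto simp: model_of_def)
  have glue: "\<exists>e0\<in>assignments K. \<exists>e'\<in>assignments K. (\<forall>i. i \<notin> free_vars p \<longrightarrow> e' i = e0 i) \<and> sat K e' p"
    if "e \<in> assignments K" "sat K e p" for K :: "'c ring_system" and e
    using that by blast
  have M: "(\<exists>e\<in>assignments M. sat M e p) \<longleftrightarrow> (\<exists>e\<in>assignments M. sat M e q)"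
    using q(3) glue by blast
  have N: "(\<exists>e\<in>assignments N. sat N e p) \<longleftrightarrow> (\<exists>e\<in>assignments N. sat N e q)"
    using q(4) glue by blast
  have cM: "sat M e q = sat M e' q" and cN: "sat N f q = sat N f' q" for e e' f f'
    using q(2) by (intro sat_cong; simp)+
  obtain e0 where e0: "e0 \<in> assignments M"
    using assignments_const wf_system_univ_nonempty[OF assms(1)] by (metis ex_in_conv)
  obtain f0 where f0: "f0 \<in> assignments N"
    using assignments_const wf_system_univ_nonempty[OF wfN] by (metis ex_in_conv)
  have S: "r \<in> theory_of n M \<Longrightarrow> holds_in N r" for r using assms by (auto simp: model_of_def)
  have th: "r \<in> theory_of n M \<longleftrightarrow> sat M e0 r" if "r = q \<or> r = Neg q" for r
  proof -
    have "r \<in> sentences n" using that q(1,2) by (auto simp: sentences_def)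
    moreover have "sat M e r = sat M e0 r" for e using that cM[of e e0] by auto
    ultimately show ?thesis using e0 by (auto simp: theory_of_def holds_in_def assignments_def)
  qed
  have "sat N f0 q \<longleftrightarrow> sat M e0 q"
    using S[of q] S[of "Neg q"] th[of q] th[of "Neg q"] f0
    by (auto simp: holds_in_def assignments_def)
  then show ?thesis using M N cM cN e0 f0 by metis
qed

section \<open>Henkin term models\<close>

text \<open>A complete theory in which the variables serve as Henkin constants, presented
  semantically: \<open>T Q\<close> says that \<open>Q\<close> belongs to it. Arbitrary predicates
  may belong to \<open>T\<close>, but only definable ones have to be decided or witnessed.\<close>

locale henkin_filter =
  fixes n :: nat and M :: "'a ring_system" and T :: "((nat \<Rightarrow> 'a) \<Rightarrow> bool) \<Rightarrow> bool"
  assumes wf: "wf_system n M"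
    and mono: "T Q \<Longrightarrow> (\<And>e. e \<in> assignments M \<Longrightarrow> Q e \<Longrightarrow> Q' e) \<Longrightarrow> T Q'"
    and conj: "T Q \<Longrightarrow> T Q' \<Longrightarrow> T (\<lambda>e. Q e \<and> Q' e)"
    and consistent: "\<not> T (\<lambda>_. False)"
    and decide: "definable n M Q \<Longrightarrow> T Q \<or> T (\<lambda>e. \<not> Q e)"
    and witness: "definable n M Q \<Longrightarrow> T (\<lambda>e. \<exists>a\<in>univ M. Q (e(k := a))) \<Longrightarrow>
      \<exists>j. T (\<lambda>e. Q (e(k := e j)))"
begin

lemma mono2: "T Q \<Longrightarrow> T Q' \<Longrightarrow> (\<And>e. e \<in> assignments M \<Longrightarrow> Q e \<Longrightarrow> Q' e \<Longrightarrow> Q'' e) \<Longrightarrow> T Q''"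
  using mono[OF conj] by blast

lemma always: "(\<And>e. e \<in> assignments M \<Longrightarrow> Q e) \<Longrightarrow> T Q"
  using decide[OF definable_term_eq[of n M TZero TZero]] mono[of _ Q] mono[of _ "\<lambda>_. False"] consistent
  by auto

text \<open>Choosing the least index in each class avoids a quotient, so the term model consists of
  natural numbers, as \<open>omega_categorical\<close> requires of its models.\<close>

definition rep :: "nat \<Rightarrow> nat" where
  "rep i = (LEAST j. T (\<lambda>e. e j = e i))"

lemma rep_eq: "T (\<lambda>e. e (rep i) = e i)"
  unfolding rep_def by (rule LeastI[of _ i]) (rule always, simp)

lemma rep_cong:
  assumes "T (\<lambda>e. e i = e j)"
  shows "rep i = rep j"
proof -
  have "T (\<lambda>e. e k = e i) \<longleftrightarrow> T (\<lambda>e. e k = e j)" for k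
    using mono2[OF assms, of "\<lambda>e. e k = e i" "\<lambda>e. e k = e j"]
      mono2[OF assms, of "\<lambda>e. e k = e j" "\<lambda>e. e k = e i"] by auto
  then show ?thesis unfolding rep_def by simp
qed

lemma rep_eq_iff: "rep i = rep j \<longleftrightarrow> T (\<lambda>e. e i = e j)"
proof
  assume "rep i = rep j"
  then show "T (\<lambda>e. e i = e j)" using mono2[OF rep_eq[of i] rep_eq[of j]] by simp
qed (rule rep_cong)

definition term_model :: "nat ring_system" where
  "term_model = \<lparr>univ = range rep,
     zero_of = rep (SOME j. T (\<lambda>e. e j = zero_of M)),
     add_of = (\<lambda>u v. rep (SOME j. T (\<lambda>e. e j = add_of M (e u) (e v)))),
     mult_of = (\<lambda>u v. rep (SOME j. T (\<lambda>e. e j = mult_of M (e u) (e v)))),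
     pred_of = (\<lambda>i. {u \<in> range rep. T (\<lambda>e. e u \<in> pred_of M i)})\<rparr>"

lemma univ_term_model: "univ term_model = range rep"
  by (simp add: term_model_def)

lemma wf_term_model: "wf_system n term_model"
  by (auto simp: wf_system_def term_model_def)

text \<open>Apply \<open>witness\<close> to the true statement that some \<open>a\<close> equals
  \<open>t\<close>, with a variable \<open>k\<close> that does not occur in \<open>t\<close>. Thus
  the result of every ring operation on variables is again named by a variable.\<close>

lemma name_term: "\<exists>j. T (\<lambda>e. e j = term_val M e t)"
proof -
  obtain k where k: "k \<notin> term_vars t"
    using finite_term_vars ex_new_if_finite infinite_UNIV_nat by blast
  have tv: "term_val M (e(k := a)) t = term_val M e t" for e a
    by (rule term_val_cong) (use k in auto)
  have "T (\<lambda>e. \<exists>a\<in>univ M. term_val M (e(k := a)) (TVar k) = term_val M (e(k := a)) t)"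
    by (rule always) (simp add: tv term_val_in_univ[OF wf])
  from witness[OF definable_term_eq this] show ?thesis unfolding tv by simp
qed

lemma name_operation:
  assumes "\<exists>l. T (\<lambda>e. e l = f (e (rep i)) (e (rep j)))" "T (\<lambda>e. e i = a e)" "T (\<lambda>e. e j = b e)"
  shows "T (\<lambda>e. e (SOME l. T (\<lambda>e. e l = f (e (rep i)) (e (rep j)))) = f (a e) (b e))"
  by (rule mono2[OF someI_ex[OF assms(1)] conj[OF conj[OF rep_eq[of i] rep_eq[of j]] conj[OF assms(2,3)]]])
    simp

lemma term_val_term_model:
  "\<exists>j. term_val term_model (rep \<circ> s) t = rep j \<and> T (\<lambda>e. e j = term_val M (e \<circ> s) t)"
proof (induction t)
  case (TVar k)
  show ?case by (rule exI[of _ "s k"]) (auto intro: always)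
next
  case TZero
  have "\<exists>j. T (\<lambda>e. e j = zero_of M)" using name_term[of TZero] by simp
  from someI_ex[OF this] show ?case by (auto simp: term_model_def)
next
  case (TAdd t u)
  then obtain i j where ij: "term_val term_model (rep \<circ> s) t = rep i" "T (\<lambda>e. e i = term_val M (e \<circ> s) t)"
    "term_val term_model (rep \<circ> s) u = rep j" "T (\<lambda>e. e j = term_val M (e \<circ> s) u)" by blast
  have "\<exists>l. T (\<lambda>e. e l = add_of M (e (rep i)) (e (rep j)))"
    using name_term[of "TAdd (TVar (rep i)) (TVar (rep j))"] by simp
  from name_operation[OF this ij(2,4)] show ?case
    unfolding term_val.simps ij(1,3) by (auto simp: term_model_def)
next
  case (TMult t u)
  then obtain i j where ij: "term_val term_model (rep \<circ> s) t = rep i" "T (\<lambda>e. e i = term_val M (e \<circ> s) t)"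
    "term_val term_model (rep \<circ> s) u = rep j" "T (\<lambda>e. e j = term_val M (e \<circ> s) u)" by blast
  have "\<exists>l. T (\<lambda>e. e l = mult_of M (e (rep i)) (e (rep j)))"
    using name_term[of "TMult (TVar (rep i)) (TVar (rep j))"] by simp
  from name_operation[OF this ij(2,4)] show ?case
    unfolding term_val.simps ij(1,3) by (auto simp: term_model_def)
qed

text \<open>Truth lemma by induction on \<open>p\<close>. The substitution \<open>s\<close> varies
  because a quantifier replaces it by \<open>s(k := j)\<close>. Negation rests on
  \<open>decide\<close> and consistency, the quantifier on \<open>witness\<close>.\<close>

lemma sat_term_model:
  "pred_symbols p \<subseteq> {1..n} \<Longrightarrow> sat term_model (rep \<circ> s) p \<longleftrightarrow> T (\<lambda>e. sat M (e \<circ> s) p)"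
proof (induction p arbitrary: s)
  case (Eq t u)
  obtain i j where ij: "term_val term_model (rep \<circ> s) t = rep i" "T (\<lambda>e. e i = term_val M (e \<circ> s) t)"
    "term_val term_model (rep \<circ> s) u = rep j" "T (\<lambda>e. e j = term_val M (e \<circ> s) u)"
    using term_val_term_model[of s t] term_val_term_model[of s u] by blast
  have "T (\<lambda>e. e i = e j) \<longleftrightarrow> T (\<lambda>e. term_val M (e \<circ> s) t = term_val M (e \<circ> s) u)"
  proof
    assume "T (\<lambda>e. e i = e j)"
    then show "T (\<lambda>e. term_val M (e \<circ> s) t = term_val M (e \<circ> s) u)"
      by (rule mono2[OF _ conj[OF ij(2,4)]]) simp
  next
    assume "T (\<lambda>e. term_val M (e \<circ> s) t = term_val M (e \<circ> s) u)"
    then show "T (\<lambda>e. e i = e j)" by (rule mono2[OF _ conj[OF ij(2,4)]]) simp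
  qed
  then show ?case unfolding sat.simps ij rep_eq_iff .
next
  case (Pred k t)
  obtain i where i: "term_val term_model (rep \<circ> s) t = rep i" "T (\<lambda>e. e i = term_val M (e \<circ> s) t)"
    using term_val_term_model[of s t] by blast
  have "T (\<lambda>e. e (rep i) \<in> pred_of M k) \<longleftrightarrow> T (\<lambda>e. term_val M (e \<circ> s) t \<in> pred_of M k)"
  proof
    assume "T (\<lambda>e. e (rep i) \<in> pred_of M k)"
    then show "T (\<lambda>e. term_val M (e \<circ> s) t \<in> pred_of M k)"
      by (rule mono2[OF _ conj[OF rep_eq[of i] i(2)]]) simp
  next
    assume "T (\<lambda>e. term_val M (e \<circ> s) t \<in> pred_of M k)"
    then show "T (\<lambda>e. e (rep i) \<in> pred_of M k)" by (rule mono2[OF _ conj[OF rep_eq[of i] i(2)]]) simp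
  qed
  then show ?case unfolding sat.simps i by (simp add: term_model_def)
next
  case (Neg p)
  have "definable n M (\<lambda>e. sat M (e \<circ> s) p)" using definable_rename[of p n M s] Neg.prems by simp
  then have "T (\<lambda>e. sat M (e \<circ> s) p) \<or> T (\<lambda>e. \<not> sat M (e \<circ> s) p)" by (rule decide)
  moreover have "\<not> (T (\<lambda>e. sat M (e \<circ> s) p) \<and> T (\<lambda>e. \<not> sat M (e \<circ> s) p))"
    using mono2[of "\<lambda>e. sat M (e \<circ> s) p" "\<lambda>e. \<not> sat M (e \<circ> s) p" "\<lambda>_. False"] consistent by blast
  moreover have "sat term_model (rep \<circ> s) p \<longleftrightarrow> T (\<lambda>e. sat M (e \<circ> s) p)"
    by (rule Neg.IH) (use Neg.prems in simp)
  ultimately show ?case unfolding sat.simps by blast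
next
  case (Conj p q)
  have IH: "sat term_model (rep \<circ> s) p \<longleftrightarrow> T (\<lambda>e. sat M (e \<circ> s) p)"
    "sat term_model (rep \<circ> s) q \<longleftrightarrow> T (\<lambda>e. sat M (e \<circ> s) q)"
    using Conj.prems by (intro Conj.IH; simp)+
  show ?case unfolding sat.simps IH
  proof
    assume "T (\<lambda>e. sat M (e \<circ> s) p) \<and> T (\<lambda>e. sat M (e \<circ> s) q)"
    then show "T (\<lambda>e. sat M (e \<circ> s) p \<and> sat M (e \<circ> s) q)" using conj by blast
  next
    assume *: "T (\<lambda>e. sat M (e \<circ> s) p \<and> sat M (e \<circ> s) q)"
    show "T (\<lambda>e. sat M (e \<circ> s) p) \<and> T (\<lambda>e. sat M (e \<circ> s) q)"
      using mono[OF *, of "\<lambda>e. sat M (e \<circ> s) p"] mono[OF *, of "\<lambda>e. sat M (e \<circ> s) q"] by blast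
  qed
next
  case (Exists k p)
  have comp: "(e \<circ> s)(k := e j) = e \<circ> s(k := j)" for e :: "nat \<Rightarrow> 'c" and j by auto
  have "sat term_model (rep \<circ> s) (Exists k p) \<longleftrightarrow> (\<exists>j. sat term_model (rep \<circ> s(k := j)) p)"
    unfolding sat.simps univ_term_model by (auto simp: comp)
  also have "\<dots> \<longleftrightarrow> (\<exists>j. T (\<lambda>e. sat M (e \<circ> s(k := j)) p))"
  proof -
    have "sat term_model (rep \<circ> s(k := j)) p = T (\<lambda>e. sat M (e \<circ> s(k := j)) p)" for j
      by (rule Exists.IH) (use Exists.prems in simp)
    then show ?thesis by blast
  qed
  also have "\<dots> \<longleftrightarrow> T (\<lambda>e. sat M (e \<circ> s) (Exists k p))"
  proof
    assume "\<exists>j. T (\<lambda>e. sat M (e \<circ> s(k := j)) p)"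
    then obtain j where "T (\<lambda>e. sat M (e \<circ> s(k := j)) p)" ..
    then show "T (\<lambda>e. sat M (e \<circ> s) (Exists k p))"
      unfolding sat.simps comp[symmetric] by (rule mono) (use assignments_apply in blast)
  next
    assume *: "T (\<lambda>e. sat M (e \<circ> s) (Exists k p))"
    obtain j0 where j0: "j0 \<notin> s ` free_vars p"
      using finite_free_vars ex_new_if_finite infinite_UNIV_nat by blast
    have eq: "sat M (e(j0 := a) \<circ> s(k := j0)) p = sat M ((e \<circ> s)(k := a)) p" for e a
      using j0 by (intro sat_cong) auto
    have "pred_symbols p \<subseteq> {1..n}" using Exists.prems by simp
    from witness[OF definable_rename[OF this, of M "s(k := j0)"], of j0]
    obtain j where "T (\<lambda>e. sat M ((e \<circ> s)(k := e j)) p)"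
      using * unfolding eq sat.simps by blast
    then show "\<exists>j. T (\<lambda>e. sat M (e \<circ> s(k := j)) p)" unfolding comp by blast
  qed
  finally show ?case .
qed

lemma model_of_term_model: "model_of n (theory_of n M) term_model"
  unfolding model_of_def
proof (intro conjI ballI wf_term_model)
  fix p assume p: "p \<in> theory_of n M"
  then have preds: "pred_symbols p \<subseteq> {1..n}" by (auto simp: theory_of_def sentences_def)
  show "holds_in term_model p"
    unfolding holds_in_def
  proof (intro allI impI)
    fix f :: "nat \<Rightarrow> nat" assume "range f \<subseteq> univ term_model"
    then have "\<forall>i. \<exists>j. f i = rep j" unfolding univ_term_model by blast
    then obtain s where "f = rep \<circ> s" by (metis comp_apply ext)
    moreover have "T (\<lambda>e. sat M (e \<circ> s) p)"
    proof (rule always)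
      fix e assume "e \<in> assignments M"
      then have "range (e \<circ> s) \<subseteq> univ M" by (auto simp: assignments_def)
      then show "sat M (e \<circ> s) p" using p unfolding theory_of_def holds_in_def by blast
    qed
    ultimately show "sat term_model f p" using sat_term_model[OF preds] by simp
  qed
qed

end

text \<open>A generic construction. \<open>consistent F\<close> means that \<open>F\<close> is
  definable and compatible with every set of the decreasing sequence \<open>E\<close>, to which
  variable \<open>0\<close> is committed; \<open>W\<close> lists further requirements, each of which
  can be met by strengthening a consistent predicate. A descending sequence of consistent predicates
  decides every formula, adds every Henkin witness and meets every \<open>W m\<close>.\<close>

lemma ex_henkin_filter:
  fixes n :: nat and M :: "'a ring_system" and E :: "nat \<Rightarrow> 'a set" and W :: "nat \<Rightarrow> ((nat \<Rightarrow> 'a) \<Rightarrow> bool) \<Rightarrow> bool"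
  defines "consistent F \<equiv> definable n M F \<and> (\<forall>i. \<exists>e\<in>assignments M. e 0 \<in> E i \<and> F e)"
  assumes wf: "wf_system n M" and decE: "decseq E"
    and E: "\<And>i. E i \<noteq> {}" "\<And>i. E i \<subseteq> univ M"
    and step: "\<And>m F. consistent F \<Longrightarrow>
      \<exists>F'. consistent F' \<and> (\<forall>e\<in>assignments M. F' e \<longrightarrow> F e) \<and> W m F'"
  obtains T where "henkin_filter n M T" "\<And>m. \<exists>F. T F \<and> W m F" "\<And>i. T (\<lambda>e. e 0 \<in> E i)"
proof -
  define le where "le F' F \<longleftrightarrow> (\<forall>e\<in>assignments M. F' e \<longrightarrow> F e)" for F' F :: "(nat \<Rightarrow> 'a) \<Rightarrow> bool"
  define decides where "decides F p \<longleftrightarrow> le F (\<lambda>e. sat M e p) \<or> le F (\<lambda>e. \<not> sat M e p)" for F p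
  define witnesses where "witnesses F k p \<longleftrightarrow>
    (\<exists>j. le F (\<lambda>e. (\<exists>a\<in>univ M. sat M (e(k := a)) p) \<longrightarrow> sat M (e(k := e j)) p))" for F k p
  have decide_step: "\<exists>F'. consistent F' \<and> le F' F \<and> decides F' p"
    if F: "consistent F" and p: "pred_symbols p \<subseteq> {1..n}" for F p
  proof -
    have d: "definable n M (\<lambda>e. F e \<and> sat M e p)" "definable n M (\<lambda>e. F e \<and> \<not> sat M e p)"
      using F unfolding consistent_def by (intro definable_conj definable_not definable_sat p; blast)+
    \<comment> \<open>If both extensions failed, at \<open>E i\<close> and at \<open>E j\<close>,
      then \<open>F\<close> would have no solution with \<open>e 0\<close> in
      \<open>E (max i j)\<close>, which lies in both.\<close>
    have "consistent (\<lambda>e. F e \<and> sat M e p) \<or> consistent (\<lambda>e. F e \<and> \<not> sat M e p)"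
    proof (rule ccontr)
      assume "\<not> ?thesis"
      then obtain i j where ij: "\<And>e. e \<in> assignments M \<Longrightarrow> e 0 \<in> E i \<Longrightarrow> F e \<Longrightarrow> \<not> sat M e p"
        "\<And>e. e \<in> assignments M \<Longrightarrow> e 0 \<in> E j \<Longrightarrow> F e \<Longrightarrow> sat M e p"
        using d unfolding consistent_def by blast
      obtain e where "e \<in> assignments M" "e 0 \<in> E (max i j)" "F e"
        using F unfolding consistent_def by blast
      moreover have "E (max i j) \<subseteq> E i" "E (max i j) \<subseteq> E j"
        using decE by (auto simp: decseq_def)
      ultimately show False using ij by blast
    qed
    then show ?thesis
    proof
      assume "consistent (\<lambda>e. F e \<and> sat M e p)"
      then show ?thesis by (rule_tac exI, auto simp: le_def decides_def)
    next
      assume "consistent (\<lambda>e. F e \<and> \<not> sat M e p)"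
      then show ?thesis by (rule_tac exI, auto simp: le_def decides_def)
    qed
  qed
  have witness_step: "\<exists>F'. consistent F' \<and> le F' F \<and> witnesses F' k p"
    if F: "consistent F" and p: "pred_symbols p \<subseteq> {1..n}" for F k p
  proof -
    obtain V where V: "finite V" "\<And>e e'. e \<in> assignments M \<Longrightarrow> e' \<in> assignments M \<Longrightarrow>
        (\<And>i. i \<in> V \<Longrightarrow> e i = e' i) \<Longrightarrow> F e = F e'"
      using F definable_support[of n M F] unfolding consistent_def by metis
    have "finite (V \<union> free_vars p \<union> {0})" using V finite_free_vars by auto
    \<comment> \<open>The witness is a variable that \<open>F\<close> and \<open>p\<close> ignore,
      and not \<open>0\<close>, whose value is already committed to \<open>E\<close>. Resetting it
      to a suitable \<open>a\<close> makes the Henkin axiom \<open>H\<close> true and keeps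
      \<open>F\<close>.\<close>
    then obtain j where j: "j \<notin> V" "j \<notin> free_vars p" "j \<noteq> 0"
      using ex_new_if_finite[OF infinite_UNIV_nat, of "V \<union> free_vars p \<union> {0}"] by auto
    define H where "H e \<longleftrightarrow> ((\<exists>a\<in>univ M. sat M (e(k := a)) p) \<longrightarrow> sat M (e(k := e j)) p)" for e
    have comp: "e(k := e j) = e \<circ> id(k := j)" for e :: "nat \<Rightarrow> 'a" by auto
    have dH: "definable n M H"
      unfolding H_def comp
      by (intro definable_imp definable_rename definable_ex definable_sat p)
    have "consistent (\<lambda>e. F e \<and> H e)"
      unfolding consistent_def
    proof (intro conjI allI)
      show "definable n M (\<lambda>e. F e \<and> H e)"
        using F dH by (auto simp: consistent_def intro: definable_conj)
      fix i
      obtain e where e: "e \<in> assignments M" "e 0 \<in> E i" "F e" using F unfolding consistent_def by blast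
      show "\<exists>e\<in>assignments M. e 0 \<in> E i \<and> F e \<and> H e"
      proof (cases "\<exists>a\<in>univ M. sat M (e(k := a)) p")
        case False
        then have "H e" unfolding H_def by blast
        then show ?thesis using e by blast
      next
        case True
        then obtain a where a: "a \<in> univ M" "sat M (e(k := a)) p" by blast
        have as: "e(j := a) \<in> assignments M" using assignments_upd[OF e(1) a(1)] .
        have "sat M ((e(j := a))(k := a)) p = sat M (e(k := a)) p"
          by (rule sat_cong) (use j in auto)
        then have "H (e(j := a))" unfolding H_def using a by simp
        moreover have "F (e(j := a)) = F e"
          by (rule V(2)[OF as e(1)]) (use j in auto)
        ultimately show ?thesis using e as j by (intro bexI[OF _ as]) auto
      qed
    qed
    moreover have "witnesses (\<lambda>e. F e \<and> H e) k p"
      unfolding witnesses_def le_def H_def by blast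
    ultimately show ?thesis by (rule_tac exI[of _ "\<lambda>e. F e \<and> H e"]) (auto simp: le_def)
  qed
  define good where "good m F \<longleftrightarrow> W m F \<and> (case from_nat m of (k, p) \<Rightarrow>
    pred_symbols p \<subseteq> {1..n} \<longrightarrow> (\<exists>F'. le F F' \<and> decides F' p) \<and> (\<exists>F'. le F F' \<and> witnesses F' k p))"
    for m :: nat and F
  have le_trans: "le F G \<Longrightarrow> le G H \<Longrightarrow> le F H" for F G H unfolding le_def by blast
  have step': "\<exists>F'. consistent F' \<and> le F' F \<and> (\<exists>G. le F' G \<and> good m G)" if F: "consistent F" for m F
  proof -
    obtain k p where kp: "(from_nat m :: nat \<times> fm) = (k, p)" by fastforce
    have "\<exists>F'. consistent F' \<and> le F' F \<and>
       (pred_symbols p \<subseteq> {1..n} \<longrightarrow> (\<exists>G. le F' G \<and> decides G p) \<and> (\<exists>G. le F' G \<and> witnesses G k p))"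
    proof (cases "pred_symbols p \<subseteq> {1..n}")
      case True
      obtain F1 where F1: "consistent F1" "le F1 F" "decides F1 p" using decide_step[OF F True] by blast
      obtain F2 where F2: "consistent F2" "le F2 F1" "witnesses F2 k p"
        using witness_step[OF F1(1) True] by blast
      have "le F2 F2" by (simp add: le_def)
      then show ?thesis using F1 F2 le_trans by blast
    next
      case False
      have "le F F" by (simp add: le_def)
      then show ?thesis using F False by blast
    qed
    then obtain F1 where F1: "consistent F1" "le F1 F"
      "pred_symbols p \<subseteq> {1..n} \<longrightarrow> (\<exists>G. le F1 G \<and> decides G p) \<and> (\<exists>G. le F1 G \<and> witnesses G k p)"
      by blast
    obtain F2 where F2: "consistent F2" "le F2 F1" "W m F2"
      using step[OF F1(1)] unfolding le_def by blast
    have "good m F2" unfolding good_def kp prod.case using F1(3) F2 le_trans by blast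
    moreover have "le F2 F2" by (simp add: le_def)
    ultimately show ?thesis using F1 F2 le_trans by blast
  qed
  have "\<exists>f. \<forall>m. consistent (f m) \<and> le (f (Suc m)) (f m) \<and> (\<exists>G. le (f (Suc m)) G \<and> good m G)"
  proof (rule dependent_nat_choice)
    have "\<exists>e\<in>assignments M. e 0 \<in> E i" for i
    proof -
      obtain a where "a \<in> E i" using E(1) by blast
      then show ?thesis using E(2) by (intro bexI[OF _ assignments_const[of a]]) auto
    qed
    then show "\<exists>F. consistent F"
      unfolding consistent_def using definable_term_eq[of n M TZero TZero]
      by (intro exI[of _ "\<lambda>_. True"]) simp
  qed (rule step')
  then obtain f where f: "\<And>m. consistent (f m)" "\<And>m. le (f (Suc m)) (f m)"
    "\<And>m. \<exists>G. le (f (Suc m)) G \<and> good m G" by metis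
  have f_le: "le (f l) (f m)" if "m \<le> l" for m l
    using that
  proof (induction rule: dec_induct)
    case base
    show ?case by (simp add: le_def)
  next
    case (step l)
    then show ?case using f(2) le_trans by blast
  qed
  \<comment> \<open>The filter generated by the predicates \<open>f m\<close> and the conditions
    that \<open>e 0\<close> lies in \<open>E m\<close>. Both sequences decrease, so a single
    \<open>m\<close> suffices.\<close>
  define T where "T Q \<longleftrightarrow> (\<exists>m. \<forall>e\<in>assignments M. f m e \<and> e 0 \<in> E m \<longrightarrow> Q e)" for Q
  have le_T: "T Q" if "le (f m) Q" for m Q using that unfolding T_def le_def by blast
  have T_mono: "T Q'" if "T Q" "\<And>e. e \<in> assignments M \<Longrightarrow> Q e \<Longrightarrow> Q' e" for Q Q'
    using that unfolding T_def by blast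
  have T_conj: "T (\<lambda>e. Q e \<and> Q' e)" if "T Q" "T Q'" for Q Q'
  proof -
    from that(1) obtain m where m: "\<forall>e\<in>assignments M. f m e \<and> e 0 \<in> E m \<longrightarrow> Q e"
      unfolding T_def by blast
    from that(2) obtain l where l: "\<forall>e\<in>assignments M. f l e \<and> e 0 \<in> E l \<longrightarrow> Q' e"
      unfolding T_def by blast
    have "E (max m l) \<subseteq> E m" "E (max m l) \<subseteq> E l" using decE by (auto simp: decseq_def)
    moreover have "le (f (max m l)) (f m)" "le (f (max m l)) (f l)" by (auto intro: f_le)
    ultimately have "\<forall>e\<in>assignments M. f (max m l) e \<and> e 0 \<in> E (max m l) \<longrightarrow> Q e \<and> Q' e"
      using m l unfolding le_def by blast
    then show ?thesis unfolding T_def by blast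
  qed
  have good: "\<exists>m G. T G \<and> (\<forall>G'. le G G' \<longrightarrow> T G') \<and> good m G \<and> (from_nat m :: nat \<times> fm) = (k, p)" for k p
  proof -
    obtain G where "le (f (Suc (to_nat (k, p)))) G" "good (to_nat (k, p)) G" using f(3) by blast
    moreover from this have "\<forall>G'. le G G' \<longrightarrow> T G'" "T G" using le_T le_trans by blast+
    moreover have "(from_nat (to_nat (k, p)) :: nat \<times> fm) = (k, p)" by simp
    ultimately show ?thesis by blast
  qed
  have filt: "henkin_filter n M T"
  proof
    show "wf_system n M" by fact
    show "T Q'" if "T Q" "\<And>e. e \<in> assignments M \<Longrightarrow> Q e \<Longrightarrow> Q' e" for Q Q'
      using that by (rule T_mono)
    show "T (\<lambda>e. Q e \<and> Q' e)" if "T Q" "T Q'" for Q Q' using that by (rule T_conj)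
    show "\<not> T (\<lambda>_. False)" using f(1) unfolding T_def consistent_def by blast
    show "T Q \<or> T (\<lambda>e. \<not> Q e)" if "definable n M Q" for Q
    proof -
      from that obtain p
        where p: "pred_symbols p \<subseteq> {1..n}" "\<And>e. e \<in> assignments M \<Longrightarrow> sat M e p = Q e"
        unfolding definable_def by blast
      obtain m G where G: "\<forall>G'. le G G' \<longrightarrow> T G'" "good m G" "(from_nat m :: nat \<times> fm) = (0, p)"
        using good by blast
      obtain F' where "le G F'" "decides F' p" using G(2,3) p(1) unfolding good_def by auto
      then have "le G (\<lambda>e. sat M e p) \<or> le G (\<lambda>e. \<not> sat M e p)"
        unfolding decides_def using le_trans by blast
      then have "le G Q \<or> le G (\<lambda>e. \<not> Q e)" unfolding le_def using p(2) by blast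
      then show ?thesis using G(1) by blast
    qed
    show "\<exists>j. T (\<lambda>e. Q (e(k := e j)))"
      if "definable n M Q" and ex: "T (\<lambda>e. \<exists>a\<in>univ M. Q (e(k := a)))" for Q k
    proof -
      from that obtain p
        where p: "pred_symbols p \<subseteq> {1..n}" "\<And>e. e \<in> assignments M \<Longrightarrow> sat M e p = Q e"
        unfolding definable_def by blast
      obtain m G where G: "\<forall>G'. le G G' \<longrightarrow> T G'" "good m G" "(from_nat m :: nat \<times> fm) = (k, p)"
        using good by blast
      obtain F' where "le G F'" "witnesses F' k p" using G(2,3) p(1) unfolding good_def by auto
      then obtain j where "le G (\<lambda>e. (\<exists>a\<in>univ M. sat M (e(k := a)) p) \<longrightarrow> sat M (e(k := e j)) p)"
        unfolding witnesses_def using le_trans by blast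
      then have "T (\<lambda>e. (\<exists>a\<in>univ M. sat M (e(k := a)) p) \<longrightarrow> sat M (e(k := e j)) p)"
        using G(1) by blast
      from T_conj[OF this ex] have "T (\<lambda>e. Q (e(k := e j)))"
        by (rule T_mono) (use p(2) assignments_upd assignments_apply in metis)
      then show ?thesis ..
    qed
  qed
  have "\<exists>F. T F \<and> W m F" for m
    using f(3)[of m] le_T unfolding good_def by blast
  moreover have "T (\<lambda>e. e 0 \<in> E i)" for i unfolding T_def by blast
  ultimately show thesis using that filt by blast
qed

section \<open>Definable sets of elements and the omission of a non-principal type\<close>

definition unary_definable :: "nat \<Rightarrow> 'a ring_system \<Rightarrow> 'a set set" where
  "unary_definable n M = {D. D \<subseteq> univ M \<and> definable n M (\<lambda>e. e 0 \<in> D)}"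

lemma definable_var_mem:
  assumes "definable n M (\<lambda>e. e 0 \<in> D)"
  shows "definable n M (\<lambda>e. e m \<in> D)"
proof -
  obtain p where p: "pred_symbols p \<subseteq> {1..n}" "\<And>e. e \<in> assignments M \<Longrightarrow> sat M e p \<longleftrightarrow> e 0 \<in> D"
    using assms unfolding definable_def by blast
  show ?thesis
  proof (rule definable_cong[OF definable_rename[OF p(1), of M "\<lambda>_. m"]])
    fix e assume "e \<in> assignments M"
    then show "sat M (e \<circ> (\<lambda>_. m)) p = (e m \<in> D)"
      using p(2)[OF assignments_comp, of e "\<lambda>_. m"] by (simp only: comp_apply)
  qed
qed

text \<open>All free variables other than \<open>m\<close> are quantified away. When a type is
  omitted, this turns the values that a consistent \<open>F\<close> leaves open for variable
  \<open>m\<close> into a definable set, which can be compared with the sets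
  \<open>E i\<close>.\<close>

lemma unary_definable_projection:
  assumes "definable n M F"
  shows "{e m |e. e \<in> assignments M \<and> F e} \<in> unary_definable n M"
proof -
  let ?D = "{e m |e. e \<in> assignments M \<and> F e}"
  obtain p where p: "pred_symbols p \<subseteq> {1..n}" "\<And>e. e \<in> assignments M \<Longrightarrow> sat M e p \<longleftrightarrow> F e"
    using assms unfolding definable_def by blast
  define V where "V = free_vars p - {m}"
  define q where "q = foldr Exists (sorted_list_of_set V) p"
  have fin: "finite V" unfolding V_def using finite_free_vars by auto
  have q: "pred_symbols q \<subseteq> {1..n}" "\<And>e. e \<in> assignments M \<Longrightarrow> sat M e q \<longleftrightarrow>
      (\<exists>e'\<in>assignments M. (\<forall>i. i \<notin> V \<longrightarrow> e' i = e i) \<and> sat M e' p)"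
    using p(1) fin unfolding q_def
    by (simp_all only: pred_symbols_foldr_Exists sat_foldr_Exists set_sorted_list_of_set)
  have sat_q: "sat M e q \<longleftrightarrow> e m \<in> ?D" if e: "e \<in> assignments M" for e
  proof
    assume "sat M e q"
    then obtain e' where e': "e' \<in> assignments M" "\<forall>i. i \<notin> V \<longrightarrow> e' i = e i" "sat M e' p"
      using q(2)[OF e] by blast
    then have "F e'" "e' m = e m" using p(2) by (auto simp: V_def)
    then show "e m \<in> ?D" using e'(1) by (auto intro!: exI[of _ e'])
  next
    assume "e m \<in> ?D"
    then obtain e'' where e'': "e'' \<in> assignments M" "F e''" "e m = e'' m" by auto
    define e' where "e' i = (if i \<in> V then e'' i else e i)" for i
    have "sat M e' p = sat M e'' p"
      by (rule sat_cong) (use e'' in \<open>auto simp: e'_def V_def\<close>)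
    moreover have "e' \<in> assignments M"
      using e e'' by (auto simp: e'_def assignments_def)
    moreover have "\<forall>i. i \<notin> V \<longrightarrow> e' i = e i" by (simp add: e'_def)
    ultimately show "sat M e q" using q(2)[OF e] p(2)[OF e''(1)] e''(2) by blast
  qed
  have "definable n M (\<lambda>e. e 0 \<in> ?D)"
  proof (rule definable_cong[OF definable_rename[OF q(1), of M "\<lambda>_. 0"]])
    fix e assume "e \<in> assignments M"
    then show "sat M (e \<circ> (\<lambda>_. 0)) q = (e 0 \<in> ?D)"
      using sat_q[OF assignments_comp, of e "\<lambda>_. 0"] by (simp only: comp_apply)
  qed
  then show ?thesis
    unfolding unary_definable_def using assignments_apply by blast
qed

lemma unary_definable_formula:
  assumes "D \<in> unary_definable n M" "univ M \<noteq> {}"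
  obtains p where "pred_symbols p \<subseteq> {1..n}" "free_vars p \<subseteq> {0}"
    "\<And>e. e \<in> assignments M \<Longrightarrow> sat M e p \<longleftrightarrow> e 0 \<in> D"
proof (rule definable_formula[where Q = "\<lambda>e. e 0 \<in> D" and V = "{0}"])
  show "definable n M (\<lambda>e. e 0 \<in> D)" using assms by (auto simp: unary_definable_def)
qed (use assms that in \<open>simp_all\<close>)

lemma countable_unary_definable: "countable (unary_definable n M)"
proof -
  have "D \<in> range (\<lambda>p. {a \<in> univ M. sat M (\<lambda>_. a) p})" if "D \<in> unary_definable n M" for D
  proof -
    from that obtain p where p: "\<And>e. e \<in> assignments M \<Longrightarrow> sat M e p \<longleftrightarrow> e 0 \<in> D"
      unfolding unary_definable_def definable_def by blast
    have "D = {a \<in> univ M. sat M (\<lambda>_. a) p}"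
      using that p[OF assignments_const] by (auto simp: unary_definable_def)
    then show ?thesis by blast
  qed
  then have "unary_definable n M \<subseteq> range (\<lambda>p. {a \<in> univ M. sat M (\<lambda>_. a) p})" by blast
  then show ?thesis by (rule countable_subset) simp
qed

text \<open>The sets \<open>E i\<close> generate a non-principal type: infinitely many definable sets have different
  traces on each \<open>E i\<close>, whereas at most two have on a set contained in all \<open>E i\<close>.\<close>

lemma ex_nonisolated_type:
  assumes "wf_system n M" and inf: "infinite (unary_definable n M)"
  obtains E :: "nat \<Rightarrow> 'a set" where "decseq E" "\<And>i. E i \<noteq> {}" "\<And>i. E i \<in> unary_definable n M"
    "\<And>D. D \<in> unary_definable n M \<Longrightarrow> D \<noteq> {} \<Longrightarrow> \<exists>i. \<not> D \<subseteq> E i"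
proof -
  let ?U = "unary_definable n M"
  define big where "big E \<longleftrightarrow> infinite ((\<lambda>D. D \<inter> E) ` ?U)" for E
  define Q where "Q = from_nat_into ?U"
  have ne: "?U \<noteq> {}" using inf by auto
  have Q: "Q i \<in> ?U" for i unfolding Q_def using from_nat_into[OF ne] .
  have Q_surj: "\<exists>i. Q i = D" if "D \<in> ?U" for D
    unfolding Q_def using from_nat_into_surj[OF countable_unary_definable that] .
  have Int: "D \<inter> D' \<in> ?U" if "D \<in> ?U" "D' \<in> ?U" for D D'
  proof -
    have "definable n M (\<lambda>e. e 0 \<in> D \<and> e 0 \<in> D')"
      using that by (auto simp: unary_definable_def intro!: definable_conj)
    then show ?thesis using that by (auto simp: unary_definable_def)
  qed
  have Diff: "D - D' \<in> ?U" if "D \<in> ?U" "D' \<in> ?U" for D D'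
  proof -
    have "definable n M (\<lambda>e. e 0 \<in> D \<and> \<not> e 0 \<in> D')"
      using that by (auto simp: unary_definable_def intro!: definable_conj definable_not)
    then show ?thesis using that by (auto simp: unary_definable_def)
  qed
  have "\<exists>E. \<forall>i. (E i \<in> ?U \<and> big (E i)) \<and> (E (Suc i) = E i \<inter> Q i \<or> E (Suc i) = E i - Q i)"
  proof (rule dependent_nat_choice)
    have "definable n M (\<lambda>e. e 0 \<in> univ M)"
      by (rule definable_cong[OF definable_term_eq[of n M TZero TZero]]) (simp add: assignments_apply)
    then have "univ M \<in> ?U" by (simp add: unary_definable_def)
    moreover have "(\<lambda>D. D \<inter> univ M) ` ?U = (\<lambda>D. D) ` ?U"
      by (rule image_cong) (auto simp: unary_definable_def)
    then have "(\<lambda>D. D \<inter> univ M) ` ?U = ?U" by simp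
    ultimately show "\<exists>E. E \<in> ?U \<and> big E" using inf unfolding big_def by metis
  next
    fix E i assume E: "E \<in> ?U \<and> big E"
    \<comment> \<open>Every trace on \<open>E\<close> is the union of a trace on
      \<open>E \<inter> Q i\<close> and one on \<open>E - Q i\<close>, so these cannot both carry
      only finitely many traces.\<close>
    have "big (E \<inter> Q i) \<or> big (E - Q i)"
    proof (rule ccontr)
      assume "\<not> ?thesis"
      then have "finite ((\<lambda>(A, B). A \<union> B) ` ((\<lambda>D. D \<inter> (E \<inter> Q i)) ` ?U \<times> (\<lambda>D. D \<inter> (E - Q i)) ` ?U))"
        unfolding big_def by blast
      moreover have "(\<lambda>D. D \<inter> E) ` ?U \<subseteq>
          (\<lambda>(A, B). A \<union> B) ` ((\<lambda>D. D \<inter> (E \<inter> Q i)) ` ?U \<times> (\<lambda>D. D \<inter> (E - Q i)) ` ?U)"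
      proof
        fix A assume "A \<in> (\<lambda>D. D \<inter> E) ` ?U"
        then obtain D where D: "D \<in> ?U" "A = D \<inter> E" by blast
        have "A = (\<lambda>(A, B). A \<union> B) (D \<inter> (E \<inter> Q i), D \<inter> (E - Q i))" using D by auto
        then show "A \<in> (\<lambda>(A, B). A \<union> B) ` ((\<lambda>D. D \<inter> (E \<inter> Q i)) ` ?U \<times> (\<lambda>D. D \<inter> (E - Q i)) ` ?U)"
          using D(1) by blast
      qed
      ultimately show False using E unfolding big_def using finite_subset by blast
    qed
    then show "\<exists>E'. (E' \<in> ?U \<and> big E') \<and> (E' = E \<inter> Q i \<or> E' = E - Q i)"
      using E Int[OF _ Q[of i]] Diff[OF _ Q[of i]] by blast
  qed
  then obtain E where E: "\<And>i. E i \<in> ?U" "\<And>i. big (E i)"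
    "\<And>i. E (Suc i) = E i \<inter> Q i \<or> E (Suc i) = E i - Q i" by metis
  show thesis
  proof
    show "decseq E" by (rule decseq_SucI) (use E(3) in blast)
    show "E i \<noteq> {}" for i
    proof
      assume "E i = {}"
      then have "(\<lambda>D. D \<inter> E i) ` ?U \<subseteq> {{}}" by auto
      then show False using E(2)[of i] finite_subset unfolding big_def by blast
    qed
    show "E i \<in> ?U" for i by (rule E)
    show "\<exists>i. \<not> D \<subseteq> E i" if D: "D \<in> ?U" "D \<noteq> {}" for D
    proof (rule ccontr)
      assume "\<not> ?thesis"
      then have sub: "D \<subseteq> E i" for i by blast
      \<comment> \<open>At the stage that treats \<open>D\<close> itself, the nonempty
        \<open>D\<close> survives only in the intersection, so \<open>E (Suc j) = D\<close>. Each
        definable set is decided in the same way by some \<open>E (Suc i)\<close> containing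
        \<open>D\<close>, which leaves only two traces on \<open>D\<close>.\<close>
      obtain j where j: "Q j = D" using Q_surj[OF D(1)] by blast
      have D_eq: "D = E (Suc j)" using E(3)[of j] sub[of j] sub[of "Suc j"] D(2) j by blast
      have "A \<inter> D = {} \<or> A \<inter> D = D" if "A \<in> ?U" for A
        using Q_surj[OF that] E(3) sub by blast
      then have "(\<lambda>A. A \<inter> D) ` ?U \<subseteq> {{}, D}" by auto
      then show False using E(2)[of "Suc j"] finite_subset unfolding big_def D_eq[symmetric] by blast
    qed
  qed
qed

theorem omega_categorical_finite_unary_definable:
  assumes wf: "wf_system n M" and cat: "omega_categorical n M"
  shows "finite (unary_definable n M)"
proof (rule ccontr)
  let ?U = "unary_definable n M"
  assume "infinite ?U"
  then obtain E where E: "decseq E" "\<And>i. E i \<noteq> {}" "\<And>i. E i \<in> ?U"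
    "\<And>D. D \<in> ?U \<Longrightarrow> D \<noteq> {} \<Longrightarrow> \<exists>i. \<not> D \<subseteq> E i"
    using ex_nonisolated_type[OF wf] by metis
  have ne: "univ M \<noteq> {}" using wf by (rule wf_system_univ_nonempty)
  have "\<exists>p. pred_symbols p \<subseteq> {1..n} \<and> free_vars p \<subseteq> {0} \<and>
      (\<forall>e\<in>assignments M. sat M e p \<longleftrightarrow> e 0 \<in> E i)" for i
    using unary_definable_formula[OF E(3) ne] by metis
  then obtain p where p: "\<And>i. pred_symbols (p i) \<subseteq> {1..n}" "\<And>i. free_vars (p i) \<subseteq> {0}"
    "\<And>i e. e \<in> assignments M \<Longrightarrow> sat M e (p i) \<longleftrightarrow> e 0 \<in> E i" by metis
  \<comment> \<open>No further requirements: variable \<open>0\<close> realises the type given by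
    \<open>E\<close> in the term model.\<close>
  obtain T where T: "henkin_filter n M T" "\<And>i. T (\<lambda>e. e 0 \<in> E i)"
  proof (rule ex_henkin_filter[OF wf E(1) E(2), where W = "\<lambda>_ _. True"])
    show "E i \<subseteq> univ M" for i using E(3) by (auto simp: unary_definable_def)
  qed blast+
  interpret real: henkin_filter n M T by fact
  have real: "sat real.term_model real.rep (p i)" for i
  proof -
    have "T (\<lambda>e. sat M (e \<circ> id) (p i))"
      by (rule real.mono[OF T(2)[of i]]) (use p(3) in simp)
    then show ?thesis using real.sat_term_model[OF p(1), of id i] by simp
  qed
  \<comment> \<open>Here variable \<open>0\<close> is unconstrained and the requirement
    \<open>W m\<close> excludes the \<open>m\<close>-th variable from some \<open>E i\<close>. As
    every element of the term model represents a variable, the type is omitted.\<close>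
  obtain S where S: "henkin_filter n M S" "\<And>m. \<exists>F. S F \<and> (\<exists>i. \<forall>e\<in>assignments M. F e \<longrightarrow> e m \<notin> E i)"
  proof (rule ex_henkin_filter[OF wf, where E = "\<lambda>_. univ M"
        and W = "\<lambda>m F. \<exists>i. \<forall>e\<in>assignments M. F e \<longrightarrow> e m \<notin> E i"])
    show "decseq (\<lambda>_. univ M)" by (simp add: decseq_def)
    show "univ M \<noteq> {}" by fact
    fix m F assume F: "definable n M F \<and> (\<forall>i::nat. \<exists>e\<in>assignments M. e 0 \<in> univ M \<and> F e)"
    have "{e m |e. e \<in> assignments M \<and> F e} \<noteq> {}" using F by blast
    then obtain i where "\<not> {e m |e. e \<in> assignments M \<and> F e} \<subseteq> E i"
      using E(4)[OF unary_definable_projection] F by blast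
    then obtain e where e: "e \<in> assignments M" "F e" "e m \<notin> E i" by blast
    have "definable n M (\<lambda>e. e 0 \<in> E i)" using E(3) by (auto simp: unary_definable_def)
    note dF = definable_conj[OF conjunct1[OF F] definable_not[OF definable_var_mem[OF this, of m]]]
    have eF: "\<exists>e\<in>assignments M. e 0 \<in> univ M \<and> F e \<and> \<not> e m \<in> E i"
      by (rule bexI[OF _ e(1)]) (use e assignments_apply in blast)
    show "\<exists>F'. (definable n M F' \<and> (\<forall>i::nat. \<exists>e\<in>assignments M. e 0 \<in> univ M \<and> F' e)) \<and>
        (\<forall>e\<in>assignments M. F' e \<longrightarrow> F e) \<and> (\<exists>i. \<forall>e\<in>assignments M. F' e \<longrightarrow> e m \<notin> E i)"
    proof (intro exI conjI allI)
      show "definable n M (\<lambda>e. F e \<and> \<not> e m \<in> E i)" by (rule dF)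
      show "\<exists>e\<in>assignments M. e 0 \<in> univ M \<and> F e \<and> \<not> e m \<in> E i" by (rule eF)
      show "\<forall>e\<in>assignments M. F e \<and> \<not> e m \<in> E i \<longrightarrow> F e" by simp
      show "\<forall>e\<in>assignments M. F e \<and> \<not> e m \<in> E i \<longrightarrow> e m \<notin> E i" by simp
    qed
  qed auto
  interpret omit: henkin_filter n M S by fact
  have omit: "\<exists>i. \<not> sat omit.term_model (omit.rep \<circ> (\<lambda>_. m)) (p i)" for m
  proof -
    obtain F i where F: "S F" "\<forall>e\<in>assignments M. F e \<longrightarrow> e m \<notin> E i" using S(2) by blast
    have "S (\<lambda>e. sat M (e \<circ> (\<lambda>_. m)) (Neg (p i)))"
    proof (rule omit.mono[OF F(1)])
      fix e assume "e \<in> assignments M" "F e"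
      then show "sat M (e \<circ> (\<lambda>_. m)) (Neg (p i))"
        using F(2) p(3)[OF assignments_comp, of e "\<lambda>_. m" i] by (simp only: sat.simps comp_apply) blast
    qed
    then have "sat omit.term_model (omit.rep \<circ> (\<lambda>_. m)) (Neg (p i))"
      using omit.sat_term_model[of "Neg (p i)" "\<lambda>_. m"] p(1) by simp
    then show ?thesis unfolding sat.simps by blast
  qed
  obtain N :: "nat ring_system" where N: "isomorphic_systems n real.term_model N"
    "isomorphic_systems n omit.term_model N"
    using cat[unfolded omega_categorical_def] real.model_of_term_model omit.model_of_term_model by metis
  obtain g where g: "bij_betw g (univ real.term_model) (univ N)"
    "\<And>f q. f \<in> assignments real.term_model \<Longrightarrow> pred_symbols q \<subseteq> {1..n} \<Longrightarrow>
       sat N (g \<circ> f) q = sat real.term_model f q"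
    using N(1) sat_iso[OF real.wf_term_model] unfolding isomorphic_systems_def bij_betw_def by metis
  obtain h where h: "bij_betw h (univ omit.term_model) (univ N)"
    "\<And>f q. f \<in> assignments omit.term_model \<Longrightarrow> pred_symbols q \<subseteq> {1..n} \<Longrightarrow>
       sat N (h \<circ> f) q = sat omit.term_model f q"
    using N(2) sat_iso[OF omit.wf_term_model] unfolding isomorphic_systems_def bij_betw_def by metis
  have "g (real.rep 0) \<in> univ N" using g(1) by (auto simp: bij_betw_def real.univ_term_model)
  then obtain m where m: "h (omit.rep m) = g (real.rep 0)"
    using h(1) unfolding bij_betw_def omit.univ_term_model by (metis imageE)
  obtain i where i: "\<not> sat omit.term_model (omit.rep \<circ> (\<lambda>_. m)) (p i)" using omit by blast
  have "sat N (h \<circ> (omit.rep \<circ> (\<lambda>_. m))) (p i) = sat N (g \<circ> real.rep) (p i)"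
    by (rule sat_cong) (use p(2)[of i] m in auto)
  moreover have "omit.rep \<circ> (\<lambda>_. m) \<in> assignments omit.term_model" "real.rep \<in> assignments real.term_model"
    by (auto simp: assignments_def real.univ_term_model omit.univ_term_model)
  ultimately show False using g(2)[OF _ p(1)] h(2)[OF _ p(1)] i real by blast
qed

section \<open>Finitely many types imply categoricity\<close>

lemma isomorphic_systems_sym:
  assumes "wf_system n M" "isomorphic_systems n M N"
  shows "isomorphic_systems n N M"
proof -
  obtain h where h: "bij_betw h (univ M) (univ N)" "h (zero_of M) = zero_of N"
    "\<And>a b. a \<in> univ M \<Longrightarrow> b \<in> univ M \<Longrightarrow> h (add_of M a b) = add_of N (h a) (h b) \<and>
       h (mult_of M a b) = mult_of N (h a) (h b)"
    "\<And>i a. i \<in> {1..n} \<Longrightarrow> a \<in> univ M \<Longrightarrow> a \<in> pred_of M i \<longleftrightarrow> h a \<in> pred_of N i"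
    using assms(2) unfolding isomorphic_systems_def by blast
  define g where "g = inv_into (univ M) h"
  have g: "bij_betw g (univ N) (univ M)" unfolding g_def by (rule bij_betw_inv_into[OF h(1)])
  have gh: "g (h a) = a" if "a \<in> univ M" for a
    unfolding g_def by (rule bij_betw_inv_into_left[OF h(1) that])
  have hg: "\<exists>a\<in>univ M. u = h a" if "u \<in> univ N" for u
    using h(1) that unfolding bij_betw_def by blast
  show ?thesis
    unfolding isomorphic_systems_def
  proof (intro exI[of _ g] conjI ballI g)
    show "g (zero_of N) = zero_of M" using gh[of "zero_of M"] h(2) assms(1) by (simp add: wf_system_def)
  next
    fix u v assume "u \<in> univ N" "v \<in> univ N"
    then obtain a b where ab: "a \<in> univ M" "b \<in> univ M" "u = h a" "v = h b" using hg by blast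
    have "add_of M a b \<in> univ M" "mult_of M a b \<in> univ M"
      using ab assms(1) by (simp_all add: wf_system_def)
    then show "g (add_of N u v) = add_of M (g u) (g v)" "g (mult_of N u v) = mult_of M (g u) (g v)"
      using h(3)[OF ab(1,2)] gh ab by (metis)+
  next
    fix i u assume "i \<in> {1..n}" "u \<in> univ N"
    then show "u \<in> pred_of N i \<longleftrightarrow> g u \<in> pred_of M i" using hg h(4) gh by metis
  qed
qed

lemma isomorphic_systems_trans:
  assumes "isomorphic_systems n M N" "isomorphic_systems n N K"
  shows "isomorphic_systems n M K"
proof -
  obtain h where h: "bij_betw h (univ M) (univ N)" "h (zero_of M) = zero_of N"
    "\<And>a b. a \<in> univ M \<Longrightarrow> b \<in> univ M \<Longrightarrow> h (add_of M a b) = add_of N (h a) (h b) \<and>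
       h (mult_of M a b) = mult_of N (h a) (h b)"
    "\<And>i a. i \<in> {1..n} \<Longrightarrow> a \<in> univ M \<Longrightarrow> a \<in> pred_of M i \<longleftrightarrow> h a \<in> pred_of N i"
    using assms(1) unfolding isomorphic_systems_def by blast
  obtain g where g: "bij_betw g (univ N) (univ K)" "g (zero_of N) = zero_of K"
    "\<And>a b. a \<in> univ N \<Longrightarrow> b \<in> univ N \<Longrightarrow> g (add_of N a b) = add_of K (g a) (g b) \<and>
       g (mult_of N a b) = mult_of K (g a) (g b)"
    "\<And>i a. i \<in> {1..n} \<Longrightarrow> a \<in> univ N \<Longrightarrow> a \<in> pred_of N i \<longleftrightarrow> g a \<in> pred_of K i"
    using assms(2) unfolding isomorphic_systems_def by blast
  have mem: "h a \<in> univ N" if "a \<in> univ M" for a using h(1) that by (auto simp: bij_betw_def)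
  show ?thesis
    unfolding isomorphic_systems_def
    by (intro exI[of _ "g \<circ> h"] conjI ballI bij_betw_trans[OF h(1) g(1)])
      (simp_all add: h(2,3) g(2,3) mem h(4) g(4)[OF _ mem, symmetric])
qed

text \<open>Categoricity quantifies over systems on sets of natural numbers, so \<open>M\<close>
  needs a copy among them to serve as the required model.\<close>

lemma countable_system_copy:
  assumes wf: "wf_system n M" and "countable (univ M)"
  obtains K :: "nat ring_system" where "isomorphic_systems n M K" "model_of n (theory_of n M) K"
proof -
  define \<iota> where "\<iota> = to_nat_on (univ M)"
  have inj: "inj_on \<iota> (univ M)" unfolding \<iota>_def using assms(2) by (rule inj_on_to_nat_on)
  define \<kappa> where "\<kappa> = inv_into (univ M) \<iota>"
  have \<kappa>: "\<kappa> (\<iota> a) = a" if "a \<in> univ M" for a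
    unfolding \<kappa>_def by (rule inv_into_f_f[OF inj that])
  \<comment> \<open>Intersecting with \<open>univ M\<close> matters since \<iota> is injective only
    there, and \<open>wf_system\<close> constrains just the predicates \<open>1\<close> to
    \<open>n\<close>.\<close>
  define K where "K = \<lparr>univ = \<iota> ` univ M, zero_of = \<iota> (zero_of M),
    add_of = (\<lambda>u v. \<iota> (add_of M (\<kappa> u) (\<kappa> v))), mult_of = (\<lambda>u v. \<iota> (mult_of M (\<kappa> u) (\<kappa> v))),
    pred_of = (\<lambda>i. \<iota> ` (pred_of M i \<inter> univ M))\<rparr>"
  have wfK: "wf_system n K"
    using wf unfolding wf_system_def K_def by (auto simp: \<kappa>)
  have ops: "\<iota> (add_of M a b) = add_of K (\<iota> a) (\<iota> b) \<and> \<iota> (mult_of M a b) = mult_of K (\<iota> a) (\<iota> b)"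
    if "a \<in> univ M" "b \<in> univ M" for a b
    using that by (simp add: K_def \<kappa>)
  have preds: "a \<in> pred_of M i \<longleftrightarrow> \<iota> a \<in> pred_of K i" if "a \<in> univ M" for a i
    using that inj unfolding K_def by (auto dest: inj_onD)
  have [simp]: "univ K = \<iota> ` univ M" "zero_of K = \<iota> (zero_of M)" by (simp_all add: K_def)
  have "isomorphic_systems n M K"
    unfolding isomorphic_systems_def using inj ops preds
    by (intro exI[of _ \<iota>]) (auto simp: bij_betw_def)
  moreover have "model_of n (theory_of n M) K"
    unfolding model_of_def
  proof (intro conjI ballI wfK)
    fix p assume p: "p \<in> theory_of n M"
    show "holds_in K p"
      unfolding holds_in_def
    proof (intro allI impI)
      fix f :: "nat \<Rightarrow> nat" assume f: "range f \<subseteq> univ K"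
      have "f = \<iota> \<circ> (\<kappa> \<circ> f)"
      proof
        fix i
        obtain a where "a \<in> univ M" "f i = \<iota> a" using f by auto
        then show "f i = (\<iota> \<circ> (\<kappa> \<circ> f)) i" by (simp add: \<kappa>)
      qed
      moreover have as: "\<kappa> \<circ> f \<in> assignments M"
      proof -
        have "\<kappa> (f i) \<in> univ M" for i
        proof -
          obtain a where "a \<in> univ M" "f i = \<iota> a" using f by auto
          then show ?thesis by (simp add: \<kappa>)
        qed
        then show ?thesis by (auto simp: assignments_def)
      qed
      moreover have "sat M (\<kappa> \<circ> f) p" using p as by (auto simp: theory_of_def holds_in_def assignments_def)
      moreover have "sat K (\<iota> \<circ> (\<kappa> \<circ> f)) p = sat M (\<kappa> \<circ> f) p"
        by (rule sat_iso[OF wf inj])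
          (use ops preds p as in \<open>auto simp: theory_of_def sentences_def\<close>)
      ultimately show "sat K f p" by metis
    qed
  qed
  ultimately show thesis using that by blast
qed

section \<open>Complete types in the first k variables, isolating formulas, back and forth\<close>

definition agree :: "nat \<Rightarrow> nat \<Rightarrow> 'a ring_system \<Rightarrow> (nat \<Rightarrow> 'a) \<Rightarrow> 'b ring_system \<Rightarrow> (nat \<Rightarrow> 'b) \<Rightarrow> bool" where
  "agree n k M e N f \<longleftrightarrow>
     (\<forall>p. pred_symbols p \<subseteq> {1..n} \<longrightarrow> free_vars p \<subseteq> {..<k} \<longrightarrow> sat M e p = sat N f p)"

text \<open>\<open>q\<close> isolates a complete type in the variables below \<open>k\<close>, where
  \<open>agree\<close> is equality of these types. An unsatisfiable \<open>q\<close> also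
  qualifies.\<close>

definition isolating :: "nat \<Rightarrow> nat \<Rightarrow> 'a ring_system \<Rightarrow> fm \<Rightarrow> bool" where
  "isolating n k M q \<longleftrightarrow> pred_symbols q \<subseteq> {1..n} \<and> free_vars q \<subseteq> {..<k} \<and>
     (\<forall>e\<in>assignments M. \<forall>e'\<in>assignments M. sat M e q \<longrightarrow> sat M e' q \<longrightarrow> agree n k M e M e')"

lemma sat_foldr_Conj:
  "sat M e (foldr Conj ps (Eq TZero TZero)) \<longleftrightarrow> (\<forall>p\<in>set ps. sat M e p)"
  by (induction ps) auto

lemma free_vars_foldr_Conj:
  "free_vars (foldr Conj ps (Eq TZero TZero)) = (\<Union>p\<in>set ps. free_vars p)"
  by (induction ps) auto

lemma pred_symbols_foldr_Conj:
  "pred_symbols (foldr Conj ps (Eq TZero TZero)) = (\<Union>p\<in>set ps. pred_symbols p)"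
  by (induction ps) auto

text \<open>An invariant with finitely many values that determines the type leaves only finitely
  many types. Hence \<open>e\<close> is separated from the representatives of all other types by
  finitely many formulas, and their conjunction isolates its type.\<close>

lemma finite_invariant_imp_isolating:
  fixes I :: "(nat \<Rightarrow> 'a) \<Rightarrow> 'c"
  assumes fin: "finite (I ` assignments M)"
    and inv: "\<And>e e'. e \<in> assignments M \<Longrightarrow> e' \<in> assignments M \<Longrightarrow> I e = I e' \<Longrightarrow> agree n k M e M e'"
  obtains qs where "\<And>q. q \<in> set qs \<Longrightarrow> isolating n k M q"
    "\<And>e. e \<in> assignments M \<Longrightarrow> \<exists>q\<in>set qs. sat M e q"
proof -
  let ?A = "assignments M"
  have "\<forall>v\<in>I ` ?A. \<exists>e\<in>?A. I e = v" by blast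
  then obtain r where r: "\<And>v. v \<in> I ` ?A \<Longrightarrow> r v \<in> ?A \<and> I (r v) = v" by metis
  have iso: "\<exists>q. isolating n k M q \<and> sat M e q" if e: "e \<in> ?A" for e
  proof -
    let ?B = "{v \<in> I ` ?A. \<not> agree n k M e M (r v)}"
    have "\<exists>p. pred_symbols p \<subseteq> {1..n} \<and> free_vars p \<subseteq> {..<k} \<and> sat M e p \<and> \<not> sat M (r v) p"
      if "v \<in> ?B" for v
    proof -
      from that obtain p where p: "pred_symbols p \<subseteq> {1..n}" "free_vars p \<subseteq> {..<k}"
        "sat M e p \<noteq> sat M (r v) p" unfolding agree_def by blast
      show ?thesis
      proof (cases "sat M e p")
        case True
        then show ?thesis using p by blast
      next
        case False
        then show ?thesis using p by (intro exI[of _ "Neg p"]) simp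
      qed
    qed
    then obtain \<theta> where \<theta>: "\<And>v. v \<in> ?B \<Longrightarrow> pred_symbols (\<theta> v) \<subseteq> {1..n} \<and> free_vars (\<theta> v) \<subseteq> {..<k} \<and>
        sat M e (\<theta> v) \<and> \<not> sat M (r v) (\<theta> v)" by metis
    have "finite (\<theta> ` ?B)" using fin by auto
    from finite_list[OF this] obtain ps where ps: "set ps = \<theta> ` ?B" ..
    define q where "q = foldr Conj ps (Eq TZero TZero)"
    have pq: "pred_symbols q \<subseteq> {1..n}" "free_vars q \<subseteq> {..<k}"
      unfolding q_def pred_symbols_foldr_Conj free_vars_foldr_Conj ps using \<theta> by blast+
    have "sat M e q" unfolding q_def sat_foldr_Conj ps using \<theta> by blast
    have ag: "agree n k M e M e'" if e': "e' \<in> ?A" "sat M e' q" for e'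
    proof -
      have rv: "I (r (I e')) = I e'" "r (I e') \<in> ?A" using r e' by blast+
      have a: "agree n k M (r (I e')) M e'" by (rule inv[OF rv(2) e'(1) rv(1)])
      have "I e' \<notin> ?B"
      proof
        assume B: "I e' \<in> ?B"
        then have "sat M e' (\<theta> (I e'))" using e'(2) unfolding q_def sat_foldr_Conj ps by blast
        then show False using \<theta>[OF B] a unfolding agree_def by blast
      qed
      then show ?thesis using a e'(1) unfolding agree_def by blast
    qed
    have "isolating n k M q"
      unfolding isolating_def
    proof (intro conjI ballI impI pq)
      fix e1 e2 assume "e1 \<in> ?A" "e2 \<in> ?A" "sat M e1 q" "sat M e2 q"
      then have "agree n k M e M e1" "agree n k M e M e2" using ag by blast+
      then show "agree n k M e1 M e2" unfolding agree_def by blast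
    qed
    then show ?thesis using \<open>sat M e q\<close> by blast
  qed
  then have "\<forall>v\<in>I ` ?A. \<exists>q. isolating n k M q \<and> sat M (r v) q" using r by blast
  then obtain Q where Q: "\<And>v. v \<in> I ` ?A \<Longrightarrow> isolating n k M (Q v) \<and> sat M (r v) (Q v)" by metis
  obtain qs where qs: "set qs = Q ` I ` ?A" using finite_list[of "Q ` I ` ?A"] fin by blast
  show thesis
  proof (rule that[of qs])
    show "isolating n k M q" if "q \<in> set qs" for q using that Q unfolding qs by blast
    show "\<exists>q\<in>set qs. sat M e q" if e: "e \<in> ?A" for e
    proof -
      have v: "I e \<in> I ` ?A" using e by blast
      have "agree n k M (r (I e)) M e" using r[OF v] e by (intro inv) auto
      then have "sat M e (Q (I e))" using Q[OF v] unfolding agree_def isolating_def by blast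
      then show ?thesis using v unfolding qs by blast
    qed
  qed
qed

text \<open>If \<open>p\<close> holds at \<open>e\<close> but not at \<open>f\<close>, then
  \<open>q\<close> without \<open>p\<close> is satisfiable in \<open>N\<close>, hence in
  \<open>M\<close>, although \<open>q\<close> decides \<open>p\<close> there.\<close>

lemma isolating_transfer:
  assumes wf: "wf_system n M" and mod: "model_of n (theory_of n M) N" and iso: "isolating n k M q"
    and e: "e \<in> assignments M" "sat M e q" and f: "f \<in> assignments N" "sat N f q"
  shows "agree n k M e N f"
  unfolding agree_def
proof (intro allI impI)
  have *: "sat N f p" if p: "pred_symbols p \<subseteq> {1..n}" "free_vars p \<subseteq> {..<k}" "sat M e p" for p
  proof (rule ccontr)
    assume "\<not> sat N f p"
    then have "\<exists>f\<in>assignments N. sat N f (Conj q (Neg p))" using f by (intro bexI[of _ f]) simp_all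
    moreover have "pred_symbols (Conj q (Neg p)) \<subseteq> {1..n}" using iso p by (simp add: isolating_def)
    ultimately obtain e' where "e' \<in> assignments M" "sat M e' (Conj q (Neg p))"
      using satisfiable_transfer[OF wf mod] by blast
    then have "agree n k M e M e'" "\<not> sat M e' p"
      using iso e unfolding isolating_def sat.simps by blast+
    then show False using p unfolding agree_def by blast
  qed
  fix p assume p: "pred_symbols p \<subseteq> {1..n}" "free_vars p \<subseteq> {..<k}"
  show "sat M e p = sat N f p" using *[of p] *[of "Neg p"] p by auto
qed

text \<open>The formulas \<open>Exists k q\<close> have only the first \<open>k\<close> variables
  free, so the agreement of \<open>e\<close> and \<open>f\<close> tells which \<open>q\<close> can
  be realised by an extension. As \<open>qs\<close> is a finite list, one formula states that none
  of its members holds; it is unsatisfiable in \<open>M\<close>, hence in \<open>N\<close>.\<close>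

lemma back_and_forth:
  assumes wf: "wf_system n M" and mod: "model_of n (theory_of n M) N"
    and iso: "\<And>q. q \<in> set qs \<Longrightarrow> isolating n (Suc k) M q"
    and cover: "\<And>e. e \<in> assignments M \<Longrightarrow> \<exists>q\<in>set qs. sat M e q"
    and e: "e \<in> assignments M" and f: "f \<in> assignments N" and agree: "agree n k M e N f"
  shows forth_extension: "a \<in> univ M \<Longrightarrow> \<exists>b\<in>univ N. agree n (Suc k) M (e(k := a)) N (f(k := b))"
    and back_extension: "b \<in> univ N \<Longrightarrow> \<exists>a\<in>univ M. agree n (Suc k) M (e(k := a)) N (f(k := b))"
proof -
  have ex: "sat M e (Exists k q) = sat N f (Exists k q)" if "q \<in> set qs" for q
  proof -
    have "free_vars (Exists k q) \<subseteq> {..<k}" "pred_symbols (Exists k q) \<subseteq> {1..n}"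
      using iso[OF that] by (auto simp: isolating_def less_Suc_eq)
    then show ?thesis using agree unfolding agree_def by blast
  qed
  show "\<exists>b\<in>univ N. agree n (Suc k) M (e(k := a)) N (f(k := b))" if a: "a \<in> univ M"
  proof -
    obtain q where q: "q \<in> set qs" "sat M (e(k := a)) q" using cover[OF assignments_upd[OF e a]] by blast
    then have "sat N f (Exists k q)" using ex[OF q(1)] a unfolding sat.simps by blast
    then obtain b where b: "b \<in> univ N" "sat N (f(k := b)) q" unfolding sat.simps by blast
    have "agree n (Suc k) M (e(k := a)) N (f(k := b))"
      by (rule isolating_transfer[OF wf mod iso[OF q(1)] assignments_upd[OF e a] q(2) assignments_upd[OF f b(1)] b(2)])
    then show ?thesis using b by blast
  qed
  show "\<exists>a\<in>univ M. agree n (Suc k) M (e(k := a)) N (f(k := b))" if b: "b \<in> univ N"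
  proof -
    have "\<exists>q\<in>set qs. sat N (f(k := b)) q"
    proof (rule ccontr)
      assume no: "\<not> ?thesis"
      define p where "p = foldr Conj (map Neg qs) (Eq TZero TZero)"
      have "sat N (f(k := b)) p" using no unfolding p_def sat_foldr_Conj by simp
      moreover have "pred_symbols p \<subseteq> {1..n}"
        unfolding p_def pred_symbols_foldr_Conj using iso unfolding isolating_def by fastforce
      ultimately obtain e' where "e' \<in> assignments M" "sat M e' p"
        using satisfiable_transfer[OF wf mod, of p] assignments_upd[OF f b] by blast
      then show False using cover[of e'] unfolding p_def sat_foldr_Conj by auto
    qed
    then obtain q where q: "q \<in> set qs" "sat N (f(k := b)) q" by blast
    then have "sat M e (Exists k q)" using ex[OF q(1)] b unfolding sat.simps by blast
    then obtain a where a: "a \<in> univ M" "sat M (e(k := a)) q" unfolding sat.simps by blast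
    have "agree n (Suc k) M (e(k := a)) N (f(k := b))"
      by (rule isolating_transfer[OF wf mod iso[OF q(1)] assignments_upd[OF e a(1)] a(2) assignments_upd[OF f b] q(2)])
    then show ?thesis using a by blast
  qed
qed

lemma agree_all_imp_isomorphic:
  assumes wfM: "wf_system n M" and wfN: "wf_system n N"
    and e: "range e = univ M" and f: "range f = univ N"
    and agree: "\<And>p. pred_symbols p \<subseteq> {1..n} \<Longrightarrow> sat M e p = sat N f p"
  shows "isomorphic_systems n M N"
proof -
  define h where "h a = f (SOME i. e i = a)" for a
  have eq: "e i = e j \<longleftrightarrow> f i = f j" for i j using agree[of "Eq (TVar i) (TVar j)"] by simp
  have he: "h (e i) = f i" for i
  proof -
    have "e (SOME j. e j = e i) = e i" by (rule someI[of _ i]) simp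
    then show ?thesis unfolding h_def eq .
  qed
  have "bij_betw h (univ M) (univ N)"
    unfolding bij_betw_def e[symmetric] f[symmetric]
    by (auto simp: inj_on_def he eq image_iff)
  moreover have "h (zero_of M) = zero_of N"
  proof -
    have "zero_of M \<in> range e" using wfM e by (simp add: wf_system_def)
    then obtain i where i: "zero_of M = e i" by blast
    then show ?thesis using agree[of "Eq TZero (TVar i)"] he by simp
  qed
  moreover have "h (add_of M a b) = add_of N (h a) (h b) \<and> h (mult_of M a b) = mult_of N (h a) (h b)"
    if ab: "a \<in> univ M" "b \<in> univ M" for a b
  proof -
    have "a \<in> range e" "b \<in> range e" "add_of M a b \<in> range e" "mult_of M a b \<in> range e"
      using wfM ab e by (simp_all add: wf_system_def)
    then obtain i j k l where ij: "a = e i" "b = e j" "add_of M a b = e k" "mult_of M a b = e l" by blast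
    show ?thesis
      using agree[of "Eq (TAdd (TVar i) (TVar j)) (TVar k)"] agree[of "Eq (TMult (TVar i) (TVar j)) (TVar l)"]
      using ij he by simp
  qed
  moreover have "a \<in> pred_of M i \<longleftrightarrow> h a \<in> pred_of N i" if ia: "i \<in> {1..n}" "a \<in> univ M" for i a
  proof -
    obtain j where "a = e j" using ia e by blast
    then show ?thesis using agree[of "Pred i (TVar j)"] ia he by simp
  qed
  ultimately show ?thesis unfolding isomorphic_systems_def by blast
qed

text \<open>Back and forth between \<open>M\<close> and an arbitrary model on natural numbers. As
  all such models are isomorphic to \<open>M\<close>, they are isomorphic to its copy
  \<open>K\<close>.\<close>

theorem finite_invariants_imp_omega_categorical:
  fixes I :: "nat \<Rightarrow> (nat \<Rightarrow> 'a) \<Rightarrow> 'c"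
  assumes wf: "wf_system n M" and count: "countable (univ M)"
    and fin: "\<And>k. finite (I k ` assignments M)"
    and inv: "\<And>k e e'. e \<in> assignments M \<Longrightarrow> e' \<in> assignments M \<Longrightarrow> I k e = I k e' \<Longrightarrow> agree n k M e M e'"
  shows "omega_categorical n M"
proof -
  have "\<exists>qs. (\<forall>q\<in>set qs. isolating n k M q) \<and> (\<forall>e\<in>assignments M. \<exists>q\<in>set qs. sat M e q)" for k
    by (rule finite_invariant_imp_isolating[OF fin[of k] inv[of _ _ k]]) blast+
  then obtain qs where qs: "\<And>k q. q \<in> set (qs k) \<Longrightarrow> isolating n k M q"
    "\<And>k e. e \<in> assignments M \<Longrightarrow> \<exists>q\<in>set (qs k). sat M e q" by metis
  have iso: "isomorphic_systems n M N" if mod: "model_of n (theory_of n M) N" for N :: "nat ring_system"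
  proof -
    have wfN: "wf_system n N" using mod by (simp add: model_of_def)
    have ne: "univ M \<noteq> {}" "univ N \<noteq> {}"
      using wf_system_univ_nonempty[OF wf] wf_system_univ_nonempty[OF wfN] .
    define \<alpha> \<beta> where "\<alpha> = from_nat_into (univ M)" and "\<beta> = from_nat_into (univ N)"
    have \<alpha>: "\<alpha> i \<in> univ M" and \<beta>: "\<beta> i \<in> univ N" for i
      unfolding \<alpha>_def \<beta>_def by (rule from_nat_into[OF ne(1)], rule from_nat_into[OF ne(2)])
    define P where "P k ef \<longleftrightarrow> fst ef \<in> assignments M \<and> snd ef \<in> assignments N \<and>
      agree n k M (fst ef) N (snd ef)" for k ef
    \<comment> \<open>Stage \<open>k\<close> fixes the \<open>k\<close>-th coordinates of both
      sequences: even stages take the next element of \<open>M\<close>, odd stages the next element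
      of \<open>N\<close>, so both enumerations are exhausted.\<close>
    define R where "R k ef ef' \<longleftrightarrow> (\<exists>a b. fst ef' = (fst ef)(k := a) \<and> snd ef' = (snd ef)(k := b) \<and>
      (if even k then a = \<alpha> (k div 2) else b = \<beta> (k div 2)))" for k and ef ef' :: "(nat \<Rightarrow> 'a) \<times> (nat \<Rightarrow> nat)"
    have "\<exists>F. \<forall>k. P k (F k) \<and> R k (F k) (F (Suc k))"
    proof (rule dependent_nat_choice)
      obtain e0 f0 where ef: "e0 \<in> assignments M" "f0 \<in> assignments N"
        using ne assignments_const by (metis ex_in_conv)
      have *: "sat N f0 p" if p: "pred_symbols p \<subseteq> {1..n}" "free_vars p \<subseteq> {}" "sat M e0 p" for p
      proof -
        obtain f1 where "sat N f1 p" using satisfiable_transfer[OF wf mod p(1)] p(3) ef(1) by blast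
        moreover have "sat N f1 p = sat N f0 p" by (rule sat_cong) (use p(2) in auto)
        ultimately show ?thesis by simp
      qed
      have "agree n 0 M e0 N f0"
        unfolding agree_def
      proof (intro allI impI)
        fix p assume p: "pred_symbols p \<subseteq> {1..n}" "free_vars p \<subseteq> {..<0}"
        show "sat M e0 p = sat N f0 p" using *[of p] *[of "Neg p"] p by auto
      qed
      then show "\<exists>ef. P 0 ef" using ef unfolding P_def by (intro exI[of _ "(e0, f0)"]) simp
    next
      fix ef k assume P: "P k ef"
      obtain e f where ef: "ef = (e, f)" by (cases ef)
      have e: "e \<in> assignments M" "f \<in> assignments N" "agree n k M e N f" using P unfolding P_def ef by auto
      have "\<exists>a\<in>univ M. \<exists>b\<in>univ N. agree n (Suc k) M (e(k := a)) N (f(k := b)) \<and>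
          (if even k then a = \<alpha> (k div 2) else b = \<beta> (k div 2))"
      proof (cases "even k")
        case True
        then show ?thesis
          using forth_extension[OF wf mod qs(1)[of _ "Suc k"] qs(2) e \<alpha>[of "k div 2"]] \<alpha>[of "k div 2"] by auto
      next
        case False
        then show ?thesis
          using back_extension[OF wf mod qs(1)[of _ "Suc k"] qs(2) e \<beta>[of "k div 2"]] \<beta>[of "k div 2"] by auto
      qed
      then obtain a b where ab: "a \<in> univ M" "b \<in> univ N" "agree n (Suc k) M (e(k := a)) N (f(k := b))"
          "if even k then a = \<alpha> (k div 2) else b = \<beta> (k div 2)" by blast
      show "\<exists>ef'. P (Suc k) ef' \<and> R k ef ef'"
      proof (intro exI conjI)
        show "P (Suc k) (e(k := a), f(k := b))"
          unfolding P_def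
          using assignments_upd[OF e(1) ab(1)] assignments_upd[OF e(2) ab(2)] ab(3) by simp
        show "R k ef (e(k := a), f(k := b))"
          unfolding R_def ef fst_conv snd_conv using ab(4) by blast
      qed
    qed
    then obtain F where F: "\<And>k. P k (F k)" "\<And>k. R k (F k) (F (Suc k))" by blast
    define e f where "e i = fst (F (Suc i)) i" and "f i = snd (F (Suc i)) i" for i
    have lim: "fst (F k) i = e i \<and> snd (F k) i = f i" if "i < k" for i k
      using Suc_leI[OF that]
    proof (induction k rule: dec_induct)
      case base
      show ?case by (simp add: e_def f_def)
    next
      case (step k)
      obtain a b where "fst (F (Suc k)) = (fst (F k))(k := a)" "snd (F (Suc k)) = (snd (F k))(k := b)"
        using F(2)[of k] unfolding R_def by blast
      then show ?case using step by simp
    qed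
    have "e i \<in> univ M" "f i \<in> univ N" for i
      using F(1)[of "Suc i"] unfolding P_def e_def f_def by (auto intro: assignments_apply)
    then have sub: "range e \<subseteq> univ M" "range f \<subseteq> univ N" by auto
    have "e (2 * i) = \<alpha> i" "f (2 * i + 1) = \<beta> i" for i
      using F(2)[of "2 * i"] F(2)[of "2 * i + 1"] unfolding R_def e_def f_def by auto
    then have "range \<alpha> \<subseteq> range e" "range \<beta> \<subseteq> range f" by (metis image_subsetI rangeI)+
    moreover have "univ M \<subseteq> range \<alpha>" "univ N \<subseteq> range \<beta>"
      unfolding \<alpha>_def \<beta>_def using range_from_nat_into[OF ne(1) count] range_from_nat_into[OF ne(2) countableI_type]
      by simp_all
    ultimately have "univ M \<subseteq> range e" "univ N \<subseteq> range f" by (meson subset_trans)+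
    then have ran: "range e = univ M" "range f = univ N"
      using sub by (simp_all add: subset_antisym)
    have "sat M e p = sat N f p" if p: "pred_symbols p \<subseteq> {1..n}" for p
    proof -
      \<comment> \<open>A stage from which on no free variable of \<open>p\<close> changes;
        \<open>0\<close> is inserted so that \<open>Max\<close> is meaningful for sentences.\<close>
      define k where "k = Suc (Max (insert 0 (free_vars p)))"
      have k: "i < k" if "i \<in> free_vars p" for i
        unfolding k_def using that finite_free_vars[of p] by (simp add: less_Suc_eq_le)
      have "sat M (fst (F k)) p = sat N (snd (F k)) p"
        using F(1)[of k] p k unfolding P_def agree_def by blast
      moreover have "sat M (fst (F k)) p = sat M e p" by (rule sat_cong) (use lim k in blast)
      moreover have "sat N (snd (F k)) p = sat N f p" by (rule sat_cong) (use lim k in blast)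
      ultimately show ?thesis by simp
    qed
    then show ?thesis by (rule agree_all_imp_isomorphic[OF wf wfN ran])
  qed
  obtain K :: "nat ring_system" where K: "isomorphic_systems n M K" "model_of n (theory_of n M) K"
    using countable_system_copy[OF wf count] by metis
  have "isomorphic_systems n N K" if "model_of n (theory_of n M) N" for N :: "nat ring_system"
    using isomorphic_systems_trans[OF isomorphic_systems_sym[OF wf iso[OF that]] K(1)] .
  with K(2) show ?thesis unfolding omega_categorical_def by blast
qed

section \<open>Derived-set algebras and their atoms\<close>

text \<open>By T1, a neighbourhood of \<open>x\<close> that contains another limit point
  \<open>y\<close> of \<open>S\<close> remains an open neighbourhood of \<open>y\<close> after
  removal of \<open>x\<close>. So it contains a point of \<open>S\<close> other than
  \<open>x\<close>.\<close>

lemma derived_set_of_derived_set_of_subset: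
  assumes "t1_space X"
  shows "X derived_set_of (X derived_set_of S) \<subseteq> X derived_set_of S"
proof
  fix x assume x: "x \<in> X derived_set_of (X derived_set_of S)"
  show "x \<in> X derived_set_of S"
    unfolding in_derived_set_of
  proof (intro conjI allI impI)
    show "x \<in> topspace X" using x unfolding in_derived_set_of by blast
    fix U assume U: "x \<in> U \<and> openin X U"
    then obtain y where y: "y \<noteq> x" "y \<in> X derived_set_of S" "y \<in> U"
      using x unfolding in_derived_set_of by blast
    have "openin X (U - {x})"
    proof (rule openin_diff)
      have "x \<in> topspace X" using x unfolding in_derived_set_of by blast
      then show "closedin X {x}" using assms unfolding t1_space_closedin_singleton by blast
    qed (use U in blast)
    moreover have "\<forall>T. y \<in> T \<and> openin X T \<longrightarrow> (\<exists>z. z \<noteq> y \<and> z \<in> S \<and> z \<in> T)"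
      using y(2) unfolding in_derived_set_of by (rule conjunct2)
    moreover have "y \<in> U - {x}" using y by blast
    ultimately obtain z where "z \<in> S" "z \<in> U - {x}" by meson
    then show "\<exists>y. y \<noteq> x \<and> y \<in> S \<and> y \<in> U" by blast
  qed
qed

lemma closedin_derived_set_of:
  "t1_space X \<Longrightarrow> closedin X (X derived_set_of S)"
  by (simp add: closedin_contains_derived_set derived_set_of_derived_set_of_subset
      derived_set_of_subset_topspace)

lemma closure_of_eq_Un_derived: "S \<subseteq> topspace X \<Longrightarrow> X closure_of S = S \<union> X derived_set_of S"
  by (auto simp: closure_of derived_set_of_subset_topspace in_derived_set_of)

lemma algebra_subset_Pow: "algebra \<Omega> \<B> \<Longrightarrow> \<B> \<subseteq> Pow \<Omega>"
  by (simp add: algebra_iff_Un)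

lemma algebra_closed_hull:
  fixes f :: "'x set \<Rightarrow> 'x set" and \<Omega> :: "'x set"
  defines "H \<A> \<equiv> (\<lambda>\<B>. algebra \<Omega> \<B> \<and> (\<forall>S\<in>\<B>. f S \<in> \<B>)) hull \<A>"
  assumes "\<A> \<subseteq> Pow \<Omega>" "\<And>S. S \<subseteq> \<Omega> \<Longrightarrow> f S \<subseteq> \<Omega>"
  shows "algebra \<Omega> (H \<A>)" "\<And>S. S \<in> H \<A> \<Longrightarrow> f S \<in> H \<A>"
proof -
  let ?T = "{\<B>. (algebra \<Omega> \<B> \<and> (\<forall>S\<in>\<B>. f S \<in> \<B>)) \<and> \<A> \<subseteq> \<B>}"
  have H: "H \<A> = \<Inter>?T" unfolding H_def hull_def by simp
  have P: "Pow \<Omega> \<in> ?T" using assms by (auto intro: algebra_Pow)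
  show "algebra \<Omega> (H \<A>)"
    unfolding algebra_iff_Un
  proof (intro conjI ballI)
    show "H \<A> \<subseteq> Pow \<Omega>" unfolding H using P by (rule Inter_lower)
    show "{} \<in> H \<A>" unfolding H by (rule InterI) (simp add: algebra_iff_Un)
    show "\<Omega> - a \<in> H \<A>" if "a \<in> H \<A>" for a
      unfolding H by (rule InterI) (use that H in \<open>simp add: algebra_iff_Un\<close>)
    show "a \<union> b \<in> H \<A>" if "a \<in> H \<A>" "b \<in> H \<A>" for a b
      unfolding H by (rule InterI) (use that H in \<open>simp add: algebra_iff_Un\<close>)
  qed
  show "f S \<in> H \<A>" if "S \<in> H \<A>" for S
    unfolding H by (rule InterI) (use that H in simp)
qed

lemma derived_subalgebra:
  assumes "\<A> \<subseteq> Pow (topspace X)"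
  shows "algebra (topspace X) (derived_subalgebra X \<A>)"
    and "S \<in> derived_subalgebra X \<A> \<Longrightarrow> X derived_set_of S \<in> derived_subalgebra X \<A>"
  using algebra_closed_hull[where f = "\<lambda>S. X derived_set_of S", OF assms derived_set_of_subset_topspace]
  unfolding derived_subalgebra_def by auto

lemma closure_subalgebra:
  assumes "\<A> \<subseteq> Pow (topspace X)"
  shows "algebra (topspace X) (closure_subalgebra X \<A>)"
    and "S \<in> closure_subalgebra X \<A> \<Longrightarrow> X closure_of S \<in> closure_subalgebra X \<A>"
  using algebra_closed_hull[where f = "\<lambda>S. X closure_of S", OF assms closure_of_subset_topspace]
  unfolding closure_subalgebra_def by auto

lemma subset_derived_subalgebra: "\<A> \<subseteq> derived_subalgebra X \<A>"
  unfolding derived_subalgebra_def by (rule hull_subset)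

lemma subset_closure_subalgebra: "\<A> \<subseteq> closure_subalgebra X \<A>"
  unfolding closure_subalgebra_def by (rule hull_subset)

lemma derived_subalgebra_minimal:
  "\<A> \<subseteq> \<B> \<Longrightarrow> algebra (topspace X) \<B> \<Longrightarrow> (\<And>S. S \<in> \<B> \<Longrightarrow> X derived_set_of S \<in> \<B>) \<Longrightarrow>
     derived_subalgebra X \<A> \<subseteq> \<B>"
  unfolding derived_subalgebra_def by (rule hull_minimal) auto

lemma closure_subalgebra_minimal:
  "\<A> \<subseteq> \<B> \<Longrightarrow> algebra (topspace X) \<B> \<Longrightarrow> (\<And>S. S \<in> \<B> \<Longrightarrow> X closure_of S \<in> \<B>) \<Longrightarrow>
     closure_subalgebra X \<A> \<subseteq> \<B>"
  unfolding closure_subalgebra_def by (rule hull_minimal) auto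

section \<open>Atoms of set algebras and unions of partition blocks\<close>

lemma atom_cases:
  assumes "algebra \<Omega> \<B>" "A \<in> atoms \<B>" "S \<in> \<B>"
  shows "A \<subseteq> S \<or> A \<inter> S = {}"
proof -
  interpret algebra \<Omega> \<B> by fact
  have "A \<inter> S \<in> \<B>" using assms by (auto simp: atoms_def)
  then show ?thesis using assms by (auto simp: atoms_def)
qed

text \<open>Finiteness makes the intersection of all members containing a point \<open>x\<close> a
  member; it is the atom of \<open>x\<close>.\<close>

lemma atoms_partition_finite:
  assumes alg: "algebra \<Omega> \<B>" and fin: "finite \<B>"
  shows "partition_on \<Omega> (atoms \<B>)"
proof (rule partition_onI)
  interpret algebra \<Omega> \<B> by fact
  show "\<Union> (atoms \<B>) = \<Omega>"
  proof
    show "\<Union> (atoms \<B>) \<subseteq> \<Omega>" using space_closed by (auto simp: atoms_def)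
    show "\<Omega> \<subseteq> \<Union> (atoms \<B>)"
    proof
      fix x assume x: "x \<in> \<Omega>"
      define A where "A = \<Inter>{S \<in> \<B>. x \<in> S}"
      have "{S \<in> \<B>. x \<in> S} \<noteq> {}" using x by auto
      then have A: "A \<in> \<B>" unfolding A_def using fin by (intro finite_INT[of _ "\<lambda>S. S", simplified]) auto
      have xA: "x \<in> A" by (auto simp: A_def)
      have "B = {} \<or> B = A" if B: "B \<in> \<B>" "B \<subseteq> A" for B
      proof (cases "x \<in> B")
        case True
        then have "A \<subseteq> B" using B by (auto simp: A_def)
        then show ?thesis using B by blast
      next
        case False
        then have "\<Omega> - B \<in> {S \<in> \<B>. x \<in> S}" using B x by auto
        then have "A \<subseteq> \<Omega> - B" unfolding A_def by blast
        then show ?thesis using B by blast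
      qed
      then have "A \<in> atoms \<B>" using A xA by (auto simp: atoms_def)
      then show "x \<in> \<Union> (atoms \<B>)" using xA by blast
    qed
  qed
  show "disjnt A B" if "A \<in> atoms \<B>" "B \<in> atoms \<B>" "A \<noteq> B" for A B
  proof -
    have "A \<subseteq> B \<or> A \<inter> B = {}" using atom_cases[OF alg that(1)] that(2) by (auto simp: atoms_def)
    then show ?thesis using that by (auto simp: atoms_def disjnt_def)
  qed
  show "{} \<notin> atoms \<B>" by (simp add: atoms_def)
qed

lemma eq_Union_atoms:
  assumes "algebra \<Omega> \<B>" "partition_on \<Omega> (atoms \<B>)" "S \<in> \<B>"
  shows "S = \<Union>{A \<in> atoms \<B>. A \<subseteq> S}"
proof
  show "S \<subseteq> \<Union>{A \<in> atoms \<B>. A \<subseteq> S}"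
  proof
    fix x assume x: "x \<in> S"
    have "S \<subseteq> \<Omega>" using assms(1,3) by (auto simp: algebra_iff_Un)
    then obtain A where A: "A \<in> atoms \<B>" "x \<in> A" using x assms(2) by (auto simp: partition_on_def)
    then have "A \<subseteq> S" using atom_cases[OF assms(1) A(1) assms(3)] x by blast
    then show "x \<in> \<Union>{A \<in> atoms \<B>. A \<subseteq> S}" using A by blast
  qed
qed blast

lemma partition_block_eq: "partition_on \<Omega> \<X> \<Longrightarrow> A \<in> \<X> \<Longrightarrow> B \<in> \<X> \<Longrightarrow> x \<in> A \<Longrightarrow> x \<in> B \<Longrightarrow> A = B"
  unfolding partition_on_def disjoint_def by blast

lemma partition_nonempty: "partition_on \<Omega> \<X> \<Longrightarrow> A \<in> \<X> \<Longrightarrow> A \<noteq> {}"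
  unfolding partition_on_def by blast

lemma algebra_Unions_partition:
  assumes "partition_on \<Omega> \<X>"
  shows "algebra \<Omega> {\<Union>\<S> |\<S>. \<S> \<subseteq> \<X>}"
  unfolding algebra_iff_Un
proof (intro conjI ballI)
  show "{\<Union>\<S> |\<S>. \<S> \<subseteq> \<X>} \<subseteq> Pow \<Omega>" using assms by (auto simp: partition_on_def)
  show "{} \<in> {\<Union>\<S> |\<S>. \<S> \<subseteq> \<X>}" by (auto intro: exI[of _ "{}"])
  show "\<Omega> - a \<in> {\<Union>\<S> |\<S>. \<S> \<subseteq> \<X>}" if "a \<in> {\<Union>\<S> |\<S>. \<S> \<subseteq> \<X>}" for a
  proof -
    from that obtain \<S> where \<S>: "\<S> \<subseteq> \<X>" "a = \<Union>\<S>" by blast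
    have "\<Omega> - a = \<Union>(\<X> - \<S>)"
      using partition_block_eq[OF assms] \<S> assms unfolding partition_on_def by blast
    then show ?thesis by blast
  qed
  show "a \<union> b \<in> {\<Union>\<S> |\<S>. \<S> \<subseteq> \<X>}"
    if "a \<in> {\<Union>\<S> |\<S>. \<S> \<subseteq> \<X>}" "b \<in> {\<Union>\<S> |\<S>. \<S> \<subseteq> \<X>}" for a b
  proof -
    from that obtain \<S> \<S>' where "\<S> \<subseteq> \<X>" "a = \<Union>\<S>" "\<S>' \<subseteq> \<X>" "b = \<Union>\<S>'" by blast
    then have "a \<union> b = \<Union>(\<S> \<union> \<S>')" "\<S> \<union> \<S>' \<subseteq> \<X>" by auto
    then show ?thesis by blast
  qed
qed

text \<open>The meeting point of the implications: each derived set is a union of blocks. Two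
  different blocks may still lie in each other's derived set; antisymmetry is obtained later for the
  atoms of the derived-set algebra.\<close>

definition derived_partition :: "'x topology \<Rightarrow> 'x set set \<Rightarrow> bool" where
  "derived_partition X \<X> \<longleftrightarrow> finite_crowded_partition X \<X> \<and>
     (\<forall>A\<in>\<X>. \<forall>B\<in>\<X>. B \<inter> X derived_set_of A \<noteq> {} \<longrightarrow> B \<subseteq> X derived_set_of A)"

lemma finite_crowded_complete_imp_derived_partition:
  assumes "finite_crowded_complete_partition X \<X>"
  shows "derived_partition X \<X>"
proof -
  from assms obtain P :: "nat set" and r where P: "finite_crowded_partition X \<X>" "r \<subseteq> P \<times> P"
    "complete_partition X P r \<X>"
    unfolding finite_crowded_complete_partition_def PO_system_def by meson
  from P(3) obtain L where L: "partition_on (topspace X) \<X>" "bij_betw L P \<X>"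
    "\<forall>p\<in>P. X derived_set_of (L p) = \<Union> {L q |q. (q, p) \<in> r}"
    unfolding complete_partition_def by meson
  have "B \<subseteq> X derived_set_of A" if AB: "A \<in> \<X>" "B \<in> \<X>" "B \<inter> X derived_set_of A \<noteq> {}" for A B
  proof -
    obtain p where p: "p \<in> P" "A = L p" using L(2) AB(1) by (auto simp: bij_betw_def)
    have L3: "X derived_set_of A = \<Union> {L q |q. (q, p) \<in> r}" using L(3) p by simp
    obtain x where x: "x \<in> B" "x \<in> X derived_set_of A" using AB by blast
    then obtain q where q: "(q, p) \<in> r" "x \<in> L q" unfolding L3 by blast
    have "L q \<in> \<X>" using q P(2) L(2) by (auto simp: bij_betw_def)
    then have "B = L q" using partition_block_eq[OF L(1) AB(2) _ x(1) q(2)] by blast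
    then show ?thesis unfolding L3 using q(1) by blast
  qed
  then show ?thesis using P(1) unfolding derived_partition_def by blast
qed

text \<open>Unions of blocks form a finite algebra closed under derived sets, so it contains the
  generated one. An atom \<open>A\<close> lies in its derived set or is disjoint from it; in the
  second case no block inside \<open>A\<close> is crowded, so \<open>A\<close> is a finite union of
  finite blocks.\<close>

lemma derived_partition_imp_finite_derived_subalgebra:
  assumes t1: "t1_space X" and der: "derived_partition X \<X>" and ref: "refines_family \<X> \<A>"
  shows "finite (derived_subalgebra X \<A>)"
    and "finite_crowded_partition X (atoms (derived_subalgebra X \<A>))"
proof -
  let ?D = "derived_subalgebra X \<A>" and ?U = "{\<Union>\<S> |\<S>. \<S> \<subseteq> \<X>}"
  have part: "partition_on (topspace X) \<X>" and fin: "finite \<X>"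
    and fc: "\<And>A. A \<in> \<X> \<Longrightarrow> finite A \<or> crowded X A"
    using der by (auto simp: derived_partition_def finite_crowded_partition_def)
  have sub: "A \<subseteq> topspace X" if "A \<in> \<X>" for A using part that by (auto simp: partition_on_def)
  have \<A>U: "\<A> \<subseteq> ?U"
  proof
    fix S assume "S \<in> \<A>"
    then obtain \<S> where "\<S> \<subseteq> \<X>" "S = \<Union>\<S>" using ref unfolding refines_family_def by meson
    then show "S \<in> ?U" by blast
  qed
  have algU: "algebra (topspace X) ?U" by (rule algebra_Unions_partition[OF part])
  have \<A>P: "\<A> \<subseteq> Pow (topspace X)" using \<A>U algebra_subset_Pow[OF algU] by (rule subset_trans)
  have alg: "algebra (topspace X) ?D" by (rule derived_subalgebra(1)[OF \<A>P])
  have DU: "?D \<subseteq> ?U"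
  proof (rule derived_subalgebra_minimal[OF \<A>U algU])
    fix S assume "S \<in> ?U"
    then obtain \<S> where \<S>: "\<S> \<subseteq> \<X>" "S = \<Union>\<S>" by blast
    have "X derived_set_of S = (\<Union>A\<in>\<S>. X derived_set_of A)"
      unfolding \<S>(2) using finite_subset[OF \<S>(1) fin] by (rule derived_set_of_Union)
    also have "\<dots> = \<Union>{B \<in> \<X>. \<exists>A\<in>\<S>. B \<subseteq> X derived_set_of A}"
    proof
      show "(\<Union>A\<in>\<S>. X derived_set_of A) \<subseteq> \<Union>{B \<in> \<X>. \<exists>A\<in>\<S>. B \<subseteq> X derived_set_of A}"
      proof
        fix x assume "x \<in> (\<Union>A\<in>\<S>. X derived_set_of A)"
        then obtain A where A: "A \<in> \<S>" "x \<in> X derived_set_of A" by blast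
        then have "x \<in> topspace X" by (simp add: in_derived_set_of)
        then obtain B where B: "B \<in> \<X>" "x \<in> B" using part by (auto simp: partition_on_def)
        then have "B \<subseteq> X derived_set_of A"
          using der A \<S>(1) unfolding derived_partition_def by blast
        then show "x \<in> \<Union>{B \<in> \<X>. \<exists>A\<in>\<S>. B \<subseteq> X derived_set_of A}" using A B by blast
      qed
    qed blast
    finally show "X derived_set_of S \<in> ?U" by blast
  qed
  have "finite ?U" using fin by (simp add: setcompr_eq_image Pow_def[symmetric])
  then show finD: "finite ?D" using DU finite_subset by blast
  have partD: "partition_on (topspace X) (atoms ?D)" by (rule atoms_partition_finite[OF alg finD])
  have "finite A \<or> crowded X A" if A: "A \<in> atoms ?D" for A
  proof -
    have AD: "A \<in> ?D" using A by (simp add: atoms_def)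
    have AX: "A \<subseteq> topspace X" using AD alg by (auto simp: algebra_iff_Un)
    have "X derived_set_of A \<in> ?D" using derived_subalgebra(2)[OF \<A>P AD] .
    from atom_cases[OF alg A this] show ?thesis
    proof
      assume "A \<subseteq> X derived_set_of A"
      then show ?thesis using AX by (simp add: crowded_iff_subset_derived_set_of)
    next
      assume disj: "A \<inter> X derived_set_of A = {}"
      obtain \<S> where \<S>: "\<S> \<subseteq> \<X>" "A = \<Union>\<S>" using AD DU by blast
      have "finite B" if "B \<in> \<S>" for B
      proof -
        have "B \<subseteq> A" using that \<S> by blast
        then have "X derived_set_of B \<subseteq> X derived_set_of A" by (rule derived_set_of_mono)
        then have "B \<inter> X derived_set_of B = {}" using \<open>B \<subseteq> A\<close> disj by blast
        moreover have "B \<noteq> {}" using partition_nonempty[OF part] that \<S> by blast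
        ultimately have "\<not> crowded X B"
          using sub that \<S> by (subst crowded_iff_subset_derived_set_of) blast+
        then show ?thesis using fc that \<S> by blast
      qed
      then show ?thesis using \<S> finite_subset[OF \<S>(1) fin] by blast
    qed
  qed
  moreover have "finite (atoms ?D)" using finD by (simp add: atoms_def)
  ultimately show "finite_crowded_partition X (atoms ?D)"
    using partD by (simp add: finite_crowded_partition_def)
qed

text \<open>Two atoms contained in each other's derived set could not be told apart by the closed sets
  in \<open>\<A>\<close>, hence by no set of the generated algebra.\<close>

lemma derived_subalgebra_atoms_antisym:
  assumes t1: "t1_space X" and cl: "\<And>C. C \<in> \<A> \<Longrightarrow> closedin X C"
    and A: "A \<in> atoms (derived_subalgebra X \<A>)" and B: "B \<in> atoms (derived_subalgebra X \<A>)"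
    and AB: "A \<subseteq> X derived_set_of B" and BA: "B \<subseteq> X derived_set_of A"
  shows "A = B"
proof -
  let ?D = "derived_subalgebra X \<A>"
  have \<A>P: "\<A> \<subseteq> Pow (topspace X)" using cl closedin_subset by blast
  note alg = derived_subalgebra(1)[OF \<A>P]
  define F where "F = {S \<in> ?D. A \<subseteq> S \<longleftrightarrow> B \<subseteq> S}"
  \<comment> \<open>A closed \<open>S\<close> that contains \<open>A\<close> contains the derived
    set of \<open>A\<close> and with it \<open>B\<close>.\<close>
  have closed_F: "S \<in> F" if "S \<in> ?D" "closedin X S" for S
  proof -
    have "B \<subseteq> S" if "A \<subseteq> S" using BA derived_set_of_mono[OF that, of X] \<open>closedin X S\<close>
      by (auto simp: closedin_contains_derived_set)
    moreover have "A \<subseteq> S" if "B \<subseteq> S" using AB derived_set_of_mono[OF that, of X] \<open>closedin X S\<close>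
      by (auto simp: closedin_contains_derived_set)
    ultimately show ?thesis using that by (auto simp: F_def)
  qed
  have ne: "A \<noteq> {}" "B \<noteq> {}" using A B by (auto simp: atoms_def)
  have sub: "A \<subseteq> topspace X" "B \<subseteq> topspace X" using A B alg by (auto simp: atoms_def algebra_iff_Un)
  have "?D \<subseteq> F"
  proof (rule derived_subalgebra_minimal)
    show "\<A> \<subseteq> F" using closed_F cl subset_derived_subalgebra by blast
    show "algebra (topspace X) F"
      unfolding algebra_iff_Un
    proof (intro conjI ballI)
      show "F \<subseteq> Pow (topspace X)" using alg by (auto simp: F_def algebra_iff_Un)
      show "{} \<in> F" using alg ne by (auto simp: F_def algebra_iff_Un)
      show "topspace X - S \<in> F" if "S \<in> F" for S
      proof -
        have S: "S \<in> ?D" "A \<subseteq> S \<longleftrightarrow> B \<subseteq> S" using that by (auto simp: F_def)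
        have "A \<subseteq> S \<longleftrightarrow> \<not> A \<subseteq> topspace X - S" "B \<subseteq> S \<longleftrightarrow> \<not> B \<subseteq> topspace X - S"
          using atom_cases[OF alg A S(1)] atom_cases[OF alg B S(1)] ne sub by blast+
        moreover have "topspace X - S \<in> ?D" using S alg by (auto simp: algebra_iff_Un)
        ultimately show ?thesis using S(2) by (auto simp: F_def)
      qed
      show "S \<union> S' \<in> F" if "S \<in> F" "S' \<in> F" for S S'
      proof -
        have S: "S \<in> ?D" "A \<subseteq> S \<longleftrightarrow> B \<subseteq> S" "S' \<in> ?D" "A \<subseteq> S' \<longleftrightarrow> B \<subseteq> S'"
          using that by (auto simp: F_def)
        have "A \<subseteq> S \<union> S' \<longleftrightarrow> A \<subseteq> S \<or> A \<subseteq> S'" "B \<subseteq> S \<union> S' \<longleftrightarrow> B \<subseteq> S \<or> B \<subseteq> S'"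
          using atom_cases[OF alg A S(1)] atom_cases[OF alg B S(1)] by blast+
        moreover have "S \<union> S' \<in> ?D" using S alg by (auto simp: algebra_iff_Un)
        ultimately show ?thesis using S by (auto simp: F_def)
      qed
    qed
    show "X derived_set_of S \<in> F" if "S \<in> F" for S
      using that closed_F closedin_derived_set_of[OF t1] derived_subalgebra(2)[OF \<A>P]
      by (auto simp: F_def)
  qed
  then have "B \<subseteq> A" using A by (auto simp: F_def atoms_def)
  then show "A = B" using A B by (auto simp: atoms_def)
qed

text \<open>The order is inclusion of one atom in the derived set of the other. It is transitive
  because derived sets are closed.\<close>

lemma derived_subalgebra_atoms_complete:
  assumes t1: "t1_space X" and cl: "\<And>C. C \<in> \<A> \<Longrightarrow> closedin X C"
    and fc: "finite_crowded_partition X (atoms (derived_subalgebra X \<A>))"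
  shows "finite_crowded_complete_partition X (atoms (derived_subalgebra X \<A>))"
proof -
  let ?D = "derived_subalgebra X \<A>"
  have \<A>P: "\<A> \<subseteq> Pow (topspace X)" using cl closedin_subset by blast
  note alg = derived_subalgebra(1)[OF \<A>P]
  have part: "partition_on (topspace X) (atoms ?D)" and "finite (atoms ?D)"
    using fc by (auto simp: finite_crowded_partition_def)
  then obtain L where L: "bij_betw L {0..<card (atoms ?D)} (atoms ?D)"
    using ex_bij_betw_nat_finite by blast
  define P where "P = {0..<card (atoms ?D)}"
  define r where "r = {(q, p) \<in> P \<times> P. L q \<subseteq> X derived_set_of (L p)}"
  have LP: "L p \<in> atoms ?D" if "p \<in> P" for p using L that by (auto simp: P_def bij_betw_def)
  have "PO_system P r"
    unfolding PO_system_def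
  proof (intro conjI)
    show "r \<subseteq> P \<times> P" by (auto simp: r_def)
    show "antisym r"
    proof (rule antisymI)
      fix p q assume "(p, q) \<in> r" "(q, p) \<in> r"
      then have "L p = L q"
        using derived_subalgebra_atoms_antisym[OF t1 cl LP LP] by (auto simp: r_def)
      then show "p = q" using L \<open>(p, q) \<in> r\<close> by (auto simp: r_def P_def bij_betw_def inj_on_def)
    qed
    show "trans r"
    proof (rule transI)
      fix p q s assume pqs: "(p, q) \<in> r" "(q, s) \<in> r"
      then have "L p \<subseteq> X derived_set_of (L q)" "L q \<subseteq> X derived_set_of (L s)" by (auto simp: r_def)
      then have "L p \<subseteq> X derived_set_of (L s)"
        using derived_set_of_mono[of "L q" "X derived_set_of (L s)" X]
          derived_set_of_derived_set_of_subset[OF t1, of "L s"] by blast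
      then show "(p, s) \<in> r" using pqs by (auto simp: r_def)
    qed
  qed
  moreover have "X derived_set_of (L p) = \<Union> {L q |q. (q, p) \<in> r}" if p: "p \<in> P" for p
  proof -
    have "L p \<in> ?D" using LP[OF p] by (simp add: atoms_def)
    note eq = eq_Union_atoms[OF alg part derived_subalgebra(2)[OF \<A>P this]]
    have "{A \<in> atoms ?D. A \<subseteq> X derived_set_of (L p)} = {L q |q. (q, p) \<in> r}"
    proof -
      have "atoms ?D = L ` P" using L by (simp add: P_def bij_betw_def)
      moreover have "(q, p) \<in> r \<longleftrightarrow> q \<in> P \<and> L q \<subseteq> X derived_set_of (L p)" for q
        using p by (simp add: r_def)
      ultimately show ?thesis by (simp only: image_iff Bex_def) blast
    qed
    then have "\<Union>{A \<in> atoms ?D. A \<subseteq> X derived_set_of (L p)} = \<Union>{L q |q. (q, p) \<in> r}"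
      by (rule arg_cong)
    with eq show ?thesis by (rule trans)
  qed
  moreover have "finite P" by (simp add: P_def)
  ultimately show ?thesis
    unfolding finite_crowded_complete_partition_def complete_partition_def
    using fc part L by (intro conjI exI[of _ P] exI[of _ r] exI[of _ L] ballI) (simp_all add: P_def)
qed

lemma atoms_refine_family:
  assumes "\<A> \<subseteq> \<B>" "algebra \<Omega> \<B>" "partition_on \<Omega> (atoms \<B>)"
  shows "refines_family (atoms \<B>) \<A>"
  unfolding refines_family_def
proof
  fix S assume "S \<in> \<A>"
  then have "S = \<Union>{A \<in> atoms \<B>. A \<subseteq> S}" using assms(1) by (intro eq_Union_atoms[OF assms(2,3)]) blast
  moreover have "{A \<in> atoms \<B>. A \<subseteq> S} \<subseteq> atoms \<B>" by blast
  ultimately show "\<exists>\<S>\<subseteq>atoms \<B>. S = \<Union>\<S>" by (intro exI conjI)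
qed

text \<open>The closure of \<open>S\<close> adds its derived set, so the closure algebra lies inside
  the derived-set algebra. A crowded atom contained in \<open>B\<close> consists of limit points of
  \<open>B\<close>; the isolated points of \<open>B\<close> are therefore confined to the finite
  atoms.\<close>

lemma finite_derived_imp_finite_closure_subalgebra:
  assumes cl: "\<And>C. C \<in> \<A> \<Longrightarrow> closedin X C" and fin: "finite (derived_subalgebra X \<A>)"
    and fc: "finite_crowded_partition X (atoms (derived_subalgebra X \<A>))"
  shows "finite (closure_subalgebra X \<A>)"
    and "B \<in> atoms (closure_subalgebra X \<A>) \<Longrightarrow> finite (isolated_points X B)"
proof -
  let ?D = "derived_subalgebra X \<A>" and ?K = "closure_subalgebra X \<A>"
  have \<A>P: "\<A> \<subseteq> Pow (topspace X)" using cl closedin_subset by blast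
  note alg = derived_subalgebra(1)[OF \<A>P]
  have KD: "?K \<subseteq> ?D"
  proof (rule closure_subalgebra_minimal[OF subset_derived_subalgebra alg])
    fix S assume S: "S \<in> ?D"
    then have "X closure_of S = S \<union> X derived_set_of S"
      using alg by (intro closure_of_eq_Un_derived) (auto simp: algebra_iff_Un)
    then show "X closure_of S \<in> ?D"
      using S derived_subalgebra(2)[OF \<A>P S] alg by (auto simp: algebra_iff_Un)
  qed
  then show "finite ?K" using fin finite_subset by blast
  assume B: "B \<in> atoms ?K"
  then have BD: "B \<in> ?D" using KD by (auto simp: atoms_def)
  have BX: "B \<subseteq> topspace X" using BD alg by (auto simp: algebra_iff_Un)
  have "isolated_points X B \<subseteq> \<Union>{A \<in> atoms ?D. finite A}"
  proof
    fix x assume "x \<in> isolated_points X B"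
    then have x: "x \<in> B" "x \<notin> X derived_set_of B" by (auto simp: isolated_points_eq[OF BX])
    then have "x \<in> \<Union>(atoms ?D)"
      using BX fc by (auto simp: finite_crowded_partition_def dest!: partition_onD1)
    then obtain A where A: "A \<in> atoms ?D" "x \<in> A" by blast
    have AB: "A \<subseteq> B" using atom_cases[OF alg A(1) BD] x A by blast
    have "\<not> crowded X A"
      using x(2) A(2) AB derived_set_of_mono[OF AB, of X] BX
      by (subst crowded_iff_subset_derived_set_of) blast+
    then have "finite A" using fc A by (auto simp: finite_crowded_partition_def)
    then show "x \<in> \<Union>{A \<in> atoms ?D. finite A}" using A by blast
  qed
  moreover have "finite (\<Union>{A \<in> atoms ?D. finite A})"
    using fc by (auto simp: finite_crowded_partition_def)
  ultimately show "finite (isolated_points X B)" using finite_subset by blast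
qed

text \<open>Each atom \<open>A\<close> is cut into its isolated points and the rest. The first piece
  is finite and has no limit points, so the second has the same derived set as \<open>A\<close> and
  is crowded.\<close>

lemma finite_closure_subalgebra_imp_derived_partition:
  assumes t1: "t1_space X" and cl: "\<And>C. C \<in> \<A> \<Longrightarrow> closedin X C"
    and fin: "finite (closure_subalgebra X \<A>)"
    and isol: "\<And>B. B \<in> atoms (closure_subalgebra X \<A>) \<Longrightarrow> finite (isolated_points X B)"
  obtains \<X> where "derived_partition X \<X>" "refines_family \<X> \<A>"
proof -
  let ?K = "closure_subalgebra X \<A>"
  let ?d = "\<lambda>A. X derived_set_of A"
  have \<A>P: "\<A> \<subseteq> Pow (topspace X)" using cl closedin_subset by blast
  note alg = closure_subalgebra(1)[OF \<A>P]
  have part: "partition_on (topspace X) (atoms ?K)" by (rule atoms_partition_finite[OF alg fin])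
  have sub: "A \<subseteq> topspace X" if "A \<in> atoms ?K" for A using part that by (auto simp: partition_on_def)
  define \<X> where "\<X> = (\<Union>A\<in>atoms ?K. {A - ?d A, A \<inter> ?d A}) - {{}}"
  have der1: "?d (A - ?d A) = {}" and der2: "?d (A \<inter> ?d A) = ?d A" if A: "A \<in> atoms ?K" for A
  proof -
    have "finite (A - ?d A)" using isol[OF A] by (simp add: isolated_points_eq[OF sub[OF A]])
    then show *: "?d (A - ?d A) = {}" using t1 by (simp add: t1_space_derived_set_of_finite)
    have "?d ((A - ?d A) \<union> (A \<inter> ?d A)) = ?d (A - ?d A) \<union> ?d (A \<inter> ?d A)" by (rule derived_set_of_Un)
    moreover have "(A - ?d A) \<union> (A \<inter> ?d A) = A" by blast
    ultimately show "?d (A \<inter> ?d A) = ?d A" using * by simp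
  qed
  have block: "B \<subseteq> ?d A" if A: "A \<in> atoms ?K" and B: "B \<in> \<X>" "B \<inter> ?d A \<noteq> {}" for A B
  proof -
    obtain D where D: "D \<in> atoms ?K" "B = D - ?d D \<or> B = D \<inter> ?d D" using B(1) by (auto simp: \<X>_def)
    show ?thesis
    proof (cases "D = A")
      case True
      then show ?thesis using D B by blast
    next
      case False
      then have disj: "D \<inter> A = {}" using partition_block_eq[OF part D(1) A] by blast
      \<comment> \<open>The closure of \<open>A\<close> belongs to the algebra, so the atom
        \<open>D\<close> that meets it is contained in it; being disjoint from \<open>A\<close>, it
        lies in the derived set.\<close>
      have "X closure_of A \<in> ?K" using A closure_subalgebra(2)[OF \<A>P] by (simp add: atoms_def)
      then have "A \<union> ?d A \<in> ?K" using closure_of_eq_Un_derived[OF sub[OF A]] by simp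
      from atom_cases[OF alg D(1) this] have "D \<subseteq> ?d A" using D B disj by blast
      then show ?thesis using D by blast
    qed
  qed
  have partX: "partition_on (topspace X) \<X>"
  proof (rule partition_onI)
    have "\<Union>\<X> = \<Union>(atoms ?K)" unfolding \<X>_def by blast
    then show "\<Union>\<X> = topspace X" using part by (simp add: partition_on_def)
    show "{} \<notin> \<X>" by (simp add: \<X>_def)
    show "disjnt B B'" if BB: "B \<in> \<X>" "B' \<in> \<X>" "B \<noteq> B'" for B B'
    proof -
      obtain D D' where D: "D \<in> atoms ?K" "B = D - ?d D \<or> B = D \<inter> ?d D"
        "D' \<in> atoms ?K" "B' = D' - ?d D' \<or> B' = D' \<inter> ?d D'" using BB(1,2) by (auto simp: \<X>_def)
      have "D = D' \<or> D \<inter> D' = {}" using partition_block_eq[OF part D(1,3)] by blast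
      then show ?thesis using D(2,4) BB(3) unfolding disjnt_def by blast
    qed
  qed
  have finX: "finite \<X>" unfolding \<X>_def using fin by (auto simp: atoms_def)
  have fc: "finite B \<or> crowded X B" if "B \<in> \<X>" for B
  proof -
    obtain D where D: "D \<in> atoms ?K" "B = D - ?d D \<or> B = D \<inter> ?d D" using \<open>B \<in> \<X>\<close> by (auto simp: \<X>_def)
    from D(2) show ?thesis
    proof
      assume "B = D - ?d D"
      then show ?thesis using isol[OF D(1)] by (simp add: isolated_points_eq[OF sub[OF D(1)]])
    next
      assume B: "B = D \<inter> ?d D"
      then have "B \<subseteq> ?d B" using der2[OF D(1)] by auto
      then show ?thesis using sub[OF D(1)] B by (subst crowded_iff_subset_derived_set_of) auto
    qed
  qed
  have "B \<subseteq> ?d A" if AB: "A \<in> \<X>" "B \<in> \<X>" "B \<inter> ?d A \<noteq> {}" for A B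
  proof -
    obtain D where D: "D \<in> atoms ?K" "A = D - ?d D \<or> A = D \<inter> ?d D" using AB(1) by (auto simp: \<X>_def)
    then have "?d A = ?d D" using der1[OF D(1)] der2[OF D(1)] AB(3) by auto
    then show ?thesis using block[OF D(1) AB(2)] AB(3) by simp
  qed
  then have "derived_partition X \<X>"
    using partX finX fc by (simp add: derived_partition_def finite_crowded_partition_def)
  moreover have "refines_family \<X> \<A>"
    unfolding refines_family_def
  proof
    fix S assume "S \<in> \<A>"
    then have "S \<in> ?K" using subset_closure_subalgebra by blast
    then have "S = \<Union>{A \<in> atoms ?K. A \<subseteq> S}" by (rule eq_Union_atoms[OF alg part])
    also have "\<dots> = \<Union>{B \<in> \<X>. \<exists>A\<in>atoms ?K. A \<subseteq> S \<and> B \<subseteq> A}" unfolding \<X>_def by blast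
    finally show "\<exists>\<S>\<subseteq>\<X>. S = \<Union>\<S>" by (intro exI[of _ "{B \<in> \<X>. \<exists>A\<in>atoms ?K. A \<subseteq> S \<and> B \<subseteq> A}"]) blast
  qed
  ultimately show thesis using that by blast
qed

section \<open>Boolean rings of compact open sets\<close>

lemma compact_opens_Un: "U \<in> compact_opens X \<Longrightarrow> V \<in> compact_opens X \<Longrightarrow> U \<union> V \<in> compact_opens X"
  by (simp add: compact_opens_def compactin_Un openin_Un)

lemma compact_opens_Union:
  "finite \<U> \<Longrightarrow> \<U> \<subseteq> compact_opens X \<Longrightarrow> \<Union>\<U> \<in> compact_opens X"
  by (induction \<U> rule: finite_induct) (auto simp: compact_opens_Un, simp add: compact_opens_def)

lemma compact_opens_subset: "U \<in> compact_opens X \<Longrightarrow> U \<subseteq> topspace X"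
  by (auto simp: compact_opens_def openin_subset)

locale stone_representation =
  fixes X :: "'x topology" and \<phi> :: "'r::ring \<Rightarrow> 'x set"
  assumes stone: "stone_space X \<phi>"
begin

lemma Hausdorff: "Hausdorff_space X"
  using stone by (simp add: stone_space_def)

lemma t1: "t1_space X"
  using Hausdorff by (rule Hausdorff_imp_t1_space)

lemma compact_open_closedin: "U \<in> compact_opens X \<Longrightarrow> closedin X U"
  using Hausdorff by (auto simp: compact_opens_def intro: compactin_imp_closedin)

lemma compact_opens_Int_closed:
  assumes "U \<in> compact_opens X" "openin X S" "closedin X S"
  shows "U \<inter> S \<in> compact_opens X"
  using assms by (auto simp: compact_opens_def intro: compact_Int_closedin)

text \<open>Total disconnectedness makes the component of \<open>x\<close> the compact set
  \<open>{x}\<close>, and in a locally compact Hausdorff space a compact component has arbitrarily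
  small clopen neighbourhoods. One inside \<open>V\<close>, which lies in a compact set, is itself
  compact.\<close>

lemma compact_open_neighbourhood:
  assumes W: "openin X W" and x: "x \<in> W"
  obtains U where "U \<in> compact_opens X" "x \<in> U" "U \<subseteq> W"
proof -
  have xX: "x \<in> topspace X" using W x openin_subset by blast
  have lc: "locally_compact_space X" and td: "totally_disconnected_space X"
    using stone by (auto simp: stone_space_def)
  obtain V K where V: "openin X V" "compactin X K" "x \<in> V" "V \<subseteq> K"
    using lc xX unfolding locally_compact_space_def by blast
  let ?C = "connected_component_of_set X x"
  obtain a where "?C \<subseteq> {a}"
    using td connectedin_connected_component_of unfolding totally_disconnected_space_def by metis
  moreover have "x \<in> ?C" using xX by (simp add: connected_component_of_refl)
  ultimately have "?C = {x}" by blast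
  then have "{x} \<in> connected_components_of X"
    using xX unfolding connected_components_of_def by (metis imageI)
  moreover have "compactin X {x}" using xX by simp
  moreover have "openin X (W \<inter> V)" using W V by blast
  ultimately obtain U U' where U: "openin X U" "openin X U'" "disjnt U U'" "U \<union> U' = topspace X"
    "{x} \<subseteq> U" "U \<subseteq> W \<inter> V"
    using x V wilder_locally_compact_component_thm[OF lc Hausdorff, of "{x}" "W \<inter> V"] by blast
  have "U = topspace X - U'" using U by (auto simp: disjnt_def)
  then have "closedin X U" using U(2) by auto
  then have "compactin X U" using closed_compactin[OF V(2)] U(6) V(4) by blast
  then show thesis using that[of U] U by (auto simp: compact_opens_def)
qed

lemma compact_open_between:
  assumes K: "compactin X K" and W: "openin X W" "K \<subseteq> W"
  obtains U where "U \<in> compact_opens X" "K \<subseteq> U" "U \<subseteq> W"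
proof -
  let ?\<U> = "{U \<in> compact_opens X. U \<subseteq> W}"
  have "K \<subseteq> \<Union>?\<U>"
  proof
    fix x assume "x \<in> K"
    then obtain U where "U \<in> compact_opens X" "x \<in> U" "U \<subseteq> W"
      using compact_open_neighbourhood[OF W(1)] W(2) by blast
    then show "x \<in> \<Union>?\<U>" by blast
  qed
  moreover have "\<forall>U\<in>?\<U>. openin X U" by (auto simp: compact_opens_def)
  ultimately obtain \<F> where "finite \<F>" "\<F> \<subseteq> ?\<U>" "K \<subseteq> \<Union>\<F>"
    using K unfolding compactin_def by meson
  then show thesis using compact_opens_Union[of \<F> X] that[of "\<Union>\<F>"] by blast
qed

lemma rep_compact_open: "\<phi> a \<in> compact_opens X"
  using stone by (auto simp: stone_space_def bij_betw_def)

lemma ex_rep: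
  assumes "U \<in> compact_opens X"
  shows "\<exists>a. \<phi> a = U"
proof -
  have "range \<phi> = compact_opens X" using stone by (simp add: stone_space_def bij_betw_def)
  then show ?thesis using assms by (metis imageE)
qed

lemma rep_eq_iff: "\<phi> a = \<phi> b \<longleftrightarrow> a = b"
  using stone by (auto simp: stone_space_def bij_betw_def inj_on_def)

lemma rep_add: "\<phi> (a + b) = (\<phi> a - \<phi> b) \<union> (\<phi> b - \<phi> a)"
  using stone by (simp add: stone_space_def)

lemma rep_mult: "\<phi> (a * b) = \<phi> a \<inter> \<phi> b"
  using stone by (simp add: stone_space_def)

lemma rep_zero: "\<phi> 0 = {}"
  using rep_add[of 0 0] by simp

lemma rep_subset: "\<phi> a \<subseteq> topspace X"
  using compact_opens_subset[OF rep_compact_open] .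

end

text \<open>Each entry is tagged by its block, so the set is the graph of a function on \<X>. The
  count is set to \<open>0\<close> for infinite blocks, which keeps the range of values finite.
  Compactness is tested on the closure of \<open>A\<close>, since \<open>S \<inter> A\<close> itself
  need not be closed.\<close>

definition clopen_inv :: "'x topology \<Rightarrow> 'x set set \<Rightarrow> 'x set \<Rightarrow> ('x set \<times> nat \<times> bool \<times> bool) set" where
  "clopen_inv X \<X> S = (\<lambda>A. (A, if finite A then card (S \<inter> A) else 0, S \<inter> A = {},
     compactin X (S \<inter> X closure_of A))) ` \<X>"

lemma clopen_inv_eq_iff:
  "clopen_inv X \<X> S = clopen_inv X \<X> T \<longleftrightarrow>
     (\<forall>A\<in>\<X>. (finite A \<longrightarrow> card (S \<inter> A) = card (T \<inter> A)) \<and> (S \<inter> A = {} \<longleftrightarrow> T \<inter> A = {}) \<and>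
       (compactin X (S \<inter> X closure_of A) \<longleftrightarrow> compactin X (T \<inter> X closure_of A)))"
    (is "?L \<longleftrightarrow> ?R")
proof
  assume L: ?L
  show ?R
  proof
    fix A assume "A \<in> \<X>"
    then have "(A, if finite A then card (S \<inter> A) else 0, S \<inter> A = {},
        compactin X (S \<inter> X closure_of A)) \<in> clopen_inv X \<X> T"
      unfolding L[symmetric] by (simp add: clopen_inv_def)
    then show "(finite A \<longrightarrow> card (S \<inter> A) = card (T \<inter> A)) \<and> (S \<inter> A = {} \<longleftrightarrow> T \<inter> A = {}) \<and>
       (compactin X (S \<inter> X closure_of A) \<longleftrightarrow> compactin X (T \<inter> X closure_of A))"
      unfolding clopen_inv_def by (auto split: if_splits)
  qed
next
  assume ?R
  then show ?L unfolding clopen_inv_def by (intro image_cong) auto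
qed

lemma clopen_inv_subset:
  "clopen_inv X \<X> S \<subseteq> (SIGMA A:\<X>. {..card A} \<times> UNIV)"
  by (auto simp: clopen_inv_def intro: card_mono)

text \<open>Used to pass from finer to coarser cells. Closedness of the pieces matters for the
  compactness entry: closed parts of a compact union are compact.\<close>

lemma clopen_inv_Un:
  assumes clopen: "closedin X S" "closedin X S'" "closedin X T" "closedin X T'"
    and disj: "S \<inter> S' = {}" "T \<inter> T' = {}"
    and eq: "clopen_inv X \<X> S = clopen_inv X \<X> T" "clopen_inv X \<X> S' = clopen_inv X \<X> T'"
  shows "clopen_inv X \<X> (S \<union> S') = clopen_inv X \<X> (T \<union> T')"
  unfolding clopen_inv_eq_iff
proof (intro ballI conjI impI)
  fix A assume A: "A \<in> \<X>"
  have e: "finite A \<Longrightarrow> card (S \<inter> A) = card (T \<inter> A)" "finite A \<Longrightarrow> card (S' \<inter> A) = card (T' \<inter> A)"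
    "S \<inter> A = {} \<longleftrightarrow> T \<inter> A = {}" "S' \<inter> A = {} \<longleftrightarrow> T' \<inter> A = {}"
    "compactin X (S \<inter> X closure_of A) \<longleftrightarrow> compactin X (T \<inter> X closure_of A)"
    "compactin X (S' \<inter> X closure_of A) \<longleftrightarrow> compactin X (T' \<inter> X closure_of A)"
    using eq[unfolded clopen_inv_eq_iff] A by simp_all
  show "(S \<union> S') \<inter> A = {} \<longleftrightarrow> (T \<union> T') \<inter> A = {}" using e by blast
  show "card ((S \<union> S') \<inter> A) = card ((T \<union> T') \<inter> A)" if "finite A"
  proof -
    have "card ((S \<union> S') \<inter> A) = card (S \<inter> A) + card (S' \<inter> A)"
      using that disj unfolding Int_Un_distrib2 by (intro card_Un_disjoint) auto
    moreover have "card ((T \<union> T') \<inter> A) = card (T \<inter> A) + card (T' \<inter> A)"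
      using that disj unfolding Int_Un_distrib2 by (intro card_Un_disjoint) auto
    ultimately show ?thesis using e that by simp
  qed
  have *: "compactin X ((Z \<union> Z') \<inter> X closure_of A) \<longleftrightarrow>
      compactin X (Z \<inter> X closure_of A) \<and> compactin X (Z' \<inter> X closure_of A)"
    if "closedin X Z" "closedin X Z'" for Z Z'
  proof
    assume c: "compactin X ((Z \<union> Z') \<inter> X closure_of A)"
    have "closedin X (Z \<inter> X closure_of A)" "closedin X (Z' \<inter> X closure_of A)" using that by auto
    then show "compactin X (Z \<inter> X closure_of A) \<and> compactin X (Z' \<inter> X closure_of A)"
      by (intro conjI closed_compactin[OF c]) auto
  next
    assume "compactin X (Z \<inter> X closure_of A) \<and> compactin X (Z' \<inter> X closure_of A)"
    then show "compactin X ((Z \<union> Z') \<inter> X closure_of A)"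
      unfolding Int_Un_distrib2 by (simp add: compactin_Un)
  qed
  show "compactin X ((S \<union> S') \<inter> X closure_of A) \<longleftrightarrow> compactin X ((T \<union> T') \<inter> X closure_of A)"
    unfolding *[OF clopen(1,2)] *[OF clopen(3,4)] using e(5,6) by blast
qed

text \<open>In a compact open splitting \<open>T = V \<union> (T - V)\<close> that mirrors \<open>S = U \<union> (S - U)\<close>, the points of
  \<open>F\<close> are to lie inside \<open>V\<close> and those of \<open>G\<close> outside.\<close>

lemma (in stone_representation) split_points:
  assumes der: "derived_partition X \<X>" and A: "A \<in> \<X>" and T: "openin X T"
    and eq: "clopen_inv X \<X> S = clopen_inv X \<X> T" and US: "U \<subseteq> S"
  shows "\<exists>F G. finite F \<and> finite G \<and> F \<inter> G = {} \<and> F \<subseteq> T \<inter> A \<and> G \<subseteq> T \<inter> A \<and>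
    (F = {} \<longleftrightarrow> U \<inter> A = {}) \<and> (G = {} \<longleftrightarrow> (S - U) \<inter> A = {}) \<and>
    (finite A \<longrightarrow> F \<union> G = T \<inter> A \<and> card F = card (U \<inter> A))"
proof -
  have e: "finite A \<Longrightarrow> card (S \<inter> A) = card (T \<inter> A)" "S \<inter> A = {} \<longleftrightarrow> T \<inter> A = {}"
    using eq A unfolding clopen_inv_eq_iff by blast+
  show ?thesis
  proof (cases "finite A")
    case True
    have "card (U \<inter> A) \<le> card (T \<inter> A)"
      unfolding e(1)[OF True, symmetric] using True US by (intro card_mono) auto
    then obtain F where F: "F \<subseteq> T \<inter> A" "card F = card (U \<inter> A)" "finite F"
      by (rule obtain_subset_with_card_n)
    define G where "G = T \<inter> A - F"
    have "card G = card (T \<inter> A) - card (U \<inter> A)"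
      unfolding G_def F(2)[symmetric] using F by (simp add: card_Diff_subset)
    also have "\<dots> = card (S \<inter> A - U \<inter> A)"
      unfolding e(1)[OF True, symmetric] using True US by (subst card_Diff_subset) auto
    also have "S \<inter> A - U \<inter> A = (S - U) \<inter> A" by blast
    finally have "card G = card ((S - U) \<inter> A)" .
    then have "G = {} \<longleftrightarrow> (S - U) \<inter> A = {}"
      using True unfolding G_def by (metis card_eq_0_iff finite_Diff finite_Int)
    moreover have "F = {} \<longleftrightarrow> U \<inter> A = {}" using F True by (metis card_eq_0_iff finite_Int)
    moreover have "finite G" "F \<inter> G = {}" "G \<subseteq> T \<inter> A" "F \<union> G = T \<inter> A"
      using F True by (auto simp: G_def)
    ultimately show ?thesis using F by (intro exI[of _ F] exI[of _ G] conjI impI)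
  next
    case False
    have part: "partition_on (topspace X) \<X>" and cr: "crowded X A"
      using der A False by (auto simp: derived_partition_def finite_crowded_partition_def)
    have AX: "A \<subseteq> topspace X" using part A by (auto simp: partition_on_def)
    show ?thesis
    proof (cases "T \<inter> A = {}")
      case True
      then have "U \<inter> A = {}" "(S - U) \<inter> A = {}" using e(2) US by blast+
      then show ?thesis using False by (intro exI[of _ "{}"]) auto
    next
      case nonempty: False
      then obtain x where x: "x \<in> T" "x \<in> A" by blast
      \<comment> \<open>In a crowded block the open set \<open>T\<close> contains, besides
        \<open>x\<close>, a second point \<open>y\<close> of \<open>A\<close>, so one can be placed
        inside \<open>V\<close> and the other outside.\<close>
      then have "x \<in> X derived_set_of A" using cr AX by (auto simp: crowded_iff_subset_derived_set_of)
      then obtain y where y: "y \<noteq> x" "y \<in> A" "y \<in> T" using T x unfolding in_derived_set_of by blast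
      define F where "F = (if U \<inter> A = {} then {} else {x})"
      define G where "G = (if (S - U) \<inter> A = {} then {} else {y})"
      show ?thesis
        using x y False by (intro exI[of _ F] exI[of _ G]) (auto simp: F_def G_def)
    qed
  qed
qed

text \<open>\<open>V\<close> has to contain the compact set \<open>K\<close>: the chosen points
  \<open>F A\<close>, and all of \<open>T\<close> in the closures of the blocks that
  \<open>S - U\<close> misses (\<open>Q\<close>). It has to avoid the finite set \<open>L\<close> of
  the points \<open>G A\<close>. Each \<open>x \<in> K\<close> gets a compact open neighbourhood
  that meets only blocks with \<open>x\<close> in their closure, and finitely many of these form
  \<open>V\<close>. Hence \<open>V\<close> meets no block that \<open>U\<close> misses: the block of
  \<open>x\<close> would lie in the closure of such a block, although \<open>U\<close> meets the
  block of \<open>x\<close>.\<close>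

lemma (in stone_representation) clopen_inv_extension:
  assumes der: "derived_partition X \<X>"
    and S: "openin X S" "closedin X S" and T: "openin X T" "closedin X T"
    and eq: "clopen_inv X \<X> S = clopen_inv X \<X> T" and U: "U \<in> compact_opens X" "U \<subseteq> S"
  shows "\<exists>V. V \<in> compact_opens X \<and> V \<subseteq> T \<and> clopen_inv X \<X> U = clopen_inv X \<X> V \<and>
    clopen_inv X \<X> (S - U) = clopen_inv X \<X> (T - V)"
proof -
  have part: "partition_on (topspace X) \<X>" and finX: "finite \<X>"
    and block: "\<And>A B. A \<in> \<X> \<Longrightarrow> B \<in> \<X> \<Longrightarrow> B \<inter> X derived_set_of A \<noteq> {} \<Longrightarrow> B \<subseteq> X derived_set_of A"
    using der by (auto simp: derived_partition_def finite_crowded_partition_def)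
  have sub: "A \<subseteq> topspace X" if "A \<in> \<X>" for A using part that by (auto simp: partition_on_def)
  have cl: "X closure_of A = A \<union> X derived_set_of A" if "A \<in> \<X>" for A
    by (rule closure_of_eq_Un_derived[OF sub[OF that]])
  have e: "S \<inter> A = {} \<longleftrightarrow> T \<inter> A = {}"
    "compactin X (S \<inter> X closure_of A) \<longleftrightarrow> compactin X (T \<inter> X closure_of A)" if "A \<in> \<X>" for A
    using eq that unfolding clopen_inv_eq_iff by blast+
  have Uo: "openin X U" and Uc: "closedin X U" and Uk: "compactin X U"
    using U compact_open_closedin by (auto simp: compact_opens_def)
  have SUo: "openin X (S - U)" using S Uc by blast
  have meets: "W \<inter> A \<noteq> {}" if "openin X W" "W \<inter> B \<noteq> {}" "B \<subseteq> X closure_of A" "A \<in> \<X>" for W A B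
    using that openin_Int_closure_of_eq_empty[OF that(1), of A] by blast
  obtain F G where FG: "\<And>A. A \<in> \<X> \<Longrightarrow> finite (F A) \<and> finite (G A) \<and> F A \<inter> G A = {} \<and>
      F A \<subseteq> T \<inter> A \<and> G A \<subseteq> T \<inter> A \<and> (F A = {} \<longleftrightarrow> U \<inter> A = {}) \<and> (G A = {} \<longleftrightarrow> (S - U) \<inter> A = {}) \<and>
      (finite A \<longrightarrow> F A \<union> G A = T \<inter> A \<and> card (F A) = card (U \<inter> A))"
    using split_points[OF der _ T(1) eq U(2)] by metis
  have FT: "F A \<subseteq> T \<inter> A" and GT: "G A \<subseteq> T \<inter> A" if "A \<in> \<X>" for A
    using FG[OF that] by simp_all
  define Q where "Q = {A \<in> \<X>. (S - U) \<inter> A = {}}"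
  define Z where "Z = (\<Union>A\<in>Q. T \<inter> X closure_of A)"
  define K where "K = Z \<union> (\<Union>A\<in>\<X>. F A)"
  define L where "L = (\<Union>A\<in>\<X>. G A)"
  \<comment> \<open>\<open>Q\<close> is closed downwards: the open set \<open>S - U\<close> would
    meet \<open>A\<close> if it met a block in the closure of \<open>A\<close>.\<close>
  have cl_Q: "B \<in> Q" if "A \<in> Q" "B \<in> \<X>" "B \<inter> X closure_of A \<noteq> {}" for A B
  proof (rule ccontr)
    assume "B \<notin> Q"
    then have B: "(S - U) \<inter> B \<noteq> {}" "B \<noteq> A" using that by (auto simp: Q_def)
    have A: "A \<in> \<X>" "(S - U) \<inter> A = {}" using that(1) by (auto simp: Q_def)
    have "B \<inter> A = {}" using partition_block_eq[OF part that(2) A(1)] B(2) by blast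
    then have "B \<subseteq> X derived_set_of A" using block[OF A(1) that(2)] that(3) cl[OF A(1)] by blast
    then have "B \<subseteq> X closure_of A" using cl[OF A(1)] by blast
    from meets[OF SUo B(1) this A(1)] show False using A(2) by blast
  qed
  \<comment> \<open>For a block in \<open>Q\<close> the set \<open>S \<inter> X closure_of A\<close>
    lies in the compact \<open>U\<close> and is therefore compact; the invariant carries this over
    to \<open>T\<close>.\<close>
  have compact_Q: "compactin X (T \<inter> X closure_of A)" if "A \<in> Q" for A
  proof -
    have A: "A \<in> \<X>" "(S - U) \<inter> A = {}" using that by (auto simp: Q_def)
    have "(S - U) \<inter> X closure_of A = {}" using A(2) openin_Int_closure_of_eq_empty[OF SUo, of A] by blast
    then have "S \<inter> X closure_of A = U \<inter> X closure_of A" using U(2) by blast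
    moreover have "compactin X (U \<inter> X closure_of A)" by (rule compact_Int_closedin[OF Uk]) simp
    ultimately show ?thesis using e(2)[OF A(1)] by simp
  qed
  have KT: "K \<subseteq> T" unfolding K_def Z_def using FT by blast
  have TX: "T \<subseteq> topspace X" using T(1) openin_subset by blast
  have finF: "finite (\<Union>A\<in>\<X>. F A)" and finL: "finite L"
    unfolding L_def using finX FG by blast+
  have "compactin X K"
    unfolding K_def Z_def
  proof (rule compactin_Un)
    have "finite ((\<lambda>A. T \<inter> X closure_of A) ` Q)" using finX by (simp add: Q_def)
    then show "compactin X (\<Union>A\<in>Q. T \<inter> X closure_of A)"
      by (rule compactin_Union) (use compact_Q in auto)
    have "(\<Union>A\<in>\<X>. F A) \<subseteq> topspace X" using FT TX by blast
    then show "compactin X (\<Union>A\<in>\<X>. F A)" using finF by (simp add: finite_imp_compactin)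
  qed
  have FL: "x \<notin> L" if x: "x \<in> F A" "A \<in> \<X>" for x A
  proof
    assume "x \<in> L"
    then obtain B where B: "B \<in> \<X>" "x \<in> G B" unfolding L_def by blast
    have "A = B" using partition_block_eq[OF part x(2) B(1)] FT[OF x(2)] GT[OF B(1)] x(1) B(2) by blast
    moreover have "F B \<inter> G B = {}" using FG[OF B(1)] by simp
    ultimately show False using x(1) B(2) by blast
  qed
  have ZL: "x \<notin> L" if x: "x \<in> Z" for x
  proof
    assume "x \<in> L"
    then obtain B where B: "B \<in> \<X>" "x \<in> G B" unfolding L_def by blast
    obtain A where A: "A \<in> Q" "x \<in> X closure_of A" using x unfolding Z_def by blast
    have "x \<in> B" using GT[OF B(1)] B(2) by blast
    then have "B \<in> Q" using cl_Q[OF A(1) B(1)] A(2) by blast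
    then have "(S - U) \<inter> B = {}" by (simp add: Q_def)
    then have "G B = {}" using FG[OF B(1)] by simp
    then show False using B(2) by blast
  qed
  define N where "N x W \<longleftrightarrow> W \<in> compact_opens X \<and> x \<in> W \<and> W \<subseteq> T - L \<and>
    (\<forall>B\<in>\<X>. W \<inter> B \<noteq> {} \<longrightarrow> x \<in> X closure_of B)" for x W
  have ex_N: "\<exists>W. N x W" if x: "x \<in> K" for x
  proof -
    let ?C = "L \<union> \<Union>{X closure_of B |B. B \<in> \<X> \<and> x \<notin> X closure_of B}"
    have "closedin X ?C"
    proof (rule closedin_Un)
      have "L \<subseteq> topspace X" unfolding L_def using GT TX by blast
      then show "closedin X L" using t1 finL by (simp add: t1_space_closedin_finite)
      have "finite {X closure_of B |B. B \<in> \<X> \<and> x \<notin> X closure_of B}" using finX by auto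
      then show "closedin X (\<Union>{X closure_of B |B. B \<in> \<X> \<and> x \<notin> X closure_of B})"
        by (rule closedin_Union) auto
    qed
    then have op: "openin X (T - ?C)" using T(1) by blast
    have "x \<in> T - ?C" using x KT FL ZL unfolding K_def by blast
    from compact_open_neighbourhood[OF op this]
    obtain W where W: "W \<in> compact_opens X" "x \<in> W" "W \<subseteq> T - ?C" by blast
    have "x \<in> X closure_of B" if "B \<in> \<X>" "W \<inter> B \<noteq> {}" for B
    proof (rule ccontr)
      assume "x \<notin> X closure_of B"
      then have "X closure_of B \<subseteq> ?C" using that(1) by blast
      moreover have "B \<subseteq> X closure_of B" using cl[OF that(1)] by blast
      ultimately show False using W(3) that(2) by blast
    qed
    then show ?thesis using W unfolding N_def by blast
  qed
  have "\<forall>W\<in>{W. \<exists>x\<in>K. N x W}. openin X W" by (auto simp: N_def compact_opens_def)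
  moreover have "K \<subseteq> \<Union>{W. \<exists>x\<in>K. N x W}" using ex_N by (fastforce simp: N_def)
  ultimately obtain \<F> where \<F>: "finite \<F>" "\<F> \<subseteq> {W. \<exists>x\<in>K. N x W}" "K \<subseteq> \<Union>\<F>"
    using \<open>compactin X K\<close> unfolding compactin_def by meson
  define V where "V = \<Union>\<F>"
  have V: "V \<in> compact_opens X"
    unfolding V_def using \<F>(1,2) by (intro compact_opens_Union) (auto simp: N_def)
  have VT: "V \<subseteq> T - L" using \<F>(2) by (auto simp: V_def N_def)
  have KV: "K \<subseteq> V" using \<F>(3) by (simp add: V_def)
  have V_emp: "V \<inter> A = {} \<longleftrightarrow> U \<inter> A = {}" if A: "A \<in> \<X>" for A
  proof
    assume "V \<inter> A = {}"
    moreover have "F A \<subseteq> V" using KV A unfolding K_def by blast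
    ultimately have "F A = {}" using FT[OF A] by blast
    then show "U \<inter> A = {}" using FG[OF A] by simp
  next
    assume UA: "U \<inter> A = {}"
    show "V \<inter> A = {}"
    proof (rule ccontr)
      assume "V \<inter> A \<noteq> {}"
      then obtain x W where x: "x \<in> K" "N x W" "W \<inter> A \<noteq> {}" using \<F>(2) unfolding V_def by blast
      then have xA: "x \<in> X closure_of A" using A unfolding N_def by blast
      have "x \<in> topspace X" using x(1) KT TX by blast
      then obtain B where B: "B \<in> \<X>" "x \<in> B" using part by (auto dest!: partition_onD1)
      have "B \<subseteq> X closure_of A"
      proof (cases "x \<in> A")
        case True
        then show ?thesis using partition_block_eq[OF part B(1) A B(2)] cl[OF A] by blast
      next
        case False
        then have "B \<subseteq> X derived_set_of A" using xA cl[OF A] block[OF A B(1)] B(2) by blast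
        then show ?thesis using cl[OF A] by blast
      qed
      then have "U \<inter> B = {}" using meets[OF Uo _ _ A] UA by blast
      \<comment> \<open>If \<open>x\<close> comes from \<open>Z\<close>, then \<open>S - U\<close>
        misses \<open>B\<close> while \<open>S\<close> meets it; if \<open>x\<close> comes from some
        \<open>F D\<close>, then \<open>D = B\<close> and the nonempty \<open>F D\<close> records
        that \<open>U\<close> meets \<open>B\<close>.\<close>
      moreover have "U \<inter> B \<noteq> {}"
      proof (cases "x \<in> Z")
        case True
        then obtain D where D: "D \<in> Q" "x \<in> T" "x \<in> X closure_of D" unfolding Z_def by blast
        have "B \<in> Q" using cl_Q[OF D(1) B(1)] B(2) D(3) by blast
        then have "(S - U) \<inter> B = {}" by (simp add: Q_def)
        moreover have "S \<inter> B \<noteq> {}" using e(1)[OF B(1)] B(2) D(2) by blast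
        ultimately show ?thesis by blast
      next
        case False
        then obtain D where D: "D \<in> \<X>" "x \<in> F D" using x(1) unfolding K_def by blast
        have "D = B" using partition_block_eq[OF part D(1) B(1) _ B(2)] FT[OF D(1)] D(2) by blast
        moreover have "F D \<noteq> {}" using D(2) by blast
        ultimately show ?thesis using FG[OF D(1)] by simp
      qed
      ultimately show False by blast
    qed
  qed
  have V_fin: "V \<inter> A = F A" if A: "A \<in> \<X>" "finite A" for A
  proof
    have "F A \<union> G A = T \<inter> A" using FG[OF A(1)] A(2) by simp
    moreover have "G A \<subseteq> L" using A unfolding L_def by blast
    ultimately show "V \<inter> A \<subseteq> F A" using VT by blast
    have "F A \<subseteq> V" using KV A unfolding K_def by blast
    then show "F A \<subseteq> V \<inter> A" using FT[OF A(1)] by blast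
  qed
  have Vk: "compactin X V" using V by (simp add: compact_opens_def)
  have Int_cl: "compactin X (U \<inter> X closure_of A)" "compactin X (V \<inter> X closure_of A)" for A
    by (rule compact_Int_closedin[OF Uk] compact_Int_closedin[OF Vk], simp)+
  have inv1: "clopen_inv X \<X> U = clopen_inv X \<X> V"
    unfolding clopen_inv_eq_iff
  proof (intro ballI conjI impI)
    fix A assume A: "A \<in> \<X>"
    show "U \<inter> A = {} \<longleftrightarrow> V \<inter> A = {}" using V_emp[OF A] by blast
    show "card (U \<inter> A) = card (V \<inter> A)" if "finite A"
      unfolding V_fin[OF A that] using FG[OF A] that by simp
    show "compactin X (U \<inter> X closure_of A) \<longleftrightarrow> compactin X (V \<inter> X closure_of A)"
      using Int_cl by blast
  qed
  have inv2: "clopen_inv X \<X> (S - U) = clopen_inv X \<X> (T - V)"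
    unfolding clopen_inv_eq_iff
  proof (intro ballI conjI impI)
    fix A assume A: "A \<in> \<X>"
    show "(S - U) \<inter> A = {} \<longleftrightarrow> (T - V) \<inter> A = {}"
    proof
      assume "(S - U) \<inter> A = {}"
      then have "A \<in> Q" using A by (simp add: Q_def)
      then have "T \<inter> A \<subseteq> Z" unfolding Z_def using cl[OF A] by blast
      then show "(T - V) \<inter> A = {}" using KV unfolding K_def by blast
    next
      assume "(T - V) \<inter> A = {}"
      moreover have "G A \<subseteq> (T - V) \<inter> A" using GT[OF A] VT A unfolding L_def by blast
      ultimately have "G A = {}" by blast
      then show "(S - U) \<inter> A = {}" using FG[OF A] by simp
    qed
    show "card ((S - U) \<inter> A) = card ((T - V) \<inter> A)" if fin: "finite A"
    proof -
      have "card ((S - U) \<inter> A) = card (S \<inter> A) - card (U \<inter> A)"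
        using fin U(2) unfolding Diff_Int_distrib2 by (intro card_Diff_subset) auto
      moreover have "card ((T - V) \<inter> A) = card (T \<inter> A) - card (V \<inter> A)"
        using fin VT unfolding Diff_Int_distrib2 by (intro card_Diff_subset) auto
      moreover have "card (S \<inter> A) = card (T \<inter> A)" "card (U \<inter> A) = card (V \<inter> A)"
        using eq inv1 A fin unfolding clopen_inv_eq_iff by blast+
      ultimately show ?thesis by simp
    qed
    \<comment> \<open>Removing a compact open part does not change whether the intersection with the
      closure of \<open>A\<close> is compact.\<close>
    have *: "compactin X (Y \<inter> X closure_of A) \<longleftrightarrow> compactin X ((Y - W) \<inter> X closure_of A)"
      if Y: "closedin X Y" "W \<subseteq> Y" "W \<in> compact_opens X" "compactin X (W \<inter> X closure_of A)" for Y W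
    proof
      assume c: "compactin X (Y \<inter> X closure_of A)"
      have "closedin X (Y - W)" using Y(1,3) by (auto simp: compact_opens_def)
      then have "closedin X ((Y - W) \<inter> X closure_of A)" by auto
      then show "compactin X ((Y - W) \<inter> X closure_of A)"
        by (intro closed_compactin[OF c]) auto
    next
      assume "compactin X ((Y - W) \<inter> X closure_of A)"
      then have "compactin X ((Y - W) \<inter> X closure_of A \<union> W \<inter> X closure_of A)"
        using Y(4) by (rule compactin_Un)
      moreover have "(Y - W) \<inter> X closure_of A \<union> W \<inter> X closure_of A = Y \<inter> X closure_of A"
        using Y(2) by blast
      ultimately show "compactin X (Y \<inter> X closure_of A)" by simp
    qed
    have "V \<subseteq> T" using VT by blast
    then show "compactin X ((S - U) \<inter> X closure_of A) \<longleftrightarrow> compactin X ((T - V) \<inter> X closure_of A)"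
      using *[OF S(2) U(2,1) Int_cl(1)] *[OF T(2) _ V Int_cl(2)] e(2)[OF A] by simp
  qed
  show ?thesis using V VT inv1 inv2 by blast
qed

section \<open>Cells of a tuple and transfer of truth between tuples\<close>

fun term_mem :: "bterm \<Rightarrow> nat set \<Rightarrow> bool" where
  "term_mem (TVar k) \<sigma> \<longleftrightarrow> k \<in> \<sigma>"
| "term_mem TZero \<sigma> \<longleftrightarrow> False"
| "term_mem (TAdd s t) \<sigma> \<longleftrightarrow> term_mem s \<sigma> \<noteq> term_mem t \<sigma>"
| "term_mem (TMult s t) \<sigma> \<longleftrightarrow> term_mem s \<sigma> \<and> term_mem t \<sigma>"

lemma term_mem_cong: "\<sigma> \<inter> term_vars t = \<tau> \<inter> term_vars t \<Longrightarrow> term_mem t \<sigma> = term_mem t \<tau>"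
proof (induction t)
  case (TAdd s t)
  have "term_mem s \<sigma> = term_mem s \<tau>" by (rule TAdd.IH) (use TAdd.prems in auto)
  moreover have "term_mem t \<sigma> = term_mem t \<tau>" by (rule TAdd.IH) (use TAdd.prems in auto)
  ultimately show ?case by simp
next
  case (TMult s t)
  have "term_mem s \<sigma> = term_mem s \<tau>" by (rule TMult.IH) (use TMult.prems in auto)
  moreover have "term_mem t \<sigma> = term_mem t \<tau>" by (rule TMult.IH) (use TMult.prems in auto)
  ultimately show ?case by simp
qed auto

text \<open>The sets with index in \<open>Pow V\<close> partition the space.
  \<open>cell X u V {}\<close> is the part outside all \<open>u i\<close> with
  \<open>i \<in> V\<close>, which need not be compact.\<close>

definition cell :: "'x topology \<Rightarrow> (nat \<Rightarrow> 'x set) \<Rightarrow> nat set \<Rightarrow> nat set \<Rightarrow> 'x set" where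
  "cell X u V \<sigma> = {x \<in> topspace X. {i \<in> V. x \<in> u i} = \<sigma>}"

lemma cell_cong: "(\<And>i. i \<in> V \<Longrightarrow> u i = v i) \<Longrightarrow> cell X u V \<sigma> = cell X v V \<sigma>"
  unfolding cell_def by (intro Collect_cong conj_cong refl arg_cong[of _ _ "\<lambda>A. A = \<sigma>"]) auto

lemma cell_disjoint: "\<sigma> \<noteq> \<tau> \<Longrightarrow> cell X u V \<sigma> \<inter> cell X u V \<tau> = {}"
  by (auto simp: cell_def)

lemma cell_insert_mem:
  assumes "j \<notin> V" "\<sigma> \<subseteq> V"
  shows "cell X u (insert j V) (insert j \<sigma>) = cell X u V \<sigma> \<inter> u j"
  using assms unfolding cell_def by auto

lemma cell_insert_notmem:
  assumes "j \<notin> V" "\<sigma> \<subseteq> V"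
  shows "cell X u (insert j V) \<sigma> = cell X u V \<sigma> - u j"
  using assms unfolding cell_def by auto

lemma subset_insert_cases:
  assumes "\<sigma> \<subseteq> insert j V" "j \<notin> V"
  obtains "\<sigma> \<subseteq> V" | \<tau> where "\<tau> \<subseteq> V" "\<sigma> = insert j \<tau>"
proof (cases "j \<in> \<sigma>")
  case True
  then show thesis using that(2)[of "\<sigma> - {j}"] assms by auto
next
  case False
  then show thesis using that(1) assms by auto
qed

lemma clopen_cell:
  assumes "finite V" "\<And>i. i \<in> V \<Longrightarrow> openin X (u i)" "\<And>i. i \<in> V \<Longrightarrow> closedin X (u i)" "\<sigma> \<subseteq> V"
  shows "openin X (cell X u V \<sigma>)" "closedin X (cell X u V \<sigma>)"
proof -
  have "openin X (cell X u V \<sigma>) \<and> closedin X (cell X u V \<sigma>)"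
    using assms
  proof (induction V arbitrary: \<sigma> rule: finite_induct)
    case empty
    then show ?case by (simp add: cell_def)
  next
    case (insert j V)
    have IH: "openin X (cell X u V \<tau>) \<and> closedin X (cell X u V \<tau>)" if "\<tau> \<subseteq> V" for \<tau>
      by (rule insert.IH) (use insert.prems that in auto)
    have j: "openin X (u j)" "closedin X (u j)" using insert.prems by auto
    from insert.prems(3) insert.hyps(2) show ?case
    proof (cases rule: subset_insert_cases)
      case 1
      then show ?thesis
        unfolding cell_insert_notmem[OF insert.hyps(2) 1] using IH[OF 1] j by (simp add: openin_diff closedin_diff)
    next
      case (2 \<tau>)
      show ?thesis
        unfolding 2(2) cell_insert_mem[OF insert.hyps(2) 2(1)] using IH[OF 2(1)] j
        by (simp add: openin_Int closedin_Int)
    qed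
  qed
  then show "openin X (cell X u V \<sigma>)" "closedin X (cell X u V \<sigma>)" by auto
qed

locale partitioned_representation = stone_representation X \<phi>
  for X :: "'x topology" and \<phi> :: "'r::ring \<Rightarrow> 'x set" +
  fixes \<X> :: "'x set set" and n :: nat and C :: "nat \<Rightarrow> 'x set" and J :: "nat \<Rightarrow> 'r set"
  assumes derived: "derived_partition X \<X>"
    and refines: "refines_family \<X> (C ` {1..n})"
    and ideals: "\<And>i. i \<in> {1..n} \<Longrightarrow> J i = ideal_of_closed \<phi> (C i)"
begin

abbreviation cell_of :: "(nat \<Rightarrow> 'r) \<Rightarrow> nat set \<Rightarrow> nat set \<Rightarrow> 'x set" where
  "cell_of e \<equiv> cell X (\<lambda>i. \<phi> (e i))"

definition sim :: "nat set \<Rightarrow> (nat \<Rightarrow> 'r) \<Rightarrow> (nat \<Rightarrow> 'r) \<Rightarrow> bool" where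
  "sim V e e' \<longleftrightarrow> (\<forall>\<sigma>\<subseteq>V. clopen_inv X \<X> (cell_of e V \<sigma>) = clopen_inv X \<X> (cell_of e' V \<sigma>))"

lemma clopen_cell_of:
  assumes "finite V" "\<sigma> \<subseteq> V"
  shows "openin X (cell_of e V \<sigma>)" "closedin X (cell_of e V \<sigma>)"
  using clopen_cell[OF assms(1) _ _ assms(2), of X "\<lambda>i. \<phi> (e i)"] rep_compact_open
    compact_open_closedin[OF rep_compact_open] by (auto simp: compact_opens_def)

lemma sim_sym: "sim V e e' \<Longrightarrow> sim V e' e"
  by (simp add: sim_def)

text \<open>A coarse cell is the disjoint union of two finer ones, according to membership in the
  \<open>j\<close>-th set.\<close>

lemma sim_restrict:
  assumes "sim (insert j V) e e'" "j \<notin> V" "finite V"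
  shows "sim V e e'"
  unfolding sim_def
proof (intro allI impI)
  fix \<sigma> assume \<sigma>: "\<sigma> \<subseteq> V"
  have fin: "finite (insert j V)" and sub: "\<sigma> \<subseteq> insert j V" "insert j \<sigma> \<subseteq> insert j V"
    using assms \<sigma> by auto
  have ne: "\<sigma> \<noteq> insert j \<sigma>" using \<sigma> assms(2) by auto
  have split: "cell_of f V \<sigma> = cell_of f (insert j V) \<sigma> \<union> cell_of f (insert j V) (insert j \<sigma>)" for f
    unfolding cell_insert_mem[OF assms(2) \<sigma>] cell_insert_notmem[OF assms(2) \<sigma>] by blast
  show "clopen_inv X \<X> (cell_of e V \<sigma>) = clopen_inv X \<X> (cell_of e' V \<sigma>)"
    unfolding split
    by (intro clopen_inv_Un clopen_cell_of[OF fin] sub cell_disjoint ne)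
      (use assms(1) sub in \<open>simp_all add: sim_def\<close>)
qed

text \<open>The set represented by \<open>a\<close> cuts every cell of \<open>e\<close> in a compact
  open part. A matching part \<open>W \<sigma>\<close> is chosen inside each cell of
  \<open>e'\<close>, and the union of these finitely many parts represents
  \<open>a'\<close>.\<close>

lemma sim_extend:
  assumes sim: "sim V e e'" and j: "j \<notin> V" and fin: "finite V"
  shows "\<exists>a'. sim (insert j V) (e(j := a)) (e'(j := a'))"
proof -
  have "\<exists>W. W \<in> compact_opens X \<and> W \<subseteq> cell_of e' V \<sigma> \<and>
      clopen_inv X \<X> (cell_of e V \<sigma> \<inter> \<phi> a) = clopen_inv X \<X> W \<and>
      clopen_inv X \<X> (cell_of e V \<sigma> - \<phi> a) = clopen_inv X \<X> (cell_of e' V \<sigma> - W)" if \<sigma>: "\<sigma> \<subseteq> V" for \<sigma>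
  proof -
    have "\<phi> a \<inter> cell_of e V \<sigma> \<in> compact_opens X"
      by (rule compact_opens_Int_closed[OF rep_compact_open clopen_cell_of[OF fin \<sigma>]])
    then have U: "cell_of e V \<sigma> \<inter> \<phi> a \<in> compact_opens X" by (simp add: Int_commute)
    have D: "cell_of e V \<sigma> - cell_of e V \<sigma> \<inter> \<phi> a = cell_of e V \<sigma> - \<phi> a" by blast
    have "clopen_inv X \<X> (cell_of e V \<sigma>) = clopen_inv X \<X> (cell_of e' V \<sigma>)"
      using sim \<sigma> by (simp add: sim_def)
    from clopen_inv_extension[OF derived clopen_cell_of[OF fin \<sigma>] clopen_cell_of[OF fin \<sigma>] this U Int_lower1]
    show ?thesis unfolding D .
  qed
  then obtain W where W: "\<And>\<sigma>. \<sigma> \<subseteq> V \<Longrightarrow> W \<sigma> \<in> compact_opens X \<and> W \<sigma> \<subseteq> cell_of e' V \<sigma> \<and>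
      clopen_inv X \<X> (cell_of e V \<sigma> \<inter> \<phi> a) = clopen_inv X \<X> (W \<sigma>) \<and>
      clopen_inv X \<X> (cell_of e V \<sigma> - \<phi> a) = clopen_inv X \<X> (cell_of e' V \<sigma> - W \<sigma>)" by metis
  have "\<Union>(W ` Pow V) \<in> compact_opens X"
    using fin W by (intro compact_opens_Union) auto
  then obtain a' where a': "\<phi> a' = \<Union>(W ` Pow V)" using ex_rep by blast
  have int: "cell_of e' V \<sigma> \<inter> \<phi> a' = W \<sigma>" if \<sigma>: "\<sigma> \<subseteq> V" for \<sigma>
  proof
    show "W \<sigma> \<subseteq> cell_of e' V \<sigma> \<inter> \<phi> a'" using W[OF \<sigma>] \<sigma> unfolding a' by blast
    show "cell_of e' V \<sigma> \<inter> \<phi> a' \<subseteq> W \<sigma>"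
    proof
      fix x assume x: "x \<in> cell_of e' V \<sigma> \<inter> \<phi> a'"
      then obtain \<tau> where \<tau>: "\<tau> \<subseteq> V" "x \<in> W \<tau>" unfolding a' by blast
      then have "x \<in> cell_of e' V \<tau>" using W[OF \<tau>(1)] by blast
      then have "\<sigma> = \<tau>" using x cell_disjoint[of \<sigma> \<tau> X "\<lambda>i. \<phi> (e' i)" V] by blast
      then show "x \<in> W \<sigma>" using \<tau> by simp
    qed
  qed
  have upd: "cell_of (f(j := b)) V \<sigma> = cell_of f V \<sigma>" for f b \<sigma>
    by (rule cell_cong) (use j in auto)
  have "sim (insert j V) (e(j := a)) (e'(j := a'))"
    unfolding sim_def
  proof (intro allI impI)
    fix \<sigma> assume "\<sigma> \<subseteq> insert j V"
    from this j show "clopen_inv X \<X> (cell_of (e(j := a)) (insert j V) \<sigma>) =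
        clopen_inv X \<X> (cell_of (e'(j := a')) (insert j V) \<sigma>)"
    proof (cases rule: subset_insert_cases)
      case 1
      have "cell_of e' V \<sigma> - \<phi> a' = cell_of e' V \<sigma> - W \<sigma>" using int[OF 1] by blast
      then show ?thesis
        unfolding cell_insert_notmem[OF j 1] upd using W[OF 1] by simp
    next
      case (2 \<tau>)
      show ?thesis
        unfolding 2(2) cell_insert_mem[OF j 2(1)] upd using W[OF 2(1)] int[OF 2(1)] by simp
    qed
  qed
  then show ?thesis ..
qed

lemma rep_term_val:
  "x \<in> \<phi> (term_val (system_of J) e t) \<longleftrightarrow> term_mem t {i. x \<in> \<phi> (e i)}"
  by (induction t) (auto simp: system_of_def rep_add rep_mult rep_zero)

lemma rep_term_val_cell:
  assumes "term_vars t \<subseteq> V" "x \<in> cell_of e V \<sigma>"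
  shows "x \<in> \<phi> (term_val (system_of J) e t) \<longleftrightarrow> term_mem t \<sigma>"
  unfolding rep_term_val by (rule term_mem_cong) (use assms in \<open>auto simp: cell_def\<close>)

text \<open>The failure of an atomic formula always has this shape: some cell with a property of its
  index meets a union of blocks. An equation fails if a nonempty cell distinguishes the terms, a
  predicate fails if a cell inside the term meets \<open>C i\<close>.\<close>

lemma sim_hits:
  assumes "sim V e e'" "\<S> \<subseteq> \<X>"
  shows "(\<exists>\<sigma>\<subseteq>V. P \<sigma> \<and> cell_of e V \<sigma> \<inter> \<Union>\<S> \<noteq> {}) \<longleftrightarrow> (\<exists>\<sigma>\<subseteq>V. P \<sigma> \<and> cell_of e' V \<sigma> \<inter> \<Union>\<S> \<noteq> {})"
proof -
  have "cell_of e V \<sigma> \<inter> A = {} \<longleftrightarrow> cell_of e' V \<sigma> \<inter> A = {}" if "\<sigma> \<subseteq> V" "A \<in> \<X>" for \<sigma> A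
    using assms(1) that unfolding sim_def clopen_inv_eq_iff by blast
  then have *: "\<And>\<sigma> A. \<sigma> \<subseteq> V \<Longrightarrow> A \<in> \<X> \<Longrightarrow> cell_of e V \<sigma> \<inter> A = {} \<longleftrightarrow> cell_of e' V \<sigma> \<inter> A = {}" .
  have "cell_of e V \<sigma> \<inter> \<Union>\<S> \<noteq> {} \<longleftrightarrow> cell_of e' V \<sigma> \<inter> \<Union>\<S> \<noteq> {}" if "\<sigma> \<subseteq> V" for \<sigma>
  proof -
    have "Z \<inter> \<Union>\<S> = {} \<longleftrightarrow> (\<forall>A\<in>\<S>. Z \<inter> A = {})" for Z by auto
    moreover have "(\<forall>A\<in>\<S>. cell_of e V \<sigma> \<inter> A = {}) \<longleftrightarrow> (\<forall>A\<in>\<S>. cell_of e' V \<sigma> \<inter> A = {})"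
      by (rule ball_cong[OF refl]) (use *[OF that] assms(2) in blast)
    ultimately show ?thesis by simp
  qed
  then show ?thesis by (intro ex_cong1 conj_cong refl)
qed

lemma ex_cell:
  assumes "x \<in> topspace X"
  shows "\<exists>\<sigma>\<subseteq>V. x \<in> cell_of e V \<sigma>"
  using assms by (intro exI[of _ "{i \<in> V. x \<in> \<phi> (e i)}"]) (auto simp: cell_def)

lemma sim_sat:
  assumes "finite V" "free_vars p \<subseteq> V" "pred_symbols p \<subseteq> {1..n}" "sim V e e'"
  shows "sat (system_of J) e p \<longleftrightarrow> sat (system_of J) e' p"
  using assms
proof (induction p arbitrary: V e e')
  case (Eq s t)
  have topX: "topspace X = \<Union>\<X>"
    using derived by (auto simp: derived_partition_def finite_crowded_partition_def dest: partition_onD1)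
  have "term_val (system_of J) f s \<noteq> term_val (system_of J) f t \<longleftrightarrow>
      (\<exists>\<sigma>\<subseteq>V. term_mem s \<sigma> \<noteq> term_mem t \<sigma> \<and> cell_of f V \<sigma> \<inter> \<Union>\<X> \<noteq> {})" for f
  proof
    assume "term_val (system_of J) f s \<noteq> term_val (system_of J) f t"
    then obtain x where x: "(x \<in> \<phi> (term_val (system_of J) f s)) \<noteq> (x \<in> \<phi> (term_val (system_of J) f t))"
      unfolding rep_eq_iff[symmetric] by blast
    then have xX: "x \<in> topspace X" using rep_subset by blast
    then obtain \<sigma> where \<sigma>: "\<sigma> \<subseteq> V" "x \<in> cell_of f V \<sigma>" using ex_cell by blast
    then have "term_mem s \<sigma> \<noteq> term_mem t \<sigma>"
      using x rep_term_val_cell[of _ V x f \<sigma>] Eq.prems(2) by simp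
    moreover have "x \<in> cell_of f V \<sigma> \<inter> \<Union>\<X>" using \<sigma>(2) xX by (simp only: topX[symmetric] Int_iff)
    ultimately show "\<exists>\<sigma>\<subseteq>V. term_mem s \<sigma> \<noteq> term_mem t \<sigma> \<and> cell_of f V \<sigma> \<inter> \<Union>\<X> \<noteq> {}"
      using \<sigma>(1) by blast
  next
    assume "\<exists>\<sigma>\<subseteq>V. term_mem s \<sigma> \<noteq> term_mem t \<sigma> \<and> cell_of f V \<sigma> \<inter> \<Union>\<X> \<noteq> {}"
    then obtain \<sigma> x where x: "term_mem s \<sigma> \<noteq> term_mem t \<sigma>" "x \<in> cell_of f V \<sigma>" by blast
    have "(x \<in> \<phi> (term_val (system_of J) f s)) \<noteq> (x \<in> \<phi> (term_val (system_of J) f t))"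
      using x rep_term_val_cell[of _ V x f \<sigma>] Eq.prems(2) by simp
    then show "term_val (system_of J) f s \<noteq> term_val (system_of J) f t" by auto
  qed
  note * = this
  show ?case
    unfolding sat.simps
    using *[of e] *[of e'] sim_hits[OF Eq.prems(4) subset_refl, of "\<lambda>\<sigma>. term_mem s \<sigma> \<noteq> term_mem t \<sigma>"]
    by argo
next
  case (Pred i t)
  have i: "i \<in> {1..n}" using Pred.prems(3) by simp
  then obtain \<S> where \<S>: "\<S> \<subseteq> \<X>" "C i = \<Union>\<S>" using refines unfolding refines_family_def by blast
  have pr: "pred_of (system_of J) i = {a. \<phi> a \<inter> C i = {}}"
    using ideals[OF i] by (simp add: system_of_def ideal_of_closed_def)
  have "\<phi> (term_val (system_of J) f t) \<inter> C i \<noteq> {} \<longleftrightarrow>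
      (\<exists>\<sigma>\<subseteq>V. term_mem t \<sigma> \<and> cell_of f V \<sigma> \<inter> \<Union>\<S> \<noteq> {})" for f
  proof
    assume "\<phi> (term_val (system_of J) f t) \<inter> C i \<noteq> {}"
    then obtain x where x: "x \<in> \<phi> (term_val (system_of J) f t)" "x \<in> \<Union>\<S>" unfolding \<S>(2) by blast
    have "x \<in> topspace X" using x(1) rep_subset by (rule subsetD[rotated])
    then obtain \<sigma> where \<sigma>: "\<sigma> \<subseteq> V" "x \<in> cell_of f V \<sigma>" using ex_cell by blast
    moreover have "term_mem t \<sigma>" using x \<sigma> rep_term_val_cell[of t V x f \<sigma>] Pred.prems(2) by simp
    moreover have "x \<in> cell_of f V \<sigma> \<inter> \<Union>\<S>" using \<sigma>(2) x(2) by (rule IntI)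
    ultimately show "\<exists>\<sigma>\<subseteq>V. term_mem t \<sigma> \<and> cell_of f V \<sigma> \<inter> \<Union>\<S> \<noteq> {}" by blast
  next
    assume "\<exists>\<sigma>\<subseteq>V. term_mem t \<sigma> \<and> cell_of f V \<sigma> \<inter> \<Union>\<S> \<noteq> {}"
    then obtain \<sigma> x where x: "term_mem t \<sigma>" "x \<in> cell_of f V \<sigma>" "x \<in> \<Union>\<S>" by blast
    then have "x \<in> \<phi> (term_val (system_of J) f t)"
      using rep_term_val_cell[of t V x f \<sigma>] Pred.prems(2) by simp
    then show "\<phi> (term_val (system_of J) f t) \<inter> C i \<noteq> {}" using x(3) \<S>(2) by blast
  qed
  note * = this
  show ?case
    unfolding sat.simps pr mem_Collect_eq
    using *[of e] *[of e'] sim_hits[OF Pred.prems(4) \<S>(1), of "term_mem t"] by argo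
next
  case (Neg p)
  have "sat (system_of J) e p \<longleftrightarrow> sat (system_of J) e' p"
    by (rule Neg.IH[of V]) (use Neg.prems in auto)
  then show ?case by simp
next
  case (Conj p q)
  have "sat (system_of J) e p \<longleftrightarrow> sat (system_of J) e' p" "sat (system_of J) e q \<longleftrightarrow> sat (system_of J) e' q"
    by (rule Conj.IH[of V]; use Conj.prems in auto)+
  then show ?case by simp
next
  case (Exists j p)
  \<comment> \<open>The bound variable is dropped from \<open>V\<close> first: its old value is
    overwritten, and \<open>sim_extend\<close> asks for a fresh index.\<close>
  define V0 where "V0 = V - {j}"
  have V0: "j \<notin> V0" "finite V0" "free_vars p \<subseteq> insert j V0" "finite (insert j V0)"
    using Exists.prems by (auto simp: V0_def)
  have sim0: "sim V0 e e'"
  proof (cases "j \<in> V")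
    case True
    then have "insert j V0 = V" by (auto simp: V0_def)
    then show ?thesis using sim_restrict[OF _ V0(1,2)] Exists.prems(4) by simp
  next
    case False
    then show ?thesis using Exists.prems(4) by (simp add: V0_def)
  qed
  have pr: "pred_symbols p \<subseteq> {1..n}" using Exists.prems(3) by simp
  have half: "sat (system_of J) f' (Exists j p)"
    if sim: "sim V0 f f'" and sat: "sat (system_of J) f (Exists j p)" for f f'
  proof -
    from sat obtain a where a: "sat (system_of J) (f(j := a)) p" unfolding sat.simps by blast
    obtain a' where "sim (insert j V0) (f(j := a)) (f'(j := a'))"
      using sim_extend[OF sim V0(1,2)] by blast
    from Exists.IH[OF V0(4,3) pr this] have "sat (system_of J) (f'(j := a')) p" using a by blast
    moreover have "a' \<in> univ (system_of J)" by (simp add: system_of_def)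
    ultimately show ?thesis unfolding sat.simps by blast
  qed
  show ?case using half[OF sim0] half[OF sim_sym[OF sim0]] by blast
qed

text \<open>Tagging by \<sigma> makes equality of values imply \<open>sim\<close>, while the range
  stays finite; this is the form in which the categoricity criterion takes its invariants.\<close>

definition type_inv :: "nat set \<Rightarrow> (nat \<Rightarrow> 'r) \<Rightarrow> (nat set \<times> ('x set \<times> nat \<times> bool \<times> bool) set) set" where
  "type_inv V e = (\<lambda>\<sigma>. (\<sigma>, clopen_inv X \<X> (cell_of e V \<sigma>))) ` Pow V"

lemma type_inv_imp_sim: "type_inv V e = type_inv V e' \<Longrightarrow> sim V e e'"
proof -
  assume eq: "type_inv V e = type_inv V e'"
  show "sim V e e'"
    unfolding sim_def
  proof (intro allI impI)
    fix \<sigma> assume "\<sigma> \<subseteq> V"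
    then have "(\<sigma>, clopen_inv X \<X> (cell_of e V \<sigma>)) \<in> type_inv V e'"
      unfolding eq[symmetric] by (simp add: type_inv_def)
    then show "clopen_inv X \<X> (cell_of e V \<sigma>) = clopen_inv X \<X> (cell_of e' V \<sigma>)"
      by (auto simp: type_inv_def)
  qed
qed

lemma finite_type_inv:
  assumes "finite V"
  shows "finite (range (type_inv V))"
proof (rule finite_subset)
  let ?F = "SIGMA A:\<X>. {..card A} \<times> (UNIV :: (bool \<times> bool) set)"
  have "finite \<X>" using derived by (simp add: derived_partition_def finite_crowded_partition_def)
  then have "finite ?F" by (intro finite_SigmaI) auto
  then show "finite (Pow (Pow V \<times> Pow ?F))" using assms by simp
  show "range (type_inv V) \<subseteq> Pow (Pow V \<times> Pow ?F)"
    using clopen_inv_subset by (fastforce simp: type_inv_def)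
qed

lemma derived_partition_imp_omega_categorical:
  assumes "countable (UNIV :: 'r set)"
  shows "omega_categorical n (system_of J)"
proof (rule finite_invariants_imp_omega_categorical[where I = "\<lambda>k. type_inv {..<k}"])
  show "wf_system n (system_of J)" by (simp add: wf_system_def system_of_def)
  show "countable (univ (system_of J))" using assms by (simp add: system_of_def)
  show "finite (type_inv {..<k} ` assignments (system_of J))" for k
    using finite_type_inv[of "{..<k}"] by (rule finite_subset[rotated]) auto
  show "agree n k (system_of J) e (system_of J) e'" if "type_inv {..<k} e = type_inv {..<k} e'" for k e e'
    unfolding agree_def using sim_sat[OF finite_lessThan _ _ type_inv_imp_sim[OF that]] by blast
qed

end

section \<open>Definability of the closure algebra\<close>

lemma definable_term_mem:
  assumes wf: "wf_system n M" and D: "definable n M (\<lambda>e. e 0 \<in> D)"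
  shows "definable n M (\<lambda>e. term_val M e t \<in> D)"
proof -
  obtain k where k: "k \<notin> term_vars t"
    using finite_term_vars ex_new_if_finite infinite_UNIV_nat by blast
  have tv: "term_val M (e(k := a)) t = term_val M e t" for e a
    by (rule term_val_cong) (use k in auto)
  note * = definable_ex[OF definable_conj[OF definable_term_eq[of n M "TVar k" t] definable_var_mem[OF D, of k]], of k]
  show ?thesis
    by (rule definable_cong[OF *]) (simp add: tv term_val_in_univ[OF wf])
qed

text \<open>Detectability, defined below, passes to unions, but to intersections only of closed sets
  and to differences only when a closed set is removed. Finite unions of differences
  \<open>E - G\<close> are therefore the normal form for members of the closure algebra.\<close>

inductive_set constructible :: "'x set set \<Rightarrow> 'x set set" for \<D> :: "'x set set" where
  constructible_diff: "E \<in> \<D> \<Longrightarrow> G \<in> \<D> \<Longrightarrow> E - G \<in> constructible \<D>"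
| constructible_Un: "A \<in> constructible \<D> \<Longrightarrow> B \<in> constructible \<D> \<Longrightarrow> A \<union> B \<in> constructible \<D>"

lemma algebra_constructible:
  assumes Un: "\<And>E G. E \<in> \<D> \<Longrightarrow> G \<in> \<D> \<Longrightarrow> E \<union> G \<in> \<D>"
    and Int: "\<And>E G. E \<in> \<D> \<Longrightarrow> G \<in> \<D> \<Longrightarrow> E \<inter> G \<in> \<D>"
    and sub: "\<D> \<subseteq> Pow \<Omega>" and top: "\<Omega> \<in> \<D>" and bot: "{} \<in> \<D>"
  shows "algebra \<Omega> (constructible \<D>)"
proof -
  have Int1: "A \<inter> (E - G) \<in> constructible \<D>" if "A \<in> constructible \<D>" "E \<in> \<D>" "G \<in> \<D>" for A E G
    using that(1)
  proof induction
    case (constructible_diff E' G')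
    have "(E' - G') \<inter> (E - G) = E' \<inter> E - (G' \<union> G)" by blast
    then show ?case using Un Int constructible_diff that by (simp add: constructible.constructible_diff)
  next
    case (constructible_Un A B)
    then show ?case unfolding Int_Un_distrib2 by (intro constructible.constructible_Un)
  qed
  have Int2: "A \<inter> B \<in> constructible \<D>" if "A \<in> constructible \<D>" "B \<in> constructible \<D>" for A B
    using that(2)
  proof induction
    case (constructible_diff E G)
    then show ?case by (rule Int1[OF that(1)])
  next
    case (constructible_Un B B')
    then show ?case unfolding Int_Un_distrib by (intro constructible.constructible_Un)
  qed
  show ?thesis
    unfolding algebra_iff_Un
  proof (intro conjI ballI)
    show "constructible \<D> \<subseteq> Pow \<Omega>"
    proof
      fix A assume "A \<in> constructible \<D>"
      then show "A \<in> Pow \<Omega>" by induction (use sub in auto)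
    qed
    show "{} \<in> constructible \<D>" using constructible_diff[OF bot bot] by simp
    show "A \<union> B \<in> constructible \<D>" if "A \<in> constructible \<D>" "B \<in> constructible \<D>" for A B
      using that by (rule constructible_Un)
    show "\<Omega> - A \<in> constructible \<D>" if "A \<in> constructible \<D>" for A
      using that
    proof induction
      case (constructible_diff E G)
      have "\<Omega> - (E - G) = (\<Omega> - E) \<union> (G - {})" using constructible_diff sub by blast
      moreover have "\<Omega> - E \<in> constructible \<D>" "G - {} \<in> constructible \<D>"
        by (rule constructible.constructible_diff[OF top constructible_diff(1)],
            rule constructible.constructible_diff[OF constructible_diff(2) bot])
      ultimately show ?case using constructible.constructible_Un by metis
    next
      case (constructible_Un A B)
      then show ?case unfolding Diff_Un by (intro Int2)
    qed
  qed
qed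

lemma ex_finite_algebra:
  assumes fin: "finite \<K>" and sub: "\<K> \<subseteq> Pow \<Omega>"
  obtains \<B> where "finite \<B>" "algebra \<Omega> \<B>" "\<K> \<subseteq> \<B>"
proof -
  define B where "B \<Sigma> = {x \<in> \<Omega>. {K \<in> \<K>. x \<in> K} \<in> \<Sigma>}" for \<Sigma> :: "'a set set set"
  let ?\<B> = "B ` Pow (Pow \<K>)"
  have "finite ?\<B>" using fin by simp
  moreover have "algebra \<Omega> ?\<B>"
    unfolding algebra_iff_Un
  proof (intro conjI ballI)
    show "?\<B> \<subseteq> Pow \<Omega>" by (auto simp: B_def)
    have "B {} = {}" by (simp add: B_def)
    then show "{} \<in> ?\<B>" by (metis Pow_bottom imageI)
    show "\<Omega> - A \<in> ?\<B>" if "A \<in> ?\<B>" for A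
    proof -
      from that obtain \<Sigma> where "\<Sigma> \<subseteq> Pow \<K>" "A = B \<Sigma>" by blast
      then have "\<Omega> - A = B (Pow \<K> - \<Sigma>)" by (auto simp: B_def)
      then show ?thesis by blast
    qed
    show "A \<union> A' \<in> ?\<B>" if "A \<in> ?\<B>" "A' \<in> ?\<B>" for A A'
    proof -
      from that obtain \<Sigma> \<Sigma>' where S: "\<Sigma> \<subseteq> Pow \<K>" "A = B \<Sigma>" "\<Sigma>' \<subseteq> Pow \<K>" "A' = B \<Sigma>'" by blast
      then have "A \<union> A' = B (\<Sigma> \<union> \<Sigma>')" by (auto simp: B_def)
      moreover have "\<Sigma> \<union> \<Sigma>' \<in> Pow (Pow \<K>)" using S by blast
      ultimately show ?thesis by blast
    qed
  qed
  moreover have "\<K> \<subseteq> ?\<B>"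
  proof
    fix K assume K: "K \<in> \<K>"
    then have "K = B {T \<in> Pow \<K>. K \<in> T}" using sub by (auto simp: B_def)
    then show "K \<in> ?\<B>" by blast
  qed
  ultimately show thesis using that by blast
qed

section \<open>Subsets of the Stone space whose ideals are definable\<close>

locale closed_ideals = stone_representation X \<phi>
  for X :: "'x topology" and \<phi> :: "'r::ring \<Rightarrow> 'x set" +
  fixes n :: nat and C :: "nat \<Rightarrow> 'x set" and J :: "nat \<Rightarrow> 'r set"
  assumes closed: "\<And>i. i \<in> {1..n} \<Longrightarrow> closedin X (C i)"
    and ideals: "\<And>i. i \<in> {1..n} \<Longrightarrow> J i = ideal_of_closed \<phi> (C i)"
begin

lemma wf_system_of: "wf_system n (system_of J)"
  by (simp add: wf_system_def system_of_def)

lemma system_of_sel: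
  "univ (system_of J) = UNIV" "zero_of (system_of J) = 0" "add_of (system_of J) = (+)"
  "mult_of (system_of J) = (*)" "pred_of (system_of J) = J"
  by (simp_all add: system_of_def)

lemma rep_diff: "\<phi> (a + a * b) = \<phi> a - \<phi> b"
  by (auto simp: rep_add rep_mult)

definition detectable :: "'x set \<Rightarrow> bool" where
  "detectable S \<longleftrightarrow> definable n (system_of J) (\<lambda>e. e 0 \<in> ideal_of_closed \<phi> S)"

lemma detectable_term:
  "detectable S \<Longrightarrow> definable n (system_of J) (\<lambda>e. \<phi> (term_val (system_of J) e t) \<inter> S = {})"
  using definable_term_mem[OF wf_system_of, of "ideal_of_closed \<phi> S" t]
  by (simp add: detectable_def ideal_of_closed_def)

lemma detectableI:
  assumes "definable n (system_of J) Q" "\<And>e. Q e \<longleftrightarrow> \<phi> (e 0) \<inter> S = {}"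
  shows "detectable S"
  unfolding detectable_def using assms(1)
  by (rule definable_cong) (simp add: assms(2) ideal_of_closed_def)

lemma detectable_generator: "i \<in> {1..n} \<Longrightarrow> detectable (C i)"
  using definable_pred[of i n "system_of J" "TVar 0"] ideals[of i]
  by (simp add: detectable_def system_of_def)

lemma detectable_empty: "detectable {}"
  by (rule detectableI[OF definable_term_eq[of n _ TZero TZero]]) simp

lemma detectable_topspace: "detectable (topspace X)"
proof (rule detectableI[OF definable_term_eq[of n _ "TVar 0" TZero]])
  fix e :: "nat \<Rightarrow> 'r"
  have "e 0 = 0 \<longleftrightarrow> \<phi> (e 0) = {}" using rep_eq_iff[of "e 0" 0] rep_zero by simp
  then show "term_val (system_of J) e (TVar 0) = term_val (system_of J) e TZero \<longleftrightarrow>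
      \<phi> (e 0) \<inter> topspace X = {}"
    using rep_subset[of "e 0"] by (simp add: system_of_sel Int_absorb2)
qed

lemma detectable_Un:
  assumes "detectable S" "detectable T"
  shows "detectable (S \<union> T)"
  by (rule detectableI[OF definable_conj[OF detectable_term[OF assms(1), of "TVar 0"]
          detectable_term[OF assms(2), of "TVar 0"]]]) auto

lemma openin_rep: "openin X (\<phi> a)"
  using rep_compact_open by (auto simp: compact_opens_def)

lemma detectable_closure:
  assumes "detectable S"
  shows "detectable (X closure_of S)"
  by (rule detectableI[OF detectable_term[OF assms, of "TVar 0"]])
    (simp add: openin_Int_closure_of_eq_empty[OF openin_rep])

text \<open>\<open>a\<close> misses \<open>E \<inter> F\<close> exactly if some \<open>b\<close>
  misses \<open>E\<close> and the rest of \<open>a\<close> misses \<open>F\<close>. Such a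
  \<open>b\<close> is found between the compact set \<open>\<phi> a \<inter> F\<close> and the
  complement of \<open>E\<close>.\<close>

lemma detectable_Int:
  assumes "closedin X E" "closedin X F" "detectable E" "detectable F"
  shows "detectable (E \<inter> F)"
proof -
  \<comment> \<open>In a Boolean ring of sets \<open>x + x * y\<close> is the difference of
    \<open>x\<close> and \<open>y\<close>.\<close>
  let ?d = "TAdd (TVar 0) (TMult (TVar 0) (TVar 1))"
  note * = definable_ex[OF definable_conj[OF detectable_term[OF assms(3), of "TVar 1"]
        detectable_term[OF assms(4), of ?d]], of 1]
  show ?thesis
  proof (rule detectableI[OF *])
    fix e :: "nat \<Rightarrow> 'r"
    have "(\<exists>b. \<phi> b \<inter> E = {} \<and> (\<phi> (e 0) - \<phi> b) \<inter> F = {}) \<longleftrightarrow> \<phi> (e 0) \<inter> (E \<inter> F) = {}"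
    proof
      assume "\<phi> (e 0) \<inter> (E \<inter> F) = {}"
      then have "\<phi> (e 0) \<inter> F \<subseteq> topspace X - E" using rep_subset by blast
      moreover have "compactin X (\<phi> (e 0) \<inter> F)"
        using rep_compact_open assms(2) by (auto simp: compact_opens_def intro: compact_Int_closedin)
      moreover have "openin X (topspace X - E)" using assms(1) by blast
      ultimately obtain U where U: "U \<in> compact_opens X" "\<phi> (e 0) \<inter> F \<subseteq> U" "U \<subseteq> topspace X - E"
        using compact_open_between by metis
      obtain b where "\<phi> b = U" using ex_rep[OF U(1)] by blast
      then show "\<exists>b. \<phi> b \<inter> E = {} \<and> (\<phi> (e 0) - \<phi> b) \<inter> F = {}" using U by blast
    qed blast
    then show "(\<exists>a\<in>univ (system_of J). \<phi> (term_val (system_of J) (e(1 := a)) (TVar 1)) \<inter> E = {} \<and>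
        \<phi> (term_val (system_of J) (e(1 := a)) ?d) \<inter> F = {}) \<longleftrightarrow> \<phi> (e 0) \<inter> (E \<inter> F) = {}"
      by (simp add: system_of_sel rep_diff)
  qed
qed

text \<open>The compact open sets that miss \<open>F\<close> cover its complement, so
  \<open>a\<close> misses \<open>Z - F\<close> as soon as all its intersections with them miss
  \<open>Z\<close>.\<close>

lemma detectable_Diff:
  assumes "closedin X F" "Z \<subseteq> topspace X" "detectable Z" "detectable F"
  shows "detectable (Z - F)"
proof -
  let ?m = "TMult (TVar 0) (TVar 1)"
  note * = definable_not[OF definable_ex[OF definable_conj[OF detectable_term[OF assms(4), of "TVar 1"]
        definable_not[OF detectable_term[OF assms(3), of ?m]]], of 1]]
  show ?thesis
  proof (rule detectableI[OF *])
    fix e :: "nat \<Rightarrow> 'r"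
    have "(\<forall>b. \<phi> b \<inter> F = {} \<longrightarrow> \<phi> (e 0) \<inter> \<phi> b \<inter> Z = {}) \<longleftrightarrow> \<phi> (e 0) \<inter> (Z - F) = {}"
    proof
      assume all: "\<forall>b. \<phi> b \<inter> F = {} \<longrightarrow> \<phi> (e 0) \<inter> \<phi> b \<inter> Z = {}"
      show "\<phi> (e 0) \<inter> (Z - F) = {}"
      proof (rule ccontr)
        assume "\<phi> (e 0) \<inter> (Z - F) \<noteq> {}"
        then obtain x where x: "x \<in> \<phi> (e 0)" "x \<in> Z" "x \<in> topspace X - F" using assms(2) by blast
        have "openin X (topspace X - F)" using assms(1) by blast
        then obtain U where U: "U \<in> compact_opens X" "x \<in> U" "U \<subseteq> topspace X - F"
          using compact_open_neighbourhood x(3) by metis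
        obtain b where "\<phi> b = U" using ex_rep[OF U(1)] by blast
        then show False using all U x by blast
      qed
    qed blast
    then show "(\<not> (\<exists>a\<in>univ (system_of J). \<phi> (term_val (system_of J) (e(1 := a)) (TVar 1)) \<inter> F = {} \<and>
        \<not> \<phi> (term_val (system_of J) (e(1 := a)) ?m) \<inter> Z = {})) \<longleftrightarrow> \<phi> (e 0) \<inter> (Z - F) = {}"
      by (simp add: system_of_sel rep_mult)
  qed
qed

abbreviation \<K> :: "'x set set" where
  "\<K> \<equiv> closure_subalgebra X (C ` {1..n})"

lemma generators_subset: "C ` {1..n} \<subseteq> Pow (topspace X)"
  using closed closedin_subset by blast

text \<open>The closed detectable sets form a lattice, so the sets constructible from them form an
  algebra. The closure of a member is closed and detectable, and thus back in the lattice.\<close>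

lemma detectable_closure_subalgebra:
  assumes "S \<in> \<K>"
  shows "detectable S"
proof -
  define \<D> where "\<D> = {E. closedin X E \<and> detectable E}"
  have sub: "\<D> \<subseteq> Pow (topspace X)" by (auto simp: \<D>_def dest: closedin_subset)
  have bot: "{} \<in> \<D>" by (simp add: \<D>_def detectable_empty)
  have alg: "algebra (topspace X) (constructible \<D>)"
  proof (rule algebra_constructible[OF _ _ sub _ bot])
    show "topspace X \<in> \<D>" by (simp add: \<D>_def detectable_topspace)
    show "E \<union> G \<in> \<D>" "E \<inter> G \<in> \<D>" if "E \<in> \<D>" "G \<in> \<D>" for E G
      using that by (simp_all add: \<D>_def detectable_Un detectable_Int closedin_Un closedin_Int)
  qed
  have det: "detectable A" if "A \<in> constructible \<D>" for A
    using that
  proof induction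
    case (constructible_diff E G)
    then show ?case using sub by (intro detectable_Diff) (auto simp: \<D>_def)
  qed (rule detectable_Un)
  have mem: "E \<in> constructible \<D>" if "E \<in> \<D>" for E
    using constructible_diff[OF that bot] by simp
  have "\<K> \<subseteq> constructible \<D>"
  proof (rule closure_subalgebra_minimal[OF _ alg])
    show "C ` {1..n} \<subseteq> constructible \<D>"
    proof
      fix S assume "S \<in> C ` {1..n}"
      then obtain i where "i \<in> {1..n}" "S = C i" by blast
      then show "S \<in> constructible \<D>"
        using closed[of i] detectable_generator[of i] by (intro mem) (simp add: \<D>_def)
    qed
    show "X closure_of S \<in> constructible \<D>" if "S \<in> constructible \<D>" for S
      by (rule mem) (simp add: \<D>_def detectable_closure det[OF that])
  qed
  then show ?thesis using assms det by blast
qed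

lemma ideal_of_closed_inj:
  assumes "closedin X E" "closedin X F" "ideal_of_closed \<phi> E = ideal_of_closed \<phi> F"
  shows "E \<subseteq> F"
proof
  fix x assume x: "x \<in> E"
  show "x \<in> F"
  proof (rule ccontr)
    assume "x \<notin> F"
    then have "x \<in> topspace X - F" using x assms(1) closedin_subset by blast
    moreover have "openin X (topspace X - F)" using assms(2) by blast
    ultimately obtain U where U: "U \<in> compact_opens X" "x \<in> U" "U \<subseteq> topspace X - F"
      using compact_open_neighbourhood by metis
    obtain b where b: "\<phi> b = U" using ex_rep[OF U(1)] by blast
    then have "b \<in> ideal_of_closed \<phi> F" using U by (auto simp: ideal_of_closed_def)
    then have "b \<in> ideal_of_closed \<phi> E" using assms(3) by simp
    then show False using b U x by (auto simp: ideal_of_closed_def)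
  qed
qed

text \<open>A closed set is determined by its ideal, so \<K> has finitely many closed members. They
  lie in a finite algebra \<B>, and \<open>\<B> \<inter> \<K>\<close> is closed under closure
  because closures of members of \<K> are among those closed members.\<close>

lemma finite_closure_subalgebra:
  assumes fin: "finite (unary_definable n (system_of J))"
  shows "finite \<K>"
proof -
  note alg = closure_subalgebra(1)[OF generators_subset]
  define \<E> where "\<E> = {E \<in> \<K>. closedin X E}"
  have "inj_on (ideal_of_closed \<phi>) \<E>"
    using ideal_of_closed_inj by (intro inj_onI subset_antisym) (auto simp: \<E>_def)
  moreover have "ideal_of_closed \<phi> ` \<E> \<subseteq> unary_definable n (system_of J)"
    using detectable_closure_subalgebra
    by (auto simp: \<E>_def unary_definable_def detectable_def system_of_sel)
  ultimately have "finite \<E>" using fin finite_imageD finite_subset by metis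
  moreover have "\<E> \<subseteq> Pow (topspace X)" by (auto simp: \<E>_def dest: closedin_subset)
  ultimately obtain \<B> where \<B>: "finite \<B>" "algebra (topspace X) \<B>" "\<E> \<subseteq> \<B>"
    using ex_finite_algebra by metis
  have "\<K> \<subseteq> \<B> \<inter> \<K>"
  proof (rule closure_subalgebra_minimal)
    show "C ` {1..n} \<subseteq> \<B> \<inter> \<K>"
    proof
      fix S assume S: "S \<in> C ` {1..n}"
      then have "S \<in> \<K>" using subset_closure_subalgebra by blast
      moreover have "closedin X S" using S closed by blast
      ultimately show "S \<in> \<B> \<inter> \<K>" using \<B>(3) by (auto simp: \<E>_def)
    qed
    show "algebra (topspace X) (\<B> \<inter> \<K>)"
      using \<B>(2) alg by (auto simp: algebra_iff_Un)
    show "X closure_of S \<in> \<B> \<inter> \<K>" if "S \<in> \<B> \<inter> \<K>" for S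
      using that closure_subalgebra(2)[OF generators_subset] \<B>(3) by (auto simp: \<E>_def)
  qed
  then show ?thesis using \<B>(1) by (meson finite_subset le_inf_iff)
qed

text \<open>The induction splits off a part meeting \<open>A\<close> that leaves at least \<open>k - 1\<close> points of \<open>A\<close>.\<close>

lemma definable_card_ge:
  assumes det: "detectable A"
  shows "definable n (system_of J) (\<lambda>e. e 0 \<in> {a. infinite (\<phi> a \<inter> A) \<or> k \<le> card (\<phi> a \<inter> A)})"
proof (induction k)
  case 0
  show ?case by (rule definable_cong[OF definable_term_eq[of n _ TZero TZero]]) simp
next
  case (Suc k)
  let ?D = "{a. infinite (\<phi> a \<inter> A) \<or> k \<le> card (\<phi> a \<inter> A)}"
  let ?d = "TAdd (TVar 0) (TMult (TVar 0) (TVar 1))"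
  note * = definable_ex[OF definable_conj[OF definable_not[OF detectable_term[OF det, of "TMult (TVar 0) (TVar 1)"]]
        definable_term_mem[OF wf_system_of Suc.IH, of ?d]], of 1]
  have iff: "(\<exists>b. \<phi> a \<inter> \<phi> b \<inter> A \<noteq> {} \<and> (infinite ((\<phi> a - \<phi> b) \<inter> A) \<or> k \<le> card ((\<phi> a - \<phi> b) \<inter> A))) \<longleftrightarrow>
      infinite (\<phi> a \<inter> A) \<or> Suc k \<le> card (\<phi> a \<inter> A)" for a
  proof
    assume "\<exists>b. \<phi> a \<inter> \<phi> b \<inter> A \<noteq> {} \<and> (infinite ((\<phi> a - \<phi> b) \<inter> A) \<or> k \<le> card ((\<phi> a - \<phi> b) \<inter> A))"
    then obtain b where b: "\<phi> a \<inter> \<phi> b \<inter> A \<noteq> {}"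
      "infinite ((\<phi> a - \<phi> b) \<inter> A) \<or> k \<le> card ((\<phi> a - \<phi> b) \<inter> A)" by blast
    show "infinite (\<phi> a \<inter> A) \<or> Suc k \<le> card (\<phi> a \<inter> A)"
    proof (rule disjCI)
      assume "\<not> Suc k \<le> card (\<phi> a \<inter> A)"
      show "infinite (\<phi> a \<inter> A)"
      proof
        assume fin: "finite (\<phi> a \<inter> A)"
        have sub: "(\<phi> a - \<phi> b) \<inter> A \<subset> \<phi> a \<inter> A" using b(1) by blast
        then have "finite ((\<phi> a - \<phi> b) \<inter> A)" using fin finite_subset by blast
        then have "k < card (\<phi> a \<inter> A)" using psubset_card_mono[OF fin sub] b(2) by simp
        then show False using \<open>\<not> Suc k \<le> card (\<phi> a \<inter> A)\<close> by simp
      qed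
    qed
  next
    assume "infinite (\<phi> a \<inter> A) \<or> Suc k \<le> card (\<phi> a \<inter> A)"
    then obtain P where P: "P \<subseteq> \<phi> a \<inter> A" "finite P" "card P = Suc k"
      using infinite_arbitrarily_large obtain_subset_with_card_n by metis
    then obtain x where x: "x \<in> P" by fastforce
    have PX: "P \<subseteq> topspace X" using P rep_subset by blast
    then have "closedin X (P - {x})" using P(2) t1 by (auto simp: t1_space_closedin_finite)
    then have "openin X (topspace X - (P - {x}))" by blast
    moreover have "x \<in> topspace X - (P - {x})" using x PX by blast
    \<comment> \<open>\<open>U\<close> separates \<open>x\<close> from the other \<open>k\<close>
      points of \<open>P\<close>, which stay in the difference.\<close>
    ultimately obtain U where U: "U \<in> compact_opens X" "x \<in> U" "U \<subseteq> topspace X - (P - {x})"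
      using compact_open_neighbourhood by metis
    obtain b where b: "\<phi> b = U" using ex_rep[OF U(1)] by blast
    have sub: "P - {x} \<subseteq> (\<phi> a - \<phi> b) \<inter> A" using P U b by blast
    have "infinite ((\<phi> a - \<phi> b) \<inter> A) \<or> k \<le> card ((\<phi> a - \<phi> b) \<inter> A)"
      using card_mono[OF _ sub] P x by auto
    moreover have "\<phi> a \<inter> \<phi> b \<inter> A \<noteq> {}" using x P U b by blast
    ultimately show "\<exists>b. \<phi> a \<inter> \<phi> b \<inter> A \<noteq> {} \<and>
        (infinite ((\<phi> a - \<phi> b) \<inter> A) \<or> k \<le> card ((\<phi> a - \<phi> b) \<inter> A))" by blast
  qed
  show ?case
  proof (rule definable_cong[OF *])
    fix e :: "nat \<Rightarrow> 'r"
    show "(\<exists>a\<in>univ (system_of J). \<not> \<phi> (term_val (system_of J) (e(1 := a)) (TMult (TVar 0) (TVar 1))) \<inter> A = {} \<and>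
        term_val (system_of J) (e(1 := a)) ?d \<in> ?D) \<longleftrightarrow>
        e 0 \<in> {a. infinite (\<phi> a \<inter> A) \<or> Suc k \<le> card (\<phi> a \<inter> A)}"
      using iff[of "e 0"] by (simp add: system_of_sel rep_diff rep_mult)
  qed
qed

text \<open>With infinitely many isolated points there is, for each \<open>k\<close>, a compact open
  set meeting \<open>A\<close> in exactly \<open>k\<close> points: a union of neighbourhoods that
  isolate them. So the definable sets \<open>?D k\<close> would be pairwise different.\<close>

lemma finite_isolated_points:
  assumes fin: "finite (unary_definable n (system_of J))" and A: "A \<in> \<K>"
  shows "finite (isolated_points X A)"
proof (rule ccontr)
  assume inf: "infinite (isolated_points X A)"
  let ?D = "\<lambda>k. {a. infinite (\<phi> a \<inter> A) \<or> k \<le> card (\<phi> a \<inter> A)}"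
  have D: "?D k \<in> unary_definable n (system_of J)" for k
    using definable_card_ge[OF detectable_closure_subalgebra[OF A], of k]
    by (simp add: unary_definable_def system_of_sel)
  have AX: "A \<subseteq> topspace X"
    using A closure_subalgebra(1)[OF generators_subset] algebra_subset_Pow by blast
  have ex: "\<exists>a. finite (\<phi> a \<inter> A) \<and> card (\<phi> a \<inter> A) = k" for k
  proof -
    obtain P where P: "P \<subseteq> isolated_points X A" "finite P" "card P = k"
      using infinite_arbitrarily_large[OF inf] by blast
    have "\<exists>U. U \<in> compact_opens X \<and> U \<inter> A = {x}" if "x \<in> P" for x
    proof -
      have x: "x \<in> A" "x \<notin> X derived_set_of A" using that P(1) isolated_points_eq[OF AX] by auto
      then obtain W where W: "openin X W" "x \<in> W" "\<forall>y. y \<noteq> x \<longrightarrow> y \<in> A \<longrightarrow> y \<notin> W"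
        using AX unfolding in_derived_set_of by blast
      then obtain U where "U \<in> compact_opens X" "x \<in> U" "U \<subseteq> W"
        using compact_open_neighbourhood by metis
      then show ?thesis using W x by blast
    qed
    then obtain U where U: "\<And>x. x \<in> P \<Longrightarrow> U x \<in> compact_opens X \<and> U x \<inter> A = {x}" by metis
    have "\<Union>(U ` P) \<in> compact_opens X" using P(2) U by (intro compact_opens_Union) auto
    then obtain a where a: "\<phi> a = \<Union>(U ` P)" using ex_rep by blast
    have "\<phi> a \<inter> A = (\<Union>x\<in>P. U x \<inter> A)" unfolding a by blast
    also have "\<dots> = P" using U by auto
    finally show ?thesis using P by auto
  qed
  have "inj ?D"
  proof (rule linorder_injI)
    fix k l :: nat assume "k < l"
    obtain a where "finite (\<phi> a \<inter> A)" "card (\<phi> a \<inter> A) = k" using ex by blast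
    then have "a \<in> ?D k" "a \<notin> ?D l" using \<open>k < l\<close> by auto
    then show "?D k \<noteq> ?D l" by blast
  qed
  then have "infinite (range ?D)" by (rule range_inj_infinite)
  then show False using fin D finite_subset[of "range ?D"] by blast
qed

lemma omega_categorical_imp_finite_closure_subalgebra:
  assumes "omega_categorical n (system_of J)"
  shows "finite \<K>" and "A \<in> \<K> \<Longrightarrow> finite (isolated_points X A)"
  using finite_closure_subalgebra finite_isolated_points
    omega_categorical_finite_unary_definable[OF wf_system_of assms] by blast+

end

section \<open>The characterisation\<close>

theorem theorem1:
  fixes X :: "'x topology" and \<phi> :: "'r::ring \<Rightarrow> 'x set"
    and n :: nat and J :: "nat \<Rightarrow> 'r set" and C :: "nat \<Rightarrow> 'x set"
  assumes boolean: "\<forall>a::'r. a * a = a"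
    and countable: "countable (UNIV :: 'r set)"
    and stone: "stone_space X \<phi>"
    and ideals: "\<forall>i\<in>{1..n}. ring_ideal (J i)"
    and closed: "\<forall>i\<in>{1..n}. closedin X (C i)"
    and corresponds: "\<forall>i\<in>{1..n}. J i = ideal_of_closed \<phi> (C i)"
  defines "\<C> \<equiv> C ` {1..n}"
  defines "S1 \<equiv> omega_categorical n (system_of J)"
    and "S2 \<equiv> finite (closure_subalgebra X \<C>) \<and>
               (\<forall>A \<in> atoms (closure_subalgebra X \<C>). finite (isolated_points X A))"
    and "S3 \<equiv> finite (derived_subalgebra X \<C>) \<and>
               finite_crowded_partition X (atoms (derived_subalgebra X \<C>))"
    and "S4 \<equiv> finite_crowded_complete_partition X (atoms (derived_subalgebra X \<C>))"
    and "S5 \<equiv> \<exists>\<X>. finite_crowded_complete_partition X \<X> \<and> refines_family \<X> \<C>"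
  shows "(S1 \<longleftrightarrow> S2) \<and> (S2 \<longleftrightarrow> S3) \<and> (S3 \<longleftrightarrow> S4) \<and> (S4 \<longleftrightarrow> S5)"
proof -
  interpret rep: closed_ideals X \<phi> n C J
    using stone closed corresponds by unfold_locales auto
  have cl: "closedin X S" if "S \<in> \<C>" for S using that closed by (auto simp: \<C>_def)
  have \<C>P: "\<C> \<subseteq> Pow (topspace X)" using cl closedin_subset by blast
  note t1 = rep.t1
  have S2_derived: "\<exists>\<X>. derived_partition X \<X> \<and> refines_family \<X> \<C>" if S2
    using finite_closure_subalgebra_imp_derived_partition[OF t1 cl] that unfolding S2_def by metis
  have derived_S3: S3 if "derived_partition X \<X>" "refines_family \<X> \<C>" for \<X>
    using derived_partition_imp_finite_derived_subalgebra[OF t1 that] unfolding S3_def by blast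
  have derived_S1: S1 if "derived_partition X \<X>" "refines_family \<X> \<C>" for \<X>
  proof -
    interpret partitioned_representation X \<phi> \<X> n C J
      using that corresponds by unfold_locales (auto simp: \<C>_def)
    show ?thesis unfolding S1_def by (rule derived_partition_imp_omega_categorical[OF countable])
  qed
  have S1_S2: S2 if S1
    using rep.omega_categorical_imp_finite_closure_subalgebra that
    unfolding S1_def S2_def \<C>_def by (auto simp: atoms_def)
  have S3_S2: S2 if S3
    using finite_derived_imp_finite_closure_subalgebra[of \<C> X, OF cl] that unfolding S2_def S3_def by blast
  have S3_S4: S4 if S3
    using derived_subalgebra_atoms_complete[of X \<C>, OF t1 cl] that unfolding S3_def S4_def by blast
  have S4_S5: S5 if S4
  proof -
    have "partition_on (topspace X) (atoms (derived_subalgebra X \<C>))"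
      using that
      by (simp add: S4_def finite_crowded_complete_partition_def finite_crowded_partition_def)
    then have "refines_family (atoms (derived_subalgebra X \<C>)) \<C>"
      by (rule atoms_refine_family[OF subset_derived_subalgebra derived_subalgebra(1)[OF \<C>P]])
    then show ?thesis using that unfolding S4_def S5_def by blast
  qed
  have S5_derived: "\<exists>\<X>. derived_partition X \<X> \<and> refines_family \<X> \<C>" if S5
    using that finite_crowded_complete_imp_derived_partition unfolding S5_def by blast
  \<comment> \<open>Both \<open>S2\<close> and \<open>S5\<close> lead to a derived partition, from
    which \<open>S1\<close> and \<open>S3\<close> follow; \<open>S1\<close> and \<open>S3\<close>
    return to \<open>S2\<close>, and \<open>S3\<close> leads to \<open>S5\<close> through
    \<open>S4\<close>.\<close>
  show ?thesis
    using S1_S2 S2_derived derived_S1 derived_S3 S3_S2 S3_S4 S4_S5 S5_derived by blast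
qed

end
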